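(* Assume the setting and assumptions (i)–(ix) described in the context, and $\mathbb{E}(e^{2\imath j\eta_\sigma})\ne1$ for $j=1,2$. Then the Lyapunov exponent satisfies $$\gamma^{\epsilon,\delta}=\mathcal{C}\,\delta+\mathcal{D}\,\epsilon^2+\mathcal{O}(\epsilon^3,\epsilon\delta,\delta^2).$$
   Context: Notation: $J=\mathrm{diag}(1,-1)$; $\mathrm{SU}(1,1)=\{T\in\mathbb{C}^{2\times2}:T^*JT=J,\det T=1\}$; $\mathrm{SU}_{\le}(1,1)=\{T:T^*JT\le J,\det T=1\}$; $\mathfrak{su}(1,1)=\{A\in\mathbb{C}^{2\times2}:A^*J=-JA,\ \mathrm{Tr}A=0\}$ with real basis $B_1=\begin{pmatrix}0&1\\1&0\end{pmatrix}$, $B_2=\begin{pmatrix}0&\imath\\-\imath&0\end{pmatrix}$, $B_3=\begin{pmatrix}\imath&0\\0&-\imath\end{pmatrix}$; $R_\eta=\mathrm{diag}(e^{\imath\eta},e^{-\imath\eta})$; Möbius action $T\cdot z=\frac{az+b}{cz+d}$ on $\overline{\mathbb C}$ for $T=\begin{pmatrix}a&b\\c&d\end{pmatrix}$. Setting: $(\Sigma,\mathbb P)$ a probability space with expectation $\mathbb E$; for real $(\epsilon,\delta)$ near $(0,0)$, a random family $T^{\epsilon,\delta}_\sigma\in\mathrm{SL}(2,\mathbb C)$ with: (i) $(\epsilon,\delta)\mapsto T^{\epsilon,\delta}_\sigma$ is $C^2$ near $(0,0)$; (ii) $T^{0,0}_\sigma=R_{\eta_\sigma}$, $\eta_\sigma\in[0,2\pi)$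 random; (iii) $T^{\epsilon,0}_\sigma\in\mathrm{SU}(1,1)$; (iv) $T^{0,\imath\delta}_\sigma\in\mathrm{SU}(1,1)$; (v) $T^{\epsilon,\delta}_\sigma\in\mathrm{SU}_\le(1,1)$ for $\delta\ge0$; $T^{\epsilon,\delta}_\sigma=R_{\eta_\sigma}\exp[\epsilon P_\sigma+\epsilon^2P'_\sigma+\imath\delta Q_\sigma+\mathcal{O}(\epsilon^3,\epsilon\delta,\delta^2)]$ with random $P_\sigma,P'_\sigma,Q_\sigma\in\mathfrak{su}(1,1)$, (vi) uniformly bounded, (vii) the error term bounded by $C(\epsilon^3+\epsilon\delta+\delta^2)$ uniformly; for $(\epsilon,\delta)\ne(0,0)$: (viii) every finite $F\subset\overline{\mathbb C}$ satisfies $\mathrm{supp}(T^{\epsilon,\delta}_\sigma)\cdot F\not\subset F$, and (ix) the semigroup generated by $\mathrm{supp}(T^{\epsilon,\delta}_\sigma)$ is not relatively compact. Write $P_\sigma=\sum_jp_{j,\sigma}B_j$, $Q_\sigma=\sum_jq_{j,\sigma}B_j$ (real coefficients), $\beta_\sigma=p_{1,\sigma}-\imath p_{2,\sigma}$, $\mathcal{C}=\mathbb{E}(q_{3,\sigma})$, $\mathcal{D}=\frac12\mathbb{E}(|\beta_\sigma|^2)+\mathrm{Re}\Big(\frac{\mathbb{E}(\beta_\sigma)\mathbb{E}(e^{2\imath\eta_\sigma}\overline{\beta_\sigma})}{1-\mathbb{E}(e^{2\imath\eta_\sigma})}\Big)$. The Lyapunov exponent is $\gamma^{\epsilon,\delta}=\lim_{N\to\infty}\frac1N\log\|T_N\cdots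 T_1\|$ where $T_n$ are i.i.d. copies of $T^{\epsilon,\delta}_\sigma$. $\mathcal{O}(\cdot)$ denotes a bound by a constant (independent of $\epsilon,\delta$) times the sum of the listed quantities, for small $\epsilon$ and small $\delta\ge0$. *)

theory Defs
  imports "HOL-Analysis.Analysis" "HOL-Probability.Probability"
begin

type_synonym cmat = "complex^2^2"

definition mat2 :: "complex \<Rightarrow> complex \<Rightarrow> complex \<Rightarrow> complex \<Rightarrow> cmat" where
  "mat2 a b c d = vector [vector [a, b], vector [c, d]]"

definition Jmat :: cmat where "Jmat = mat2 1 0 0 (-1)"

definition B1 :: cmat where "B1 = mat2 0 1 1 0"
definition B2 :: cmat where "B2 = mat2 0 \<i> (-\<i>) 0"
definition B3 :: cmat where "B3 = mat2 \<i> 0 0 (-\<i>)"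

definition Rrot :: "real \<Rightarrow> cmat" where
  "Rrot \<eta> = mat2 (exp (\<i> * of_real \<eta>)) 0 0 (exp (- \<i> * of_real \<eta>))"

definition csc :: "complex \<Rightarrow> cmat \<Rightarrow> cmat" (infixr "*\<^sub>c" 75) where
  "c *\<^sub>c A = (\<chi> i j. c * A $ i $ j)"

definition adj :: "cmat \<Rightarrow> cmat" where
  "adj A = (\<chi> i j. cnj (A $ j $ i))"

definition mtrace :: "cmat \<Rightarrow> complex" where
  "mtrace A = A $ 1 $ 1 + A $ 2 $ 2"

definition qform :: "cmat \<Rightarrow> complex^2 \<Rightarrow> complex" where
  "qform H v = (\<Sum>i\<in>UNIV. \<Sum>j\<in>UNIV. cnj (v $ i) * H $ i $ j * v $ j)"

definition psd :: "cmat \<Rightarrow> bool" where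
  "psd H \<longleftrightarrow> (\<forall>v. qform H v \<in> \<real> \<and> Re (qform H v) \<ge> 0)"

definition SU11 :: "cmat set" where
  "SU11 = {T. adj T ** Jmat ** T = Jmat \<and> det T = 1}"

definition SU11_le :: "cmat set" where
  "SU11_le = {T. psd (Jmat - adj T ** Jmat ** T) \<and> det T = 1}"

definition su11 :: "cmat set" where
  "su11 = {A. adj A ** Jmat = - (Jmat ** A) \<and> mtrace A = 0}"

primrec mpow :: "cmat \<Rightarrow> nat \<Rightarrow> cmat" where
  "mpow A 0 = mat 1"
| "mpow A (Suc n) = A ** mpow A n"

definition mexp :: "cmat \<Rightarrow> cmat" where
  "mexp A = (\<Sum>k. (1 / fact k) *\<^sub>R mpow A k)"

primrec mprod :: "(nat \<Rightarrow> cmat) \<Rightarrow> nat \<Rightarrow> cmat" where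
  "mprod A 0 = mat 1"
| "mprod A (Suc n) = A n ** mprod A n"

text \<open>Moebius action on the Riemann sphere, modelled as complex option (None = infinity)\<close>
definition moebius :: "cmat \<Rightarrow> complex option \<Rightarrow> complex option" where
  "moebius T z = (let a = T$1$1; b = T$1$2; c = T$2$1; d = T$2$2 in
     (case z of
        None \<Rightarrow> (if c = 0 then None else Some (a / c))
      | Some w \<Rightarrow> (if c * w + d = 0 then None else Some ((a * w + b) / (c * w + d)))))"

definition rsupp :: "'s measure \<Rightarrow> ('s \<Rightarrow> cmat) \<Rightarrow> cmat set" where
  "rsupp M X = {A. \<forall>e>0. measure M {s \<in> space M. dist (X s) A < e} > 0}"

definition semigroup_gen :: "cmat set \<Rightarrow> cmat set" where
  "semigroup_gen S = {mprod A n | A n. n \<ge> 1 \<and> (\<forall>i<n. A i \<in> S)}"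

definition lyap :: "'s measure \<Rightarrow> ('s \<Rightarrow> cmat) \<Rightarrow> real" where
  "lyap M X = (THE g. AE w in PiM UNIV (\<lambda>_::nat. M).
      (\<lambda>N. ln (norm (mprod (\<lambda>n. X (w n)) N)) / real N) \<longlonglongrightarrow> g)"

definition C2_near :: "(real \<times> real \<Rightarrow> cmat) \<Rightarrow> real \<times> real \<Rightarrow> bool" where
  "C2_near f x0 \<longleftrightarrow> (\<exists>U D1 D2. open U \<and> x0 \<in> U \<and>
     (\<forall>x\<in>U. (f has_derivative blinfun_apply (D1 x)) (at x) \<and>
             (D1 has_derivative blinfun_apply (D2 x)) (at x)) \<and>
     continuous_on U D2)"

end

theory Submission
  imports Defs "HOL-Real_Asymp.Real_Asymp"
begin

text \<open>Matrices in \<open>SU11_le\<close> map the closed unit disc into itself. If \<open>z\<close> is the image of 0 under the first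
  \<open>n\<close> factors, then up to a bounded error the logarithm of the norm of the product is the sum of
  \<open>ln \<bar>c z + d\<bar>\<close> along the orbit. Averaging over the last factor, which is independent of \<open>z\<close>, expresses
  the expectation of this sum through the Cesaro means \<open>m1\<close>, \<open>m2\<close> of the expectations of \<open>z\<close> and \<open>z\<^sup>2\<close>.
  The action on the disc is a rotation up to \<open>O(\<bar>e\<bar> + d)\<close>, so telescoping and nonresonance determine \<open>m1\<close>
  to first order and show that \<open>m2\<close> is small; inserting this gives the expansion of the exponent.

  That the exponent exists as an almost sure limit is the subadditive ergodic theorem. For independent factors
  the upper bound is a Chernoff estimate with the Borel-Cantelli lemma. For the lower bound, Steele's greedy
  decomposition into blocks of slope at most \<open>liminf\<close> shows that the expectation of the \<open>liminf\<close> is at least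
  the limit of the normalised expectations; with the upper bound this forces equality almost surely.\<close>

section \<open>Bounded subadditive functions of independent sequences\<close>

text \<open>In the expected logarithm the mean of \<open>z\<close> has a coefficient
  \<open>e * b1 + O(e^2 + d)\<close> and the mean of \<open>z^2\<close> one of order
  \<open>e^2\<close>; so the former is needed up to \<open>O(e^2 + d)\<close>, the latter only up to
  \<open>O(\<bar>e\<bar> + d)\<close>. A rotation multiplies \<open>z^j\<close> by
  \<open>exp (2 i j eta)\<close>, hence the stationarity relation for the j-th moment can be solved
  when the mean of this factor is not 1, which is where j = 1, 2 come from. The fraction in the
  coefficient of \<open>e^2\<close> is \<open>b1\<close> times the leading coefficient of the first
  moment. No invariant measure is constructed: a limit point of two numbers suffices, chosen anew
  for each parameter. Since \<open>lyap\<close> is a definite description, estimates of expected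
  logarithms say nothing about it until the almost sure limit is known to exist and to be the limit
  of the normalised expectations.\<close>

definition shift_seq :: "nat \<Rightarrow> (nat \<Rightarrow> 'a) \<Rightarrow> nat \<Rightarrow> 'a" where
  "shift_seq m \<omega> = (\<lambda>i. \<omega> (i + m))"

lemma shift_seq_comb_seq [simp]: "shift_seq n (comb_seq n \<omega> \<omega>') = \<omega>'"
  by (simp add: shift_seq_def comb_seq_add)

lemma shift_seq_shift_seq: "shift_seq m (shift_seq n \<omega>) = shift_seq (m + n) \<omega>"
  by (simp add: shift_seq_def add.assoc)

lemma shift_seq_0 [simp]: "shift_seq 0 \<omega> = \<omega>"
  by (simp add: shift_seq_def)

context sequence_space
begin

lemma measurable_shift_seq [measurable]: "shift_seq m \<in> measurable S S"
  unfolding shift_seq_def by (rule measurable_PiM_single') (auto simp: space_PiM PiE_iff)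

lemma shift_seq_space: "\<omega> \<in> space S \<Longrightarrow> shift_seq m \<omega> \<in> space S"
  using measurable_shift_seq by (rule measurable_space)

lemma comb_seq_space: "\<omega> \<in> space S \<Longrightarrow> \<omega>' \<in> space S \<Longrightarrow> comb_seq n \<omega> \<omega>' \<in> space S"
  by (auto simp: space_PiM PiE_iff comb_seq_def)

lemma integrable_bounded:
  fixes f :: "_ \<Rightarrow> 'b::{banach, second_countable_topology}"
  assumes "f \<in> borel_measurable S" "\<And>\<omega>. \<omega> \<in> space S \<Longrightarrow> norm (f \<omega>) \<le> B"
  shows "integrable S f"
  by (rule P.integrable_const_bound[of _ B]) (use assms in auto)

text \<open>Cutting a sequence at time \<open>n\<close> identifies \<open>S\<close> with two
  independent copies of itself, and Fubini applies. Independence of the factors is used below only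
  in this form.\<close>

lemma integral_split:
  fixes f :: "_ \<Rightarrow> 'b::{banach, second_countable_topology}"
  assumes [measurable]: "f \<in> borel_measurable S"
    and bd: "\<And>\<omega>. \<omega> \<in> space S \<Longrightarrow> norm (f \<omega>) \<le> B"
  shows "(\<integral>\<omega>. f \<omega> \<partial>S) = (\<integral>\<omega>. (\<integral>\<omega>'. f (comb_seq n \<omega> \<omega>') \<partial>S) \<partial>S)"
proof -
  interpret PP: pair_prob_space S S ..
  have int: "integrable (S \<Otimes>\<^sub>M S) (\<lambda>(\<omega>, \<omega>'). f (comb_seq n \<omega> \<omega>'))"
    by (rule PP.P.integrable_const_bound[of _ B])
      (auto simp: space_pair_measure intro!: AE_I2 bd comb_seq_space)
  have "(\<integral>\<omega>. f \<omega> \<partial>S) = (\<integral>\<omega>. f \<omega> \<partial>distr (S \<Otimes>\<^sub>M S) S (\<lambda>(\<omega>, \<omega>'). comb_seq n \<omega> \<omega>'))"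
    by (simp only: PiM_comb_seq)
  also have "\<dots> = (\<integral>x. f (case x of (\<omega>, \<omega>') \<Rightarrow> comb_seq n \<omega> \<omega>') \<partial>(S \<Otimes>\<^sub>M S))"
    by (rule integral_distr) auto
  also have "\<dots> = (\<integral>\<omega>. (\<integral>\<omega>'. f (comb_seq n \<omega> \<omega>') \<partial>S) \<partial>S)"
    using PP.integral_fst'[of "\<lambda>x. f (case x of (\<omega>, \<omega>') \<Rightarrow> comb_seq n \<omega> \<omega>')"] int
    by (simp add: case_prod_unfold)
  finally show ?thesis .
qed

lemma integral_shift_seq:
  fixes f :: "_ \<Rightarrow> 'b::{banach, second_countable_topology}"
  assumes [measurable]: "f \<in> borel_measurable S"
    and bd: "\<And>\<omega>. \<omega> \<in> space S \<Longrightarrow> norm (f \<omega>) \<le> B"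
  shows "(\<integral>\<omega>. f (shift_seq m \<omega>) \<partial>S) = (\<integral>\<omega>. f \<omega> \<partial>S)"
proof -
  have "(\<integral>\<omega>. f (shift_seq m \<omega>) \<partial>S) = (\<integral>\<omega>. (\<integral>\<omega>'. f (shift_seq m (comb_seq m \<omega> \<omega>')) \<partial>S) \<partial>S)"
    by (rule integral_split[of _ B]) (auto intro: bd shift_seq_space)
  also have "\<dots> = (\<integral>\<omega>. f \<omega> \<partial>S)"
    by (simp add: P.prob_space)
  finally show ?thesis .
qed

lemma integral_component:
  fixes f :: "_ \<Rightarrow> 'b::{banach, second_countable_topology}"
  assumes [measurable]: "f \<in> borel_measurable M"
  shows "(\<integral>\<omega>. f (\<omega> n) \<partial>S) = (\<integral>s. f s \<partial>M)"
proof -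
  have "(\<integral>s. f s \<partial>M) = (\<integral>s. f s \<partial>distr S M (\<lambda>\<omega>. \<omega> n))"
    using PiM_component[of n] by simp
  also have "\<dots> = (\<integral>\<omega>. f (\<omega> n) \<partial>S)"
    by (rule integral_distr) auto
  finally show ?thesis ..
qed

end

lemma exp_le_quadratic:
  fixes x :: real
  assumes "\<bar>x\<bar> \<le> 1"
  shows "exp x \<le> 1 + x + x\<^sup>2"
proof (cases "x \<ge> 0")
  case True
  then show ?thesis using exp_bound[of x] assms by auto
next
  case False
  then have "x < 0" by auto
  \<comment> \<open>A negative argument is handled through the reciprocal: the quadratic lower bound
    for \<open>exp (-x)\<close> times the claimed upper bound is at least 1.\<close>
  have "1 + (-x) + (-x)\<^sup>2/2 \<le> exp (-x)"
    using exp_lower_Taylor_quadratic[of "-x"] \<open>x<0\<close> by auto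
  moreover have "1 \<le> (1 + (-x) + (-x)\<^sup>2/2) * (1 + x + x\<^sup>2)"
  proof -
    have "(1 + (-x) + (-x)\<^sup>2/2) * (1 + x + x\<^sup>2) - 1 = x\<^sup>2 * (1 - x + x\<^sup>2) / 2"
      by (simp add: power2_eq_square field_simps)
    also have "\<dots> \<ge> 0" using \<open>x<0\<close> by simp
    finally show ?thesis by simp
  qed
  moreover have "1 + x + x\<^sup>2 \<ge> 0" using assms \<open>x<0\<close> by (smt (verit) zero_le_power2)
  ultimately have "1 \<le> exp (-x) * (1 + x + x\<^sup>2)"
    by (meson mult_right_mono order_trans)
  then have "exp x * 1 \<le> exp x * (exp (-x) * (1 + x + x\<^sup>2))"
    by (intro mult_left_mono) auto
  then show ?thesis by (simp add: mult.assoc[symmetric] exp_minus)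
qed

text \<open>\<open>a_le\<close> has \<open>n + 1\<close> because the logarithm of the norm of the
  empty product need not vanish. \<open>a_shift_le\<close> bounds the cost of forgetting the first
  factor; it makes the lower limit of \<open>a n / n\<close> non-increasing along shifts, which lets
  one slope serve for all blocks of an orbit.\<close>

locale iid_subadditive = sequence_space M for M :: "'s measure" +
  fixes a :: "nat \<Rightarrow> (nat \<Rightarrow> 's) \<Rightarrow> real" and c :: real
  assumes a_measurable [measurable]: "a n \<in> borel_measurable S"
    and a_cong: "\<omega> \<in> space S \<Longrightarrow> \<omega>' \<in> space S \<Longrightarrow> (\<And>i. i < n \<Longrightarrow> \<omega> i = \<omega>' i) \<Longrightarrow> a n \<omega> = a n \<omega>'"
    and a_nonneg: "\<omega> \<in> space S \<Longrightarrow> 0 \<le> a n \<omega>"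
    and a_le: "\<omega> \<in> space S \<Longrightarrow> a n \<omega> \<le> c * (real n + 1)"
    and a_subadditive: "\<omega> \<in> space S \<Longrightarrow> a (m + n) \<omega> \<le> a m \<omega> + a n (shift_seq m \<omega>)"
    and a_shift_le: "\<omega> \<in> space S \<Longrightarrow> a n (shift_seq 1 \<omega>) \<le> a (Suc n) \<omega> + c"
begin

section \<open>Fekete's constant and the almost sure upper bound\<close>

lemma c_nonneg: "0 \<le> c"
proof -
  obtain \<omega> where "\<omega> \<in> space S" using P.not_empty by blast
  from a_nonneg[OF this, of 0] a_le[OF this, of 0] show ?thesis by simp
qed

lemma norm_a_le: "\<omega> \<in> space S \<Longrightarrow> norm (a n \<omega>) \<le> c * (real n + 1)"
  using a_nonneg[of \<omega> n] a_le[of \<omega> n] by simp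

lemma integrable_a [simp]: "integrable S (a n)"
  by (rule integrable_bounded[OF _ norm_a_le]) auto

text \<open>Fekete's constant. As an infimum it bounds every normalised expectation from below
  before any convergence is known.\<close>

definition growth :: real where
  "growth = (INF n\<in>{1..}. (\<integral>\<omega>. a n \<omega> \<partial>S) / real n)"

lemma growth_bdd: "bdd_below ((\<lambda>n. (\<integral>\<omega>. a n \<omega> \<partial>S) / real n) ` {1..})"
  by (rule bdd_belowI2[of _ 0]) (auto intro!: divide_nonneg_nonneg integral_nonneg_AE AE_I2 a_nonneg)

lemma growth_le: "n \<ge> 1 \<Longrightarrow> growth \<le> (\<integral>\<omega>. a n \<omega> \<partial>S) / real n"
  unfolding growth_def by (rule cINF_lower[OF growth_bdd]) auto

lemma growth_nonneg: "0 \<le> growth"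
  unfolding growth_def
  by (rule cINF_greatest) (auto intro!: divide_nonneg_nonneg integral_nonneg_AE AE_I2 a_nonneg)

lemma growth_approx:
  assumes "e > 0"
  obtains m where "m \<ge> 1" "(\<integral>\<omega>. a m \<omega> \<partial>S) < real m * (growth + e)"
proof -
  have "growth < growth + e" using assms by simp
  then obtain m where m: "m \<in> {1..}" "(\<integral>\<omega>. a m \<omega> \<partial>S) / real m < growth + e"
    using cINF_less_iff[OF _ growth_bdd, of "growth + e"] unfolding growth_def by (auto simp del: One_nat_def)
  then show ?thesis using that[of m] by (auto simp: field_simps)
qed

text \<open>The tilt \<open>n * t\<close> is additive, so subadditivity bounds the integrand by a
  function of the first \<open>m\<close> factors times a function of the rest, and independence
  factorises the expectation.\<close>

lemma exp_moment_submultiplicative: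
  assumes "l \<ge> 0"
  shows "(\<integral>\<omega>. exp (l * (a (m + n) \<omega> - real (m + n) * t)) \<partial>S)
    \<le> (\<integral>\<omega>. exp (l * (a m \<omega> - real m * t)) \<partial>S) * (\<integral>\<omega>. exp (l * (a n \<omega> - real n * t)) \<partial>S)"
proof -
  define f where "f n \<omega> = exp (l * (a n \<omega> - real n * t))" for n \<omega>
  have f_meas [measurable]: "f n \<in> borel_measurable S" for n
    unfolding f_def by measurable
  have f_pos: "0 < f n \<omega>" for n \<omega> by (simp add: f_def)
  define B where "B n = exp (l * (c * (real n + 1) + real n * \<bar>t\<bar>))" for n
  have f_le: "f n \<omega> \<le> B n" if "\<omega> \<in> space S" for n \<omega>
  proof -
    have "a n \<omega> - real n * t \<le> c * (real n + 1) + real n * \<bar>t\<bar>"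
      using a_le[OF that, of n] mult_left_mono[of "-t" "\<bar>t\<bar>" "real n"] abs_ge_minus_self[of t] by linarith
    then show ?thesis unfolding f_def B_def using assms by (simp add: mult_left_mono)
  qed
  have f_norm: "norm (f n \<omega>) \<le> B n" if "\<omega> \<in> space S" for n \<omega>
    using f_le[OF that] f_pos[of n \<omega>] by simp
  have int: "integrable S (f n)" for n
    by (rule integrable_bounded[OF _ f_norm]) auto
  have le: "f (m + n) \<omega> \<le> f m \<omega> * f n (shift_seq m \<omega>)" if "\<omega> \<in> space S" for \<omega>
  proof -
    have "l * (a (m + n) \<omega> - real (m + n) * t) \<le> l * (a m \<omega> + a n (shift_seq m \<omega>) - real (m + n) * t)"
      using a_subadditive[OF that, of m n] assms by (intro mult_left_mono) auto
    then show ?thesis unfolding f_def by (simp add: exp_add[symmetric] algebra_simps)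
  qed
  have bd: "norm (f m \<omega> * f n (shift_seq m \<omega>)) \<le> B m * B n" if "\<omega> \<in> space S" for \<omega>
    using f_norm[OF that, of m] f_norm[OF shift_seq_space[OF that], of n m]
    unfolding norm_mult by (intro mult_mono) (auto simp: B_def)
  have "(\<integral>\<omega>. f (m + n) \<omega> \<partial>S) \<le> (\<integral>\<omega>. f m \<omega> * f n (shift_seq m \<omega>) \<partial>S)"
    by (intro integral_mono int integrable_bounded[OF _ bd] le) auto
  also have "\<dots> = (\<integral>\<omega>. (\<integral>\<omega>'. f m (comb_seq m \<omega> \<omega>') * f n (shift_seq m (comb_seq m \<omega> \<omega>')) \<partial>S) \<partial>S)"
    by (rule integral_split[OF _ bd]) auto
  also have "\<dots> = (\<integral>\<omega>. (\<integral>\<omega>'. f m \<omega> * f n \<omega>' \<partial>S) \<partial>S)"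
  proof (intro Bochner_Integration.integral_cong refl)
    fix \<omega> \<omega>' assume "\<omega> \<in> space S" "\<omega>' \<in> space S"
    then have "a m (comb_seq m \<omega> \<omega>') = a m \<omega>"
      by (intro a_cong comb_seq_space) (auto simp: comb_seq_less)
    then show "f m (comb_seq m \<omega> \<omega>') * f n (shift_seq m (comb_seq m \<omega> \<omega>')) = f m \<omega> * f n \<omega>'"
      by (simp add: f_def)
  qed
  also have "\<dots> = (\<integral>\<omega>. f m \<omega> \<partial>S) * (\<integral>\<omega>. f n \<omega> \<partial>S)"
    by simp
  finally show ?thesis unfolding f_def .
qed

text \<open>A block whose mean is below \<open>m * (growth + d)\<close> has negative drift after
  tilting with slope \<open>growth + 2 * d\<close>. A small exponent then makes its exponential
  moment less than 1, so the crossing probabilities decay geometrically along the multiples of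
  \<open>m\<close>; at other times the incomplete block costs a bounded amount.\<close>

lemma eventually_less:
  assumes "e > 0"
  shows "AE \<omega> in S. eventually (\<lambda>n. a n \<omega> / real n < growth + 2 * e) sequentially"
proof -
  define d where "d = e / 2"
  have d: "d > 0" using assms by (simp add: d_def)
  obtain m where m: "m \<ge> 1" "(\<integral>\<omega>. a m \<omega> \<partial>S) < real m * (growth + d)"
    using growth_approx[OF d] by blast
  define t where "t = growth + 2 * d"
  have t: "t \<ge> 0" using growth_nonneg d by (simp add: t_def)
  define B where "B = c * (real m + 1) + real m * t + 1"
  have B: "B > 0" using c_nonneg t unfolding B_def by (simp add: add_nonneg_pos)
  define Y where "Y \<omega> = a m \<omega> - real m * t" for \<omega>
  have Y_le: "\<bar>Y \<omega>\<bar> \<le> B" if "\<omega> \<in> space S" for \<omega>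
    using a_nonneg[OF that, of m] a_le[OF that, of m] mult_nonneg_nonneg[OF _ t, of "real m"]
      mult_nonneg_nonneg[OF c_nonneg, of "real m + 1"]
    unfolding Y_def B_def abs_le_iff by linarith
  have Y_meas [measurable]: "Y \<in> borel_measurable S" unfolding Y_def by measurable
  have Y_int: "integrable S Y" by (rule integrable_bounded[of _ B]) (auto simp: Y_le)
  have EY: "(\<integral>\<omega>. Y \<omega> \<partial>S) \<le> - (real m * d)"
  proof -
    have "(\<integral>\<omega>. Y \<omega> \<partial>S) = (\<integral>\<omega>. a m \<omega> \<partial>S) - real m * t"
      unfolding Y_def by (simp add: P.prob_space)
    then show ?thesis using m by (simp add: t_def algebra_simps)
  qed
  \<comment> \<open>The first bound gives \<open>l * B \<le> 1\<close>, so the quadratic bound for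
    \<open>exp\<close> applies to \<open>l * Y\<close>. The second keeps the quadratic error below
    half of the gain \<open>l * m * d\<close> from the drift.\<close>
  define l where "l = min (1 / B) (real m * d / (2 * B\<^sup>2))"
  have l: "l > 0" "l * B \<le> 1" "l * B\<^sup>2 \<le> real m * d / 2"
  proof -
    show "l > 0" using B d m by (auto simp: l_def)
    have "l * B \<le> 1 / B * B" using B unfolding l_def by (intro mult_right_mono) auto
    then show "l * B \<le> 1" using B by simp
    have "l * B\<^sup>2 \<le> real m * d / (2 * B\<^sup>2) * B\<^sup>2" unfolding l_def by (intro mult_right_mono) auto
    then show "l * B\<^sup>2 \<le> real m * d / 2" using B by simp
  qed
  define \<rho> where "\<rho> = (\<integral>\<omega>. exp (l * Y \<omega>) \<partial>S)"
  have \<rho>0: "\<rho> \<ge> 0" unfolding \<rho>_def by (simp add: integral_nonneg_AE)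
  have lY: "\<bar>l * Y \<omega>\<bar> \<le> l * B" if "\<omega> \<in> space S" for \<omega>
    using Y_le[OF that] l by (simp add: abs_mult)
  have \<rho>1: "\<rho> < 1"
  proof -
    have bd: "exp (l * Y \<omega>) \<le> 1 + l * Y \<omega> + l\<^sup>2 * B\<^sup>2" if "\<omega> \<in> space S" for \<omega>
    proof -
      have "(l * Y \<omega>)\<^sup>2 \<le> (l * B)\<^sup>2"
        using lY[OF that] l B by (subst abs_le_square_iff[symmetric]) auto
      then show ?thesis
        using exp_le_quadratic[of "l * Y \<omega>"] lY[OF that] l(2) unfolding power_mult_distrib[of l B]
        by linarith
    qed
    have "norm (exp (l * Y \<omega>)) \<le> exp 1" if "\<omega> \<in> space S" for \<omega>
      using lY[OF that] l by simp
    then have "integrable S (\<lambda>\<omega>. exp (l * Y \<omega>))"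
      by (intro integrable_bounded[of _ "exp 1"]) auto
    then have "\<rho> \<le> (\<integral>\<omega>. 1 + l * Y \<omega> + l\<^sup>2 * B\<^sup>2 \<partial>S)"
      unfolding \<rho>_def using bd Y_int by (intro integral_mono) auto
    also have "\<dots> = 1 + l * (\<integral>\<omega>. Y \<omega> \<partial>S) + l\<^sup>2 * B\<^sup>2"
      using Y_int by (simp add: P.prob_space)
    also have "\<dots> \<le> 1 + l * (- (real m * d)) + l * (real m * d / 2)"
      using EY l by (intro add_mono mult_left_mono) (auto simp: power2_eq_square[of l] mult.assoc)
    also have "\<dots> < 1" using l d m by simp
    finally show ?thesis .
  qed
  define u where "u k = (\<integral>\<omega>. exp (l * (a (k * m) \<omega> - real (k * m) * t)) \<partial>S)" for k
  \<comment> \<open>The factor \<open>u 0\<close> stays because \<open>a 0\<close> may be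
    positive.\<close>
  have u_le: "u k \<le> u 0 * \<rho> ^ k" for k
  proof (induction k)
    case (Suc k)
    have "u (Suc k) \<le> \<rho> * u k"
      using exp_moment_submultiplicative[of l m "k * m" t] l unfolding u_def \<rho>_def Y_def by simp
    also have "\<dots> \<le> \<rho> * (u 0 * \<rho> ^ k)" using Suc \<rho>0 by (intro mult_left_mono)
    finally show ?case by (simp add: mult_ac)
  qed simp
  define A where "A k = {\<omega> \<in> space S. real (k * m) * t \<le> a (k * m) \<omega>}" for k
  have A_meas [measurable]: "A k \<in> sets S" for k unfolding A_def by measurable
  have "measure S (A k) \<le> u k" for k
  proof -
    have "norm (exp (l * (a (k * m) \<omega> - real (k * m) * t))) \<le> exp (l * (c * (real (k * m) + 1)))"
      if "\<omega> \<in> space S" for \<omega>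
    proof -
      have "a (k * m) \<omega> - real (k * m) * t \<le> c * (real (k * m) + 1)"
        using a_le[OF that, of "k * m"] t by (smt (verit) mult_nonneg_nonneg of_nat_0_le_iff)
      then show ?thesis using l by simp
    qed
    then have int: "integrable S (\<lambda>\<omega>. exp (l * (a (k * m) \<omega> - real (k * m) * t)))"
      by (intro integrable_bounded) auto
    have "measure S (A k) = (\<integral>\<omega>. indicator (A k) \<omega> \<partial>S)" by simp
    also have "\<dots> \<le> u k"
      unfolding u_def
    proof (rule integral_mono[OF _ int])
      show "integrable S (indicator (A k) :: _ \<Rightarrow> real)"
        by (rule integrable_bounded[of _ 1]) (auto simp: indicator_def)
    qed (use l in \<open>auto simp: A_def indicator_def\<close>)
    finally show ?thesis .
  qed
  then have mA: "measure S (A k) \<le> u 0 * \<rho> ^ k" for k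
    using u_le[of k] order_trans by blast
  have "summable (\<lambda>k. measure S (A k))"
    using \<rho>0 \<rho>1 mA by (intro summable_comparison_test'[OF summable_mult[OF summable_geometric]]) auto
  then have "AE \<omega> in S. eventually (\<lambda>k. \<omega> \<in> space S - A k) sequentially"
    by (intro borel_cantelli_AE1) (auto simp: P.emeasure_eq_measure)
  then show ?thesis
  proof (eventually_elim)
    case (elim \<omega>)
    then obtain k0 where k0: "\<And>k. k \<ge> k0 \<Longrightarrow> \<omega> \<in> space S - A k"
      unfolding eventually_sequentially by auto
    then have sp: "\<omega> \<in> space S" by blast
    have main: "a n \<omega> \<le> real n * t + c * (real m + 1)" if "n \<ge> k0 * m" for n
    proof -
      define k where "k = n div m"
      define r where "r = n mod m"
      have n: "n = k * m + r" "r < m" using m by (auto simp: k_def r_def)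
      have "k \<ge> k0" using that m unfolding k_def by (metis div_le_mono nonzero_mult_div_cancel_right not_one_le_zero)
      then have "a (k * m) \<omega> \<le> real (k * m) * t" using k0[of k] by (auto simp: A_def)
      moreover have "real (k * m) * t \<le> real n * t" using n t by (intro mult_right_mono) auto
      moreover have "a r (shift_seq (k * m) \<omega>) \<le> c * (real r + 1)"
        by (intro a_le shift_seq_space sp)
      moreover have "c * (real r + 1) \<le> c * (real m + 1)"
        using n c_nonneg by (intro mult_left_mono) auto
      moreover have "a n \<omega> \<le> a (k * m) \<omega> + a r (shift_seq (k * m) \<omega>)"
        using a_subadditive[OF sp, of "k * m" r] n by simp
      ultimately show ?thesis by linarith
    qed
    have "eventually (\<lambda>n. c * (real m + 1) / real n < e) sequentially"
      using assms by (intro order_tendstoD(2)[of _ 0]) (real_asymp, simp)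
    then show ?case
      using eventually_ge_at_top[of "k0 * m"] eventually_gt_at_top[of 0]
    proof eventually_elim
      case (elim n)
      have "a n \<omega> / real n \<le> (real n * t + c * (real m + 1)) / real n"
        using main[of n] elim by (intro divide_right_mono) auto
      also have "\<dots> = t + c * (real m + 1) / real n" using elim by (simp add: field_simps)
      also have "\<dots> < growth + 2 * e" using elim by (simp add: t_def d_def)
      finally show ?case .
    qed
  qed
qed

section \<open>The lower limit and its expectation\<close>

definition lower :: "(nat \<Rightarrow> 's) \<Rightarrow> ereal" where
  "lower \<omega> = liminf (\<lambda>n. ereal (a n \<omega> / real n))"

lemma lower_measurable [measurable]: "lower \<in> borel_measurable S"
  unfolding lower_def by measurable

lemma a_div_le:
  assumes "\<omega> \<in> space S"
  shows "a n \<omega> / real n \<le> 2 * c"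
proof (cases "n = 0")
  case False
  have "a n \<omega> \<le> c * (real n + 1)" by (rule a_le[OF assms])
  also have "\<dots> \<le> c * (2 * real n)" using False c_nonneg by (intro mult_left_mono) auto
  finally show ?thesis using False by (simp add: field_simps)
qed (use c_nonneg in simp)

lemma lower_bounds:
  assumes "\<omega> \<in> space S"
  shows "0 \<le> lower \<omega>" "lower \<omega> \<le> ereal (2 * c)"
proof -
  show "0 \<le> lower \<omega>" unfolding lower_def
    by (intro Liminf_bounded always_eventually) (auto intro!: divide_nonneg_nonneg a_nonneg assms)
  show "lower \<omega> \<le> ereal (2 * c)" unfolding lower_def
    by (intro Liminf_le always_eventually) (use a_div_le[OF assms] in auto)
qed

definition low :: "(nat \<Rightarrow> 's) \<Rightarrow> real" where "low \<omega> = real_of_ereal (lower \<omega>)"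

lemma low_measurable [measurable]: "low \<in> borel_measurable S"
  unfolding low_def by measurable

lemma ereal_low: "\<omega> \<in> space S \<Longrightarrow> ereal (low \<omega>) = lower \<omega>"
  using lower_bounds[of \<omega>] unfolding low_def by (cases "lower \<omega>") auto

lemma low_bounds: "\<omega> \<in> space S \<Longrightarrow> 0 \<le> low \<omega>" "\<omega> \<in> space S \<Longrightarrow> low \<omega> \<le> 2 * c"
  using lower_bounds[of \<omega>] ereal_low[of \<omega>] by (metis ereal_less_eq(3,5))+

lemma low_frequently:
  assumes "\<omega> \<in> space S" "low \<omega> < x"
  shows "\<exists>n\<ge>k. a n \<omega> / real n < x"
proof (rule ccontr)
  assume "\<not> ?thesis"
  then have "eventually (\<lambda>n. ereal x \<le> ereal (a n \<omega> / real n)) sequentially"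
    unfolding eventually_sequentially by (intro exI[of _ k]) (auto simp: not_less)
  then have "ereal x \<le> lower \<omega>" unfolding lower_def by (rule Liminf_bounded)
  then show False using assms ereal_low[OF assms(1)] by (metis ereal_less_eq(3) not_less)
qed

lemma low_eventually:
  assumes "\<omega> \<in> space S" "x < low \<omega>"
  shows "eventually (\<lambda>n. x < a n \<omega> / real n) sequentially"
proof -
  have "ereal x < liminf (\<lambda>n. ereal (a n \<omega> / real n))"
    using assms ereal_low[of \<omega>] unfolding lower_def by (metis less_ereal.simps(1))
  from less_LiminfD[OF this] show ?thesis by simp
qed

text \<open>By \<open>a_shift_le\<close> the shifted value at time \<open>n\<close> exceeds the
  original one at time \<open>n + 1\<close> by at most \<open>c\<close>; the index shift and the
  constant disappear after division by \<open>n\<close>.\<close>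

lemma low_shift_seq_1:
  assumes "\<omega> \<in> space S"
  shows "low (shift_seq 1 \<omega>) \<le> low \<omega>"
proof (rule ccontr)
  assume "\<not> ?thesis"
  then have lt: "low \<omega> < low (shift_seq 1 \<omega>)" by simp
  \<comment> \<open>\<open>y\<close> and \<open>x\<close> separate the two lower limits: the
    original ratios are below \<open>y\<close> infinitely often, and the gap between
    \<open>y\<close> and \<open>x\<close> absorbs the constant \<open>c\<close> and the passage from
    \<open>n + 1\<close> to \<open>n\<close>.\<close>
  define x where "x = (low \<omega> + low (shift_seq 1 \<omega>)) / 2"
  define y where "y = (low \<omega> + x) / 2"
  have y: "low \<omega> < y" "y < x" "x < low (shift_seq 1 \<omega>)" using lt by (auto simp: x_def y_def)
  have "eventually (\<lambda>n. x < a n (shift_seq 1 \<omega>) / real n) sequentially"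
    by (rule low_eventually[OF shift_seq_space[OF assms] y(3)])
  then obtain k where k: "\<And>n. n \<ge> k \<Longrightarrow> x < a n (shift_seq 1 \<omega>) / real n"
    unfolding eventually_sequentially by auto
  have "eventually (\<lambda>n. (y * real (Suc n) + c) / real n < x) sequentially"
    using y by (intro order_tendstoD(2)[of _ y]) real_asymp
  then obtain k' where k': "\<And>n. n \<ge> k' \<Longrightarrow> (y * real (Suc n) + c) / real n < x"
    unfolding eventually_sequentially by auto
  obtain n where n: "n \<ge> Suc (Suc (k + k'))" "a n \<omega> / real n < y"
    using low_frequently[OF assms y(1)] by blast
  then obtain n' where n': "n = Suc n'" "n' \<ge> Suc (k + k')" by (cases n) auto
  have "a n' (shift_seq 1 \<omega>) \<le> a n \<omega> + c" using a_shift_le[OF assms, of n'] n' by simp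
  also have "\<dots> \<le> y * real n + c" using n by (simp add: field_simps)
  finally have "a n' (shift_seq 1 \<omega>) / real n' \<le> (y * real n + c) / real n'"
    by (intro divide_right_mono) auto
  then show False using k[of n'] k'[of n'] n' by force
qed

lemma low_shift_seq: "\<omega> \<in> space S \<Longrightarrow> low (shift_seq j \<omega>) \<le> low \<omega>"
proof (induction j)
  case (Suc j)
  have "low (shift_seq (Suc j) \<omega>) \<le> low (shift_seq j \<omega>)"
    using low_shift_seq_1[OF shift_seq_space[OF Suc.prems, of j]] by (simp add: shift_seq_shift_seq)
  then show ?case using Suc by simp
qed simp

text \<open>Greedy decomposition of \<open>{..<m}\<close>: outside the bad set a block of length at most \<open>L\<close> and slope
  below \<open>x\<close> can be split off, inside it a single step is paid for with the trivial bound.\<close>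

lemma greedy_bound:
  assumes "\<omega> \<in> space S" "0 \<le> x"
    and "\<And>j. shift_seq j \<omega> \<notin> Bad \<Longrightarrow> \<exists>n\<in>{1..L}. a n (shift_seq j \<omega>) \<le> real n * x"
  shows "a m \<omega> \<le> real m * x + 2 * c * (\<Sum>j<m. indicator Bad (shift_seq j \<omega>)) + c * (real L + 1)"
  using assms
proof (induction m arbitrary: \<omega> rule: less_induct)
  case (less m)
  have sum_nn: "0 \<le> 2 * c * (\<Sum>j<k. indicator Bad (shift_seq j \<omega>'))" for k \<omega>'
    using c_nonneg by (simp add: sum_nonneg)
  show ?case
  proof (cases "m \<le> L")
    case True
    \<comment> \<open>What remains may be shorter than the next block, so it is paid for at once;
      this is the boundary term \<open>c * (real L + 1)\<close>.\<close>
    have "a m \<omega> \<le> c * (real m + 1)" by (rule a_le) fact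
    also have "\<dots> \<le> c * (real L + 1)" using True c_nonneg by (intro mult_left_mono) auto
    finally show ?thesis using sum_nn[of \<omega> m] less.prems(2) by (smt (verit) mult_nonneg_nonneg of_nat_0_le_iff)
  next
    case False
    have step: "a m \<omega> \<le> a n \<omega> + (real (m - n) * x
        + 2 * c * (\<Sum>j<m - n. indicator Bad (shift_seq (n + j) \<omega>)) + c * (real L + 1))"
      if n: "1 \<le> n" "n \<le> m" for n
    proof -
      have "a m \<omega> \<le> a n \<omega> + a (m - n) (shift_seq n \<omega>)"
        using a_subadditive[OF less.prems(1), of n "m - n"] n by simp
      also have "a (m - n) (shift_seq n \<omega>) \<le> real (m - n) * x
        + 2 * c * (\<Sum>j<m - n. indicator Bad (shift_seq j (shift_seq n \<omega>))) + c * (real L + 1)"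
        using n less.prems
        by (intro less.IH shift_seq_space) (auto simp: shift_seq_shift_seq)
      finally show ?thesis by (simp add: shift_seq_shift_seq add.commute)
    qed
    have sum_split: "(\<Sum>j<m. indicator Bad (shift_seq j \<omega>) :: real) =
      (\<Sum>j<n. indicator Bad (shift_seq j \<omega>)) + (\<Sum>j<m - n. indicator Bad (shift_seq (n + j) \<omega>))"
      if "n \<le> m" for n
      using that sum.atLeastLessThan_concat[of 0 n m "\<lambda>j. indicator Bad (shift_seq j \<omega>) :: real"]
        sum.shift_bounds_nat_ivl[of "\<lambda>j. indicator Bad (shift_seq j \<omega>) :: real" 0 n "m - n"]
      by (simp add: lessThan_atLeast0 add.commute)
    show ?thesis
    proof (cases "\<omega> \<in> Bad")
      case True
      have "a 1 \<omega> \<le> 2 * c" using a_le[OF less.prems(1), of 1] by simp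
      moreover have "(\<Sum>j<m. indicator Bad (shift_seq j \<omega>) :: real) =
          1 + (\<Sum>j<m - 1. indicator Bad (shift_seq (1 + j) \<omega>))"
        using sum_split[of 1] False True by simp
      moreover have "real (m - 1) * x \<le> real m * x" using less.prems(2) by (intro mult_right_mono) auto
      ultimately show ?thesis using step[of 1] False by (simp add: algebra_simps)
    next
      case nbad: False
      then obtain n where n: "n \<in> {1..L}" "a n \<omega> \<le> real n * x"
        using less.prems(3)[of 0] by auto
      have "real (m - n) * x + real n * x = real m * x"
        using n False by (simp add: of_nat_diff algebra_simps)
      moreover have "2 * c * (\<Sum>j<m - n. indicator Bad (shift_seq (n + j) \<omega>))
          \<le> 2 * c * (\<Sum>j<m. indicator Bad (shift_seq j \<omega>))"
        using sum_split[of n] n False c_nonneg by (intro mult_left_mono) (auto simp: sum_nonneg)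
      ultimately show ?thesis using step[of n] n False by simp
    qed
  qed
qed

text \<open>With blocks of slope at most \<open>low + d\<close>, the bad steps cost on average
  \<open>2 * c\<close> times the probability of \<open>Bad L\<close> per unit of time. This tends to
  0 as \<open>L\<close> grows, because every sequence has some time at which its ratio is below
  \<open>low + d\<close>. The boundary term depends on \<open>L\<close> but not on \<open>m\<close>
  and disappears after division by \<open>m\<close>.\<close>

lemma growth_le_expectation_low: "growth \<le> (\<integral>\<omega>. low \<omega> \<partial>S)"
proof (rule field_le_epsilon)
  fix e :: real assume e: "e > 0"
  define d where "d = e / 2"
  have d: "d > 0" using e by (simp add: d_def)
  define Bad where "Bad L = {\<omega> \<in> space S. \<forall>n\<in>{1..L}. real n * (low \<omega> + d) < a n \<omega>}" for L :: nat
  have Bad_meas [measurable]: "Bad L \<in> sets S" for L unfolding Bad_def by measurable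
  have "(\<lambda>L. measure S (Bad L)) \<longlonglongrightarrow> measure S (\<Inter>L. Bad L)"
    by (rule P.finite_Lim_measure_decseq) (auto simp: decseq_def Bad_def)
  moreover have "(\<Inter>L. Bad L) = {}"
  proof (rule ccontr)
    assume "(\<Inter>L. Bad L) \<noteq> {}"
    then obtain \<omega> where \<omega>: "\<And>L. \<omega> \<in> Bad L" by blast
    then have sp: "\<omega> \<in> space S" by (auto simp: Bad_def)
    obtain n where n: "n \<ge> 1" "a n \<omega> / real n < low \<omega> + d"
      using low_frequently[OF sp, of "low \<omega> + d" 1] d by auto
    then show False using \<omega>[of n] by (auto simp: Bad_def field_simps dest!: bspec[of _ _ n])
  qed
  ultimately have "(\<lambda>L. 2 * c * measure S (Bad L)) \<longlonglongrightarrow> 2 * c * 0"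
    by (intro tendsto_mult tendsto_const) simp
  then have "eventually (\<lambda>L. 2 * c * measure S (Bad L) < d) sequentially"
    using d by (intro order_tendstoD(2)) auto
  then obtain L where L: "2 * c * measure S (Bad L) < d"
    using eventually_happens by fastforce
  have low_int: "integrable S low"
    by (rule integrable_bounded[of _ "2 * c"]) (auto simp: low_bounds)
  have ind_int: "integrable S (\<lambda>\<omega>. indicator (Bad L) (shift_seq j \<omega>) :: real)" for j
    by (rule integrable_bounded[of _ 1]) (auto simp: indicator_def)
  have ind: "(\<integral>\<omega>. indicator (Bad L) (shift_seq j \<omega>) \<partial>S) = measure S (Bad L)" for j
    by (subst integral_shift_seq[of _ 1]) (auto simp: indicator_def)
  have bound: "growth \<le> (\<integral>\<omega>. low \<omega> \<partial>S) + e + c * (real L + 1) / real m" if m: "m \<ge> 1" for m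
  proof -
    have "a m \<omega> \<le> real m * (low \<omega> + d) + 2 * c * (\<Sum>j<m. indicator (Bad L) (shift_seq j \<omega>)) + c * (real L + 1)"
      if sp: "\<omega> \<in> space S" for \<omega>
    \<comment> \<open>One slope must serve at all starting times: a block that is good at the level
      \<open>low (shift_seq j \<omega>) + d\<close> is good at the level of \<open>\<omega>\<close>,
      since \<open>low\<close> does not increase along shifts.\<close>
    proof (rule greedy_bound[OF sp])
      show "0 \<le> low \<omega> + d" using low_bounds[OF sp] d by simp
      fix j assume "shift_seq j \<omega> \<notin> Bad L"
      then obtain n where n: "n \<in> {1..L}" "a n (shift_seq j \<omega>) \<le> real n * (low (shift_seq j \<omega>) + d)"
        using shift_seq_space[OF sp, of j] by (auto simp: Bad_def not_less)
      then show "\<exists>n\<in>{1..L}. a n (shift_seq j \<omega>) \<le> real n * (low \<omega> + d)"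
        using low_shift_seq[OF sp, of j]
        by (intro bexI[of _ n] order_trans[OF n(2)] mult_left_mono) auto
    qed
    then have "(\<integral>\<omega>. a m \<omega> \<partial>S) \<le> (\<integral>\<omega>. real m * (low \<omega> + d)
        + 2 * c * (\<Sum>j<m. indicator (Bad L) (shift_seq j \<omega>)) + c * (real L + 1) \<partial>S)"
      using low_int ind_int by (intro integral_mono) auto
    also have "\<dots> = real m * ((\<integral>\<omega>. low \<omega> \<partial>S) + d) + 2 * c * (real m * measure S (Bad L)) + c * (real L + 1)"
      using low_int ind_int by (simp add: P.prob_space ind)
    also have "\<dots> \<le> real m * ((\<integral>\<omega>. low \<omega> \<partial>S) + e) + c * (real L + 1)"
      using mult_left_mono[OF less_imp_le[OF L], of "real m"] by (simp add: d_def algebra_simps)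
    finally have "(\<integral>\<omega>. a m \<omega> \<partial>S) / real m \<le> (\<integral>\<omega>. low \<omega> \<partial>S) + e + c * (real L + 1) / real m"
      using m by (simp add: field_simps)
    then show ?thesis using growth_le[OF m] by simp
  qed
  have "(\<lambda>m. (\<integral>\<omega>. low \<omega> \<partial>S) + e + c * (real L + 1) / real m) \<longlonglongrightarrow> (\<integral>\<omega>. low \<omega> \<partial>S) + e + 0"
    by (intro tendsto_add tendsto_const) real_asymp
  then have "growth \<le> (\<integral>\<omega>. low \<omega> \<partial>S) + e + 0"
    by (rule tendsto_lowerbound) (use bound in \<open>auto simp: eventually_sequentially simp del: One_nat_def\<close>)
  then show "growth \<le> (\<integral>\<omega>. low \<omega> \<partial>S) + e" by simp
qed

theorem AE_tendsto_growth: "AE \<omega> in S. (\<lambda>n. a n \<omega> / real n) \<longlonglongrightarrow> growth"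
proof -
  have "AE \<omega> in S. \<forall>k. eventually (\<lambda>n. a n \<omega> / real n < growth + 2 * (1 / real (Suc k))) sequentially"
    unfolding AE_all_countable by (intro allI eventually_less) simp
  then have up: "AE \<omega> in S. \<forall>x>growth. eventually (\<lambda>n. a n \<omega> / real n < x) sequentially"
  proof eventually_elim
    case (elim \<omega>)
    show ?case
    proof (intro allI impI)
      fix x assume "x > growth"
      then obtain k where "1 / real (Suc k) < (x - growth) / 2"
        using reals_Archimedean[of "(x - growth) / 2"] by (auto simp: inverse_eq_divide)
      then have "growth + 2 * (1 / real (Suc k)) < x" by simp
      then show "eventually (\<lambda>n. a n \<omega> / real n < x) sequentially"
        using elim[rule_format, of k] by (auto elim: eventually_mono)
    qed
  qed
  have low_int: "integrable S low"
    by (rule integrable_bounded[of _ "2 * c"]) (auto simp: low_bounds)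
  have low_le: "AE \<omega> in S. low \<omega> \<le> growth"
    using up AE_space
  proof eventually_elim
    case (elim \<omega>)
    show ?case
    proof (rule ccontr)
      assume "\<not> ?thesis"
      then obtain x where x: "growth < x" "x < low \<omega>" using dense by (meson not_le)
      have "eventually (\<lambda>n::nat. False) sequentially"
        using elim(1)[rule_format, OF x(1)] low_eventually[OF elim(2) x(2)] by eventually_elim simp
      then show False by simp
    qed
  qed
  have "AE \<omega> in S. growth - low \<omega> = 0"
  proof -
    have "(\<integral>\<omega>. growth - low \<omega> \<partial>S) = growth - (\<integral>\<omega>. low \<omega> \<partial>S)"
      using low_int by (simp add: P.prob_space)
    also have "\<dots> \<le> 0" using growth_le_expectation_low by simp
    finally have "(\<integral>\<omega>. growth - low \<omega> \<partial>S) = 0"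
      using integral_nonneg_AE[of "\<lambda>\<omega>. growth - low \<omega>" S] low_le by force
    then show ?thesis
      using integral_nonneg_eq_0_iff_AE[of S "\<lambda>\<omega>. growth - low \<omega>"] low_int low_le by auto
  qed
  then show ?thesis
    using up AE_space
  proof eventually_elim
    case (elim \<omega>)
    show ?case
      by (rule order_tendstoI) (use elim low_eventually[of \<omega>] in auto)
  qed
qed

text \<open>Deduced from the almost sure convergence by domination with the constant
  \<open>2 * c\<close>.\<close>

theorem expectation_tendsto_growth: "(\<lambda>n. (\<integral>\<omega>. a n \<omega> \<partial>S) / real n) \<longlonglongrightarrow> growth"
proof -
  have "(\<lambda>n. \<integral>\<omega>. a n \<omega> / real n \<partial>S) \<longlonglongrightarrow> (\<integral>\<omega>. growth \<partial>S)"
    by (rule integral_dominated_convergence[where w = "\<lambda>_. 2 * c"])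
      (use AE_tendsto_growth in \<open>auto intro!: AE_I2 simp: a_div_le a_nonneg\<close>)
  then show ?thesis by (simp add: P.prob_space)
qed

end

section \<open>Contractions of an indefinite form on two-dimensional space\<close>

lemma norm_matrix_mult_le:
  fixes A :: "complex^'n^'m" and B :: "complex^'k^'n"
  shows "norm (A ** B) \<le> norm A * norm B"
proof -
  have entry: "norm ((A ** B) $ i $ j) \<le> norm (A $ i) * L2_set (\<lambda>k. norm (B $ k $ j)) UNIV" for i j
  proof -
    have "norm ((A ** B) $ i $ j) \<le> (\<Sum>k\<in>UNIV. \<bar>norm (A $ i $ k)\<bar> * \<bar>norm (B $ k $ j)\<bar>)"
      unfolding matrix_matrix_mult_def by (simp add: norm_mult[symmetric] norm_sum)
    also have "\<dots> \<le> norm (A $ i) * L2_set (\<lambda>k. norm (B $ k $ j)) UNIV"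
      unfolding norm_vec_def[of "A $ i"] by (rule L2_set_mult_ineq)
    finally show ?thesis .
  qed
  have sq: "(norm X)\<^sup>2 = (\<Sum>i\<in>UNIV. \<Sum>j\<in>UNIV. (norm (X $ i $ j))\<^sup>2)"
    for X :: "complex^'b^'a"
    by (simp add: norm_vec_def L2_set_def sum_nonneg)
  have sq1: "(norm v)\<^sup>2 = (\<Sum>j\<in>UNIV. (norm (v $ j))\<^sup>2)" for v :: "complex^'b"
    by (simp add: norm_vec_def L2_set_def sum_nonneg)
  have "(norm (A ** B))\<^sup>2 \<le> (\<Sum>i\<in>UNIV. \<Sum>j\<in>UNIV. (norm (A $ i))\<^sup>2 * (L2_set (\<lambda>k. norm (B $ k $ j)) UNIV)\<^sup>2)"
    unfolding sq[of "A ** B"] power_mult_distrib[symmetric]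
    by (intro sum_mono power_mono entry) auto
  also have "\<dots> = (\<Sum>i\<in>UNIV. (norm (A $ i))\<^sup>2) * (\<Sum>j\<in>UNIV. (L2_set (\<lambda>k. norm (B $ k $ j)) UNIV)\<^sup>2)"
    by (simp add: sum_product)
  also have "(\<Sum>j\<in>UNIV. (L2_set (\<lambda>k. norm (B $ k $ j)) UNIV)\<^sup>2) = (norm B)\<^sup>2"
    unfolding sq L2_set_def by (subst sum.swap) (simp add: sum_nonneg)
  also have "(\<Sum>i\<in>UNIV. (norm (A $ i))\<^sup>2) = (norm A)\<^sup>2"
    by (simp add: sq sq1)
  finally show ?thesis
    by (metis mult_nonneg_nonneg norm_ge_zero power2_le_imp_le power_mult_distrib)
qed

text \<open>Positive exponents only: the norm is the Frobenius norm, in which the 2 by 2 identity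
  matrix has norm sqrt 2.\<close>

lemma norm_mpow_le: "n > 0 \<Longrightarrow> norm (mpow A n) \<le> norm A ^ n"
proof (induction n)
  case (Suc n)
  show ?case
  proof (cases "n = 0")
    case False
    have "norm (mpow A (Suc n)) \<le> norm A * norm (mpow A n)" by (simp add: norm_matrix_mult_le)
    also have "\<dots> \<le> norm A * norm A ^ n" using Suc False by (intro mult_left_mono) auto
    finally show ?thesis by simp
  qed simp
qed simp

text \<open>The remainder begins at the third power, so the norm of the identity does not enter, and
  \<open>fact (k + 3)\<close> may be lowered to \<open>fact k\<close> to sum the series.\<close>

lemma norm_mexp_remainder_le:
  "norm (mexp A - (mat 1 + A + (1/2) *\<^sub>R (A ** A))) \<le> norm A ^ 3 * exp (norm A)"
proof -
  define f where "f k = (1 / fact k) *\<^sub>R mpow A k" for k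
  have exp_sums: "(\<lambda>k. norm A ^ k / fact k) sums exp (norm A)"
    using exp_converges[of "norm A"] by (simp add: divide_inverse mult.commute)
  have le: "norm (f (k + 3)) \<le> norm A ^ 3 * (norm A ^ k / fact k)" for k
  proof -
    have "norm (f (k + 3)) \<le> norm A ^ (k + 3) / fact (k + 3)"
      unfolding f_def using norm_mpow_le[of "k + 3" A] by (simp add: divide_right_mono)
    also have "\<dots> \<le> norm A ^ (k + 3) / fact k"
      by (intro divide_left_mono fact_mono) auto
    finally show ?thesis by (simp add: power_add mult.commute)
  qed
  have sm: "summable (\<lambda>k. norm A ^ 3 * (norm A ^ k / fact k))"
    using exp_sums by (intro summable_mult) (auto simp: sums_iff)
  have "summable (\<lambda>k. f (k + 3))"
    by (rule summable_comparison_test'[OF sm]) (rule le)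
  then have "summable f" by (simp only: summable_iff_shift)
  then have "mexp A = (\<Sum>k. f (k + 3)) + (\<Sum>k<3. f k)"
    unfolding mexp_def f_def by (rule suminf_split_initial_segment)
  also have "(\<Sum>k<3. f k) = mat 1 + A + (1/2) *\<^sub>R (A ** A)"
    by (simp add: f_def numeral_3_eq_3)
  finally have "mexp A - (mat 1 + A + (1/2) *\<^sub>R (A ** A)) = (\<Sum>k. f (k + 3))"
    by simp
  also have "norm \<dots> \<le> (\<Sum>k. norm A ^ 3 * (norm A ^ k / fact k))"
    by (rule norm_suminf_le[OF le sm])
  also have "\<dots> = norm A ^ 3 * exp (norm A)"
    using exp_sums by (subst suminf_mult) (auto simp: sums_iff)
  finally show ?thesis .
qed

section \<open>Two-by-two matrices that contract the form of signature (1,1)\<close>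

lemma mat2_nth [simp]:
  "mat2 a b c d $ 1 $ 1 = a" "mat2 a b c d $ 1 $ 2 = b"
  "mat2 a b c d $ 2 $ 1 = c" "mat2 a b c d $ 2 $ 2 = d"
  by (simp_all add: mat2_def)

lemma matrix_mult_2_nth:
  fixes A B :: cmat
  shows "(A ** B) $ i $ j = A $ i $ 1 * B $ 1 $ j + A $ i $ 2 * B $ 2 $ j"
  by (simp add: matrix_matrix_mult_def sum_2)

lemma csc_nth [simp]: "(c *\<^sub>c A) $ i $ j = c * A $ i $ j"
  by (simp add: csc_def)

lemma norm_csc: "norm (c *\<^sub>c A) = cmod c * norm A"
  by (simp add: norm_vec_def L2_set_def sum_2 norm_mult power_mult_distrib
      distrib_left[symmetric] real_sqrt_mult)

lemma norm_entry_le: "cmod ((A :: cmat) $ i $ j) \<le> norm A"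
  by (meson order_trans Finite_Cartesian_Product.norm_nth_le)

lemma norm_le_sum_entries:
  fixes A :: cmat
  shows "norm A \<le> cmod (A$1$1) + cmod (A$1$2) + cmod (A$2$1) + cmod (A$2$2)"
proof -
  have "norm A \<le> norm (A$1) + norm (A$2)"
    using L2_set_le_sum[of UNIV "\<lambda>i. norm (A $ i)"] by (simp add: norm_vec_def[of A] sum_2)
  moreover have "norm (A$i) \<le> cmod (A$i$1) + cmod (A$i$2)" for i
    using L2_set_le_sum[of UNIV "\<lambda>j. norm (A $ i $ j)"] by (simp add: norm_vec_def[of "A $ i"] sum_2)
  from this[of 1] this[of 2] show ?thesis using calculation by linarith
qed

text \<open>The inequality defining \<open>SU11_le\<close>, written in coordinates:
  \<open>(x, y)\<close> is a vector and \<open>(cmod x)^2 - (cmod y)^2\<close> its value under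
  \<open>Jmat\<close>. In this form stability under products is a chain of two inequalities.\<close>

definition contracting :: "cmat \<Rightarrow> bool" where
  "contracting A \<longleftrightarrow> det A = 1 \<and> (\<forall>x y.
     (cmod (A$1$1 * x + A$1$2 * y))\<^sup>2 - (cmod (A$2$1 * x + A$2$2 * y))\<^sup>2 \<le> (cmod x)\<^sup>2 - (cmod y)\<^sup>2)"

lemma SU11_le_contracting:
  assumes "A \<in> SU11_le"
  shows "contracting A"
  unfolding contracting_def
proof (intro conjI allI)
  show "det A = 1" using assms by (simp add: SU11_le_def)
  fix x y
  define v :: "complex^2" where "v = vector [x, y]"
  have v: "v $ 1 = x" "v $ 2 = y" by (simp_all add: v_def)
  have "0 \<le> Re (qform (Jmat - adj A ** Jmat ** A) v)"
    using assms by (simp add: SU11_le_def psd_def)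
  also have "qform (Jmat - adj A ** Jmat ** A) v = x * cnj x - y * cnj y
      - (A$1$1 * x + A$1$2 * y) * cnj (A$1$1 * x + A$1$2 * y)
      + (A$2$1 * x + A$2$2 * y) * cnj (A$2$1 * x + A$2$2 * y)"
    by (simp add: qform_def sum_2 v matrix_mult_2_nth adj_def Jmat_def algebra_simps)
  also have "Re \<dots> = (cmod x)\<^sup>2 - (cmod y)\<^sup>2 - (cmod (A$1$1 * x + A$1$2 * y))\<^sup>2
      + (cmod (A$2$1 * x + A$2$2 * y))\<^sup>2"
    by (simp only: complex_norm_square[symmetric] minus_complex.sel plus_complex.sel Re_complex_of_real)
  finally show "(cmod (A$1$1 * x + A$1$2 * y))\<^sup>2 - (cmod (A$2$1 * x + A$2$2 * y))\<^sup>2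
      \<le> (cmod x)\<^sup>2 - (cmod y)\<^sup>2" by simp
qed

lemma contracting_one [simp]: "contracting (mat 1)"
  by (simp add: contracting_def det_2 mat_def)

lemma contracting_mult:
  assumes "contracting A" "contracting B"
  shows "contracting (A ** B)"
  unfolding contracting_def
proof (intro conjI allI)
  show "det (A ** B) = 1" using assms by (simp add: contracting_def det_mul)
  fix x y
  let ?x = "B$1$1 * x + B$1$2 * y" and ?y = "B$2$1 * x + B$2$2 * y"
  have "(A ** B) $ i $ 1 * x + (A ** B) $ i $ 2 * y = A$i$1 * ?x + A$i$2 * ?y" for i
    by (simp add: matrix_mult_2_nth algebra_simps)
  moreover have "(cmod (A$1$1 * ?x + A$1$2 * ?y))\<^sup>2 - (cmod (A$2$1 * ?x + A$2$2 * ?y))\<^sup>2 \<le> (cmod ?x)\<^sup>2 - (cmod ?y)\<^sup>2"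
    using assms(1) unfolding contracting_def by blast
  moreover have "(cmod ?x)\<^sup>2 - (cmod ?y)\<^sup>2 \<le> (cmod x)\<^sup>2 - (cmod y)\<^sup>2"
    using assms(2) unfolding contracting_def by blast
  ultimately show "(cmod ((A ** B)$1$1 * x + (A ** B)$1$2 * y))\<^sup>2 - (cmod ((A ** B)$2$1 * x + (A ** B)$2$2 * y))\<^sup>2
      \<le> (cmod x)\<^sup>2 - (cmod y)\<^sup>2"
    by (simp only:)
qed

lemma contracting_mprod: "(\<And>i. i < n \<Longrightarrow> contracting (A i)) \<Longrightarrow> contracting (mprod A n)"
  by (induction n) (auto intro: contracting_mult)

text \<open>The orbit of the origin sees only the second column of a product. This estimate shows
  that the lower entry of that column already determines the norm up to a factor, hence its
  logarithm up to a constant.\<close>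

lemma contracting_norm_le:
  assumes "contracting A"
  shows "1 \<le> cmod (A$2$2)" "norm A \<le> 5 * cmod (A$2$2)"
proof -
  have q: "(cmod (A$1$1 * x + A$1$2 * y))\<^sup>2 - (cmod (A$2$1 * x + A$2$2 * y))\<^sup>2 \<le> (cmod x)\<^sup>2 - (cmod y)\<^sup>2" for x y
    using assms by (simp add: contracting_def)
  have d: "1 + (cmod (A$1$2))\<^sup>2 \<le> (cmod (A$2$2))\<^sup>2" using q[of 0 1] by simp
  then have "1\<^sup>2 \<le> (cmod (A$2$2))\<^sup>2" by (smt (verit) one_power2 zero_le_power2)
  then show d1: "1 \<le> cmod (A$2$2)" by (rule power2_le_imp_le) simp
  have b: "cmod (A$1$2) \<le> cmod (A$2$2)" by (rule power2_le_imp_le) (use d in linarith, simp)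
  \<comment> \<open>Otherwise the vector \<open>(- A$2$2 / A$2$1, 1)\<close> lies in the open disc,
    where the form is negative, while its image has second component 0 and hence a nonnegative
    form.\<close>
  have c: "cmod (A$2$1) \<le> cmod (A$2$2)"
  proof (rule ccontr)
    assume "\<not> ?thesis"
    then have lt: "cmod (A$2$2) < cmod (A$2$1)" by simp
    then have c0: "A$2$1 \<noteq> 0" using d1 by auto
    have "0 \<le> (cmod (- A$2$2 / A$2$1))\<^sup>2 - 1"
    proof -
      have "A$2$1 * (- A$2$2 / A$2$1) + A$2$2 * 1 = 0" using c0 by simp
      then have "(cmod (A$1$1 * (- A$2$2 / A$2$1) + A$1$2 * 1))\<^sup>2 - 0 \<le> (cmod (- A$2$2 / A$2$1))\<^sup>2 - 1"
        using q[of "- A$2$2 / A$2$1" 1] by (simp only: norm_zero norm_one power_zero_numeral power_one)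
      then show ?thesis
        by (intro order_trans[OF zero_le_power2]) (simp only: diff_zero)
    qed
    moreover have "cmod (- A$2$2 / A$2$1) < 1" using lt c0 by (simp add: norm_divide divide_less_eq)
    then have "(cmod (- A$2$2 / A$2$1))\<^sup>2 < 1" 
      by (simp only: abs_square_less_1 abs_norm_cancel)
    ultimately show False by simp
  qed
  \<comment> \<open>The determinant bounds the remaining entry by \<open>2 * cmod (A$2$2)\<close>;
    with three entries bounded by \<open>cmod (A$2$2)\<close> the sum gives the constant 5.\<close>
  have "A$1$1 * A$2$2 = 1 + A$1$2 * A$2$1"
    using assms by (simp add: contracting_def det_2 algebra_simps)
  then have "cmod (A$1$1) * cmod (A$2$2) \<le> 1 + cmod (A$1$2) * cmod (A$2$1)"
    using norm_triangle_ineq[of 1 "A$1$2 * A$2$1"] by (simp only: norm_mult[symmetric] norm_one)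
  also have "\<dots> \<le> cmod (A$2$2) * cmod (A$2$2) + cmod (A$2$2) * cmod (A$2$2)"
    using b c mult_mono[OF d1 d1] by (intro add_mono mult_mono) auto
  finally have "cmod (A$1$1) * cmod (A$2$2) \<le> (2 * cmod (A$2$2)) * cmod (A$2$2)" by simp
  then have "cmod (A$1$1) \<le> 2 * cmod (A$2$2)"
    by (rule mult_right_le_imp_le) (use d1 in linarith)
  then show "norm A \<le> 5 * cmod (A$2$2)"
    using norm_le_sum_entries[of A] b c by simp
qed

lemma contracting_disc:
  assumes "contracting A" "cmod x \<le> cmod y"
  shows "cmod (A$1$1 * x + A$1$2 * y) \<le> cmod (A$2$1 * x + A$2$2 * y)"
proof -
  have "(cmod x)\<^sup>2 \<le> (cmod y)\<^sup>2" using assms by (intro power_mono) auto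
  then have "(cmod (A$1$1 * x + A$1$2 * y))\<^sup>2 \<le> (cmod (A$2$1 * x + A$2$2 * y))\<^sup>2"
    using assms(1) unfolding contracting_def by (smt (verit))
  then show ?thesis by (rule power2_le_imp_le) simp
qed

lemma norm_ge_1_of_det:
  fixes A :: cmat
  assumes "det A = 1"
  shows "1 \<le> norm A"
proof -
  have "1 = cmod (A$1$1 * A$2$2 - A$1$2 * A$2$1)" using assms by (simp add: det_2)
  also have "\<dots> \<le> cmod (A$1$1) * cmod (A$2$2) + cmod (A$1$2) * cmod (A$2$1)"
    unfolding norm_mult[symmetric] by (rule norm_triangle_ineq4)
  also have "\<dots> \<le> ((cmod (A$1$1))\<^sup>2 + (cmod (A$2$2))\<^sup>2 + (cmod (A$1$2))\<^sup>2 + (cmod (A$2$1))\<^sup>2) / 2"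
    using sum_squares_bound[of "cmod (A$1$1)" "cmod (A$2$2)"] sum_squares_bound[of "cmod (A$1$2)" "cmod (A$2$1)"]
    by (simp add: field_simps)
  also have "\<dots> = (norm A)\<^sup>2 / 2"
    by (simp add: norm_vec_def L2_set_def sum_2)
  also have "\<dots> \<le> (norm A)\<^sup>2" by simp
  finally have "1\<^sup>2 \<le> (norm A)\<^sup>2" by simp
  then show ?thesis by (rule power2_le_imp_le) simp
qed

text \<open>The inverse is the adjugate, which permutes the entries up to sign and so keeps the
  Frobenius norm. It serves to bound the cost of forgetting the first factor of a product.\<close>

lemma det_1_inverse:
  fixes A :: cmat
  assumes "det A = 1"
  obtains B where "B ** A = mat 1" "A ** B = mat 1" "norm B = norm A"
proof
  define B where "B = mat2 (A$2$2) (- A$1$2) (- A$2$1) (A$1$1)"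
  show "B ** A = mat 1" "A ** B = mat 1"
    using assms by (simp_all add: vec_eq_iff forall_2 B_def matrix_mult_2_nth mat_def det_2 algebra_simps)
  show "norm B = norm A"
    by (simp add: norm_vec_def L2_set_def sum_2 B_def add.commute)
qed

lemma mprod_add: "mprod A (m + n) = mprod (\<lambda>i. A (i + m)) n ** mprod A m"
  by (induction n) (simp_all add: matrix_mul_assoc add.commute)

lemma mprod_cong: "(\<And>i. i < n \<Longrightarrow> A i = B i) \<Longrightarrow> mprod A n = mprod B n"
  by (induction n) auto

section \<open>Second-order expansions\<close>

locale small_parameters =
  fixes F :: "'x filter" and e d :: "'x \<Rightarrow> real"
  assumes e_tendsto: "(e \<longlongrightarrow> 0) F"
    and d_tendsto: "(d \<longlongrightarrow> 0) F"
    and d_nonneg: "eventually (\<lambda>x. 0 \<le> d x) F"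
begin

definition \<rho>1 :: "'x \<Rightarrow> real" where "\<rho>1 x = \<bar>e x\<bar> + d x"
definition \<rho>2 :: "'x \<Rightarrow> real" where "\<rho>2 x = (e x)\<^sup>2 + d x"
definition \<rho>3 :: "'x \<Rightarrow> real" where "\<rho>3 x = \<bar>e x\<bar> ^ 3 + \<bar>e x\<bar> * d x + (d x)\<^sup>2"

text \<open>Stated through norms, so that one notation covers real, complex and matrix values,
  always compared with a real scale.\<close>

abbreviation bO :: "('x \<Rightarrow> 'b::real_normed_vector) \<Rightarrow> ('x \<Rightarrow> real) \<Rightarrow> bool" where
  "bO f g \<equiv> (\<lambda>x. norm (f x)) \<in> O[F](g)"

lemma bO_mono: "eventually (\<lambda>x. norm (f x) \<le> norm (g x)) F \<Longrightarrow> bO g h \<Longrightarrow> bO f h"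
  by (rule landau_o.big_trans[OF landau_o.big_mono]) simp_all

lemma bO_trans: "bO f g \<Longrightarrow> g \<in> O[F](h) \<Longrightarrow> bO f h"
  by (rule landau_o.big_trans)

lemma bO_add: "bO f h \<Longrightarrow> bO g h \<Longrightarrow> bO (\<lambda>x. f x + g x) h"
  by (rule landau_o.big_trans[OF landau_o.big_mono sum_in_bigo(1)[of "\<lambda>x. norm (f x)" _ _ "\<lambda>x. norm (g x)"]])
    (auto intro!: always_eventually norm_triangle_ineq)

lemma bO_diff: "bO f h \<Longrightarrow> bO g h \<Longrightarrow> bO (\<lambda>x. f x - g x) h"
  by (rule landau_o.big_trans[OF landau_o.big_mono sum_in_bigo(1)[of "\<lambda>x. norm (f x)" _ _ "\<lambda>x. norm (g x)"]])
    (auto intro!: always_eventually norm_triangle_ineq4)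

lemma bO_mult:
  fixes f g :: "'x \<Rightarrow> 'b::real_normed_algebra"
  shows "bO f h \<Longrightarrow> bO g k \<Longrightarrow> bO (\<lambda>x. f x * g x) (\<lambda>x. h x * k x)"
  by (rule landau_o.big_trans[OF landau_o.big_mono landau_o.big.mult])
    (auto intro!: always_eventually norm_mult_ineq)

lemma bO_mult1:
  fixes f g :: "'x \<Rightarrow> 'b::real_normed_algebra"
  shows "bO f (\<lambda>_. 1) \<Longrightarrow> bO g k \<Longrightarrow> bO (\<lambda>x. f x * g x) k"
  using bO_mult[of f "\<lambda>_. 1" g k] by simp

lemma bO_mult2:
  fixes f g :: "'x \<Rightarrow> 'b::real_normed_algebra"
  shows "bO f h \<Longrightarrow> bO g (\<lambda>_. 1) \<Longrightarrow> bO (\<lambda>x. f x * g x) h"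
  using bO_mult[of f h g "\<lambda>_. 1"] by simp

lemma bO_Re: "bO f h \<Longrightarrow> bO (\<lambda>x. Re (f x)) h"
  by (rule bO_mono[of _ f]) (auto intro!: always_eventually abs_Re_le_cmod)

lemma bO_const: "bO (\<lambda>_. c) (\<lambda>_. 1)"
  by simp

lemma bO_of_real: "bO f h \<Longrightarrow> bO (\<lambda>x. complex_of_real (f x)) h"
  by simp

lemma bO_cnj: "bO f h \<Longrightarrow> bO (\<lambda>x. cnj (f x)) h"
  by simp

lemma small: "eventually (\<lambda>x. \<bar>e x\<bar> \<le> 1 \<and> 0 \<le> d x \<and> d x \<le> 1) F"
proof -
  have "eventually (\<lambda>x. \<bar>e x\<bar> < 1) F"
    using tendsto_rabs[OF e_tendsto] by (intro order_tendstoD(2)[of _ 0]) auto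
  moreover have "eventually (\<lambda>x. d x < 1) F"
    using d_tendsto by (intro order_tendstoD(2)[of _ 0]) auto
  ultimately show ?thesis using d_nonneg by eventually_elim auto
qed

lemma scaleI:
  fixes f g :: "'x \<Rightarrow> real"
  assumes "\<And>x. 0 \<le> d x \<Longrightarrow> \<bar>e x\<bar> \<le> 1 \<Longrightarrow> d x \<le> 1 \<Longrightarrow> \<bar>f x\<bar> \<le> c * \<bar>g x\<bar>"
  shows "f \<in> O[F](g)"
  by (rule bigoI[of _ c], use small in eventually_elim) (use assms in auto)

lemma scales:
  "\<rho>1 \<in> O[F](\<lambda>_. 1)" "\<rho>2 \<in> O[F](\<rho>1)" "\<rho>3 \<in> O[F](\<rho>2)"
  "(\<lambda>x. \<rho>1 x * \<rho>1 x) \<in> O[F](\<rho>2)" "(\<lambda>x. \<rho>1 x * \<rho>2 x) \<in> O[F](\<rho>3)" 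
proof -
  show "\<rho>1 \<in> O[F](\<lambda>_. 1)"
    by (rule scaleI[of _ 2]) (simp add: \<rho>1_def)
  show "\<rho>2 \<in> O[F](\<rho>1)"
  proof (rule scaleI[of _ 1])
    fix x assume x: "0 \<le> d x" "\<bar>e x\<bar> \<le> 1"
    have "(e x)\<^sup>2 \<le> \<bar>e x\<bar>" using power_decreasing[of 1 2 "\<bar>e x\<bar>"] x by simp
    then show "\<bar>\<rho>2 x\<bar> \<le> 1 * \<bar>\<rho>1 x\<bar>" using x by (simp add: \<rho>1_def \<rho>2_def)
  qed
  show "\<rho>3 \<in> O[F](\<rho>2)"
  proof (rule scaleI[of _ 2])
    fix x assume x: "0 \<le> d x" "\<bar>e x\<bar> \<le> 1" "d x \<le> 1"
    have "\<bar>e x\<bar> ^ 3 \<le> (e x)\<^sup>2" using power_decreasing[of 2 3 "\<bar>e x\<bar>"] x by simp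
    moreover have "\<bar>e x\<bar> * d x \<le> d x" using x by (simp add: mult_left_le_one_le)
    moreover have "(d x)\<^sup>2 \<le> d x" using x by (simp add: power2_eq_square mult_left_le_one_le)
    ultimately have "\<rho>3 x \<le> (e x)\<^sup>2 + d x + d x"
      unfolding \<rho>3_def by (intro add_mono)
    also have "\<dots> \<le> 2 * \<rho>2 x" by (simp add: \<rho>2_def)
    finally have "\<rho>3 x \<le> 2 * \<rho>2 x" .
    then show "\<bar>\<rho>3 x\<bar> \<le> 2 * \<bar>\<rho>2 x\<bar>" using x by (simp add: \<rho>3_def \<rho>2_def)
  qed
  show "(\<lambda>x. \<rho>1 x * \<rho>1 x) \<in> O[F](\<rho>2)"
  proof (rule scaleI[of _ 3])
    fix x assume x: "0 \<le> d x" "\<bar>e x\<bar> \<le> 1" "d x \<le> 1"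
    have "\<bar>e x\<bar> * d x \<le> d x" using x by (simp add: mult_left_le_one_le)
    moreover have "d x * d x \<le> d x" using x by (simp add: mult_left_le_one_le)
    moreover have "\<rho>1 x * \<rho>1 x = (e x)\<^sup>2 + 2 * (\<bar>e x\<bar> * d x) + d x * d x"
      by (simp add: \<rho>1_def power2_eq_square algebra_simps)
    ultimately have "\<rho>1 x * \<rho>1 x \<le> (e x)\<^sup>2 + 2 * d x + d x" by simp
    also have "\<dots> \<le> 3 * \<rho>2 x" by (simp add: \<rho>2_def)
    finally have "\<rho>1 x * \<rho>1 x \<le> 3 * \<rho>2 x" .
    then show "\<bar>\<rho>1 x * \<rho>1 x\<bar> \<le> 3 * \<bar>\<rho>2 x\<bar>" using x by (simp add: \<rho>2_def)
  qed
  show "(\<lambda>x. \<rho>1 x * \<rho>2 x) \<in> O[F](\<rho>3)"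
  proof (rule scaleI[of _ 2])
    fix x assume x: "0 \<le> d x" "\<bar>e x\<bar> \<le> 1" "d x \<le> 1"
    have "\<rho>1 x * \<rho>2 x = \<bar>e x\<bar> ^ 3 + \<bar>e x\<bar> * d x + \<bar>e x\<bar> * (\<bar>e x\<bar> * d x) + (d x)\<^sup>2"
      by (simp add: \<rho>1_def \<rho>2_def power2_eq_square power3_eq_cube algebra_simps)
    moreover have "\<bar>e x\<bar> * (\<bar>e x\<bar> * d x) \<le> \<bar>e x\<bar> * d x"
      using x by (simp add: mult_left_le_one_le)
    ultimately have "\<rho>1 x * \<rho>2 x \<le> \<bar>e x\<bar> ^ 3 + \<bar>e x\<bar> * d x + \<bar>e x\<bar> * d x + (d x)\<^sup>2" by (simp add: mult.commute)
    also have "\<dots> \<le> 2 * \<rho>3 x" using x by (simp add: \<rho>3_def mult.commute)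
    finally have "\<rho>1 x * \<rho>2 x \<le> 2 * \<rho>3 x" .
    then show "\<bar>\<rho>1 x * \<rho>2 x\<bar> \<le> 2 * \<bar>\<rho>3 x\<bar>" using x by (simp add: \<rho>1_def \<rho>2_def)
  qed
qed

lemma scale_e: "bO (\<lambda>x. complex_of_real (e x)) \<rho>1"
  using scaleI[of e 1 \<rho>1] by (simp add: \<rho>1_def)

lemma scale_e2: "bO (\<lambda>x. complex_of_real ((e x)\<^sup>2)) \<rho>2"
  using scaleI[of "\<lambda>x. (e x)\<^sup>2" 1 \<rho>2] by (simp add: \<rho>2_def norm_power)

lemma scale_d: "bO (\<lambda>x. complex_of_real (d x)) \<rho>2"
  using scaleI[of d 1 \<rho>2] by (simp add: \<rho>2_def)

lemmas bO_21 = bO_trans[OF _ scales(2)]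
lemmas bO_32 = bO_trans[OF _ scales(3)]
lemmas bO_10 = bO_trans[OF _ scales(1)]
lemmas bO_11 = bO_trans[OF bO_mult scales(4)]
lemmas bO_12 = bO_trans[OF bO_mult scales(5)]

lemma scale1_tendsto: "(\<rho>1 \<longlongrightarrow> 0) F"
  unfolding \<rho>1_def using tendsto_add[OF tendsto_rabs[OF e_tendsto] d_tendsto] by simp

lemma bO_1_tendsto:
  assumes "bO f \<rho>1"
  shows "(f \<longlongrightarrow> 0) F"
proof -
  obtain c where "c > 0" and c: "eventually (\<lambda>x. norm (norm (f x)) \<le> c * norm (\<rho>1 x)) F"
    using assms by (rule landau_o.bigE)
  have "((\<lambda>x. c * norm (\<rho>1 x)) \<longlongrightarrow> c * 0) F"
    by (intro tendsto_mult tendsto_const tendsto_norm_zero scale1_tendsto)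
  then show ?thesis
    by (intro Lim_null_comparison[of f "\<lambda>x. c * norm (\<rho>1 x)"]) (use c in auto)
qed

lemma bO_cube:
  fixes f g h :: "'x \<Rightarrow> 'b::real_normed_algebra"
  shows "bO f \<rho>1 \<Longrightarrow> bO g \<rho>1 \<Longrightarrow> bO h \<rho>1 \<Longrightarrow> bO (\<lambda>x. f x * (g x * h x)) \<rho>3"
  by (intro bO_12 bO_11)

section \<open>Second-order Taylor expansions\<close>

text \<open>The approximation is the real part of the series of the complex logarithm. It is derived
  from the real logarithm of \<open>(cmod (1 + u))^2 = 1 + t\<close>, which avoids branches; the
  quadratic part comes from \<open>(cmod u)^2 / 2 - (Re u)^2 = - Re (u^2) / 2\<close>.\<close>

lemma ln_cmod_expansion:
  assumes u: "bO u \<rho>1"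
  shows "bO (\<lambda>x. ln (cmod (1 + u x)) - Re (u x - (u x)\<^sup>2 / 2)) \<rho>3"
proof -
  define t where "t x = 2 * Re (u x) + (cmod (u x))\<^sup>2" for x
  have Ru: "bO (\<lambda>x. Re (u x)) \<rho>1" by (rule bO_Re[OF u])
  have nu: "bO (\<lambda>x. cmod (u x)) \<rho>1" using u by simp
  have sq: "bO (\<lambda>x. cmod (u x) * cmod (u x)) \<rho>2" by (rule bO_11[OF nu nu])
  have t1: "bO t \<rho>1"
    unfolding t_def power2_eq_square
    by (intro bO_add bO_mult1[OF bO_const] Ru bO_21[OF sq])
  have "(\<lambda>t::real. ln (1 + t) - t + t\<^sup>2 / 2) \<in> O[at 0](\<lambda>t. t ^ 3)"
    by real_asymp
  then obtain c where "c > 0" and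
    c: "eventually (\<lambda>t::real. norm (ln (1 + t) - t + t\<^sup>2 / 2) \<le> c * norm (t ^ 3)) (at 0)"
    by (rule landau_o.bigE)
  \<comment> \<open>\<open>t x\<close> may vanish, so the punctured neighbourhood is filled in; at 0
    both sides are 0.\<close>
  from c have "eventually (\<lambda>t::real. norm (ln (1 + t) - t + t\<^sup>2 / 2) \<le> c * norm (t ^ 3)) (nhds 0)"
    unfolding eventually_at_filter
  proof eventually_elim
    case (elim t)
    then show ?case by (cases "t = 0") auto
  qed
  then have ev: "eventually (\<lambda>x. norm (ln (1 + t x) - t x + (t x)\<^sup>2 / 2) \<le> c * norm (t x ^ 3)) F"
    using bO_1_tendsto[OF t1] unfolding filterlim_iff by blast
  have "bO (\<lambda>x. ln (1 + t x) - t x + (t x)\<^sup>2 / 2) (\<lambda>x. norm (t x * (t x * t x)))"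
    by (rule bigoI[of _ c]) (use ev in \<open>simp add: power3_eq_cube mult.assoc\<close>)
  then have rem: "bO (\<lambda>x. ln (1 + t x) - t x + (t x)\<^sup>2 / 2) \<rho>3"
    by (rule landau_o.big_trans) (rule bO_cube[OF t1 t1 t1])
  have "eventually (\<lambda>x. \<bar>t x\<bar> < 1) F"
    using tendsto_rabs[OF bO_1_tendsto[OF t1]] by (intro order_tendstoD(2)[of _ 0]) auto
  then have eq: "eventually (\<lambda>x. ln (cmod (1 + u x)) - Re (u x - (u x)\<^sup>2 / 2) =
      (1/2) * (ln (1 + t x) - t x + (t x)\<^sup>2 / 2)
      - Re (u x) * (cmod (u x) * cmod (u x)) - (1/4) * ((cmod (u x) * cmod (u x)) * (cmod (u x) * cmod (u x)))) F"
  proof eventually_elim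
    case (elim x)
    have c2: "(cmod (1 + u x))\<^sup>2 = 1 + t x"
      unfolding t_def cmod_power2 by (simp add: power2_eq_square algebra_simps)
    have "cmod (1 + u x) \<noteq> 0" using c2 elim by (metis abs_minus_cancel abs_one add_eq_0_iff less_irrefl power_zero_numeral)
    then have "2 * ln (cmod (1 + u x)) = ln (1 + t x)"
      unfolding c2[symmetric] by (simp add: ln_realpow)
    moreover have n: "cmod (u x) * cmod (u x) = Re (u x) * Re (u x) + Im (u x) * Im (u x)"
      using cmod_power2[of "u x"] by (simp add: power2_eq_square)
    moreover have "Re ((u x)\<^sup>2 / 2) = (Re (u x) * Re (u x) - Im (u x) * Im (u x)) / 2"
      by (simp add: power2_eq_square)
    moreover have "t x = 2 * Re (u x) + cmod (u x) * cmod (u x)" by (simp add: t_def power2_eq_square)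
    ultimately show ?case by (simp only: minus_complex.sel n) (simp add: field_simps power2_eq_square)
  qed
  have sq2: "bO (\<lambda>x. (cmod (u x) * cmod (u x)) * (cmod (u x) * cmod (u x))) \<rho>3"
    by (rule bO_12[OF bO_21[OF sq] sq])
  have "bO (\<lambda>x. (1/2) * (ln (1 + t x) - t x + (t x)\<^sup>2 / 2)
      - Re (u x) * (cmod (u x) * cmod (u x)) - (1/4) * ((cmod (u x) * cmod (u x)) * (cmod (u x) * cmod (u x)))) \<rho>3"
    by (intro bO_diff bO_mult1[OF bO_const] rem bO_12[OF Ru sq] sq2)
  then show ?thesis
    by (rule bO_mono[rotated]) (use eq in eventually_elim, simp)
qed

text \<open>\<open>n21\<close> and \<open>n22\<close> will be the lower row of the matrix
  exponential. Up to \<open>\<rho>3\<close> only the linear part \<open>e * A\<close> contributes to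
  the square of \<open>u\<close>. On taking real parts the first-order term in \<open>p\<close> and
  the term in \<open>y\<close> disappear, and the \<open>p^2\<close> of the square cancels against
  that of \<open>n22\<close>, so \<open>p\<close> survives only in the product with
  \<open>b * z\<close>.\<close>

lemma log_expansion:
  fixes b b' bq z n21 n22 :: "'x \<Rightarrow> complex" and p y q :: "'x \<Rightarrow> real"
  assumes bd: "bO b (\<lambda>_. 1)" "bO b' (\<lambda>_. 1)" "bO bq (\<lambda>_. 1)" "bO z (\<lambda>_. 1)"
      "bO p (\<lambda>_. 1)" "bO y (\<lambda>_. 1)" "bO q (\<lambda>_. 1)"
    and n21: "bO (\<lambda>x. n21 x - (of_real (e x) * b x + of_real ((e x)\<^sup>2) * b' x + of_real (d x) * (\<i> * bq x))) \<rho>3"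
    and n22: "bO (\<lambda>x. n22 x - (1 - of_real (e x) * (\<i> * of_real (p x))
        + of_real ((e x)\<^sup>2) * ((b x * cnj (b x) - of_real (p x) * of_real (p x)) / 2 - \<i> * of_real (y x))
        + of_real (d x) * of_real (q x))) \<rho>3"
  shows "bO (\<lambda>x. ln (cmod (n21 x * z x + n22 x)) -
     (d x * q x + (e x)\<^sup>2 * (cmod (b x))\<^sup>2 / 2
      + Re (z x * (of_real (e x) * b x + of_real ((e x)\<^sup>2) * (b' x + \<i> * (of_real (p x) * b x))
            + of_real (d x) * (\<i> * bq x)))
      - (e x)\<^sup>2 / 2 * Re ((z x)\<^sup>2 * (b x)\<^sup>2))) \<rho>3"
proof -
  define A where "A x = b x * z x - \<i> * of_real (p x)" for x
  define B where "B x = b' x * z x + ((b x * cnj (b x) - of_real (p x) * of_real (p x)) * (1/2) - \<i> * of_real (y x))" for x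
  define D where "D x = (\<i> * bq x) * z x + of_real (q x)" for x
  define u0 where "u0 x = of_real (e x) * A x + (of_real ((e x)\<^sup>2) * B x + of_real (d x) * D x)" for x
  define u where "u x = n21 x * z x + n22 x - 1" for x
  note rules = bO_add bO_diff bO_mult1 bO_const bO_of_real bO_cnj bd
  have ABD: "bO A (\<lambda>_. 1)" "bO B (\<lambda>_. 1)" "bO D (\<lambda>_. 1)"
    unfolding A_def B_def D_def by (intro rules)+
  have "bO (\<lambda>x. (n21 x - (of_real (e x) * b x + of_real ((e x)\<^sup>2) * b' x + of_real (d x) * (\<i> * bq x))) * z x
     + (n22 x - (1 - of_real (e x) * (\<i> * of_real (p x))
        + of_real ((e x)\<^sup>2) * ((b x * cnj (b x) - of_real (p x) * of_real (p x)) / 2 - \<i> * of_real (y x))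
        + of_real (d x) * of_real (q x)))) \<rho>3"
    by (intro bO_add bO_mult2 n21 n22 bd)
  also have "(\<lambda>x. (n21 x - (of_real (e x) * b x + of_real ((e x)\<^sup>2) * b' x + of_real (d x) * (\<i> * bq x))) * z x
     + (n22 x - (1 - of_real (e x) * (\<i> * of_real (p x))
        + of_real ((e x)\<^sup>2) * ((b x * cnj (b x) - of_real (p x) * of_real (p x)) / 2 - \<i> * of_real (y x))
        + of_real (d x) * of_real (q x)))) = (\<lambda>x. u x - u0 x)"
    by (rule ext) (simp add: u_def u0_def A_def B_def D_def field_simps)
  finally have u_u0: "bO (\<lambda>x. u x - u0 x) \<rho>3" .
  have eA1: "bO (\<lambda>x. of_real (e x) * A x) \<rho>1"
    by (rule bO_mult2[OF scale_e ABD(1)])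
  have "bO (\<lambda>x. (u x - u0 x) + (of_real ((e x)\<^sup>2) * B x + of_real (d x) * D x)) \<rho>2"
    by (intro bO_add bO_32[OF u_u0] bO_mult2 scale_e2 scale_d ABD)
  then have u_eA: "bO (\<lambda>x. u x - of_real (e x) * A x) \<rho>2"
    by (simp add: u0_def algebra_simps)
  have "bO (\<lambda>x. (u x - of_real (e x) * A x) + of_real (e x) * A x) \<rho>1"
    by (intro bO_add bO_21[OF u_eA] eA1)
  then have u1: "bO u \<rho>1" by simp
  \<comment> \<open>A difference of squares: the sum is of first order, the difference of
    second.\<close>
  have "bO (\<lambda>x. (u x + of_real (e x) * A x) * (u x - of_real (e x) * A x)) \<rho>3"
    by (intro bO_12 bO_add u1 eA1 u_eA)
  then have sq: "bO (\<lambda>x. (1/2) * ((u x + of_real (e x) * A x) * (u x - of_real (e x) * A x))) \<rho>3"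
    by (rule bO_mult1[OF bO_const])
  have "bO (\<lambda>x. (ln (cmod (1 + u x)) - Re (u x - (u x)\<^sup>2 / 2)) + Re ((u x - u0 x)
      - (1/2) * ((u x + of_real (e x) * A x) * (u x - of_real (e x) * A x)))) \<rho>3"
    by (intro bO_add bO_Re bO_diff ln_cmod_expansion u1 u_u0 sq)
  also have "(\<lambda>x. (ln (cmod (1 + u x)) - Re (u x - (u x)\<^sup>2 / 2)) + Re ((u x - u0 x)
      - (1/2) * ((u x + of_real (e x) * A x) * (u x - of_real (e x) * A x)))) =
    (\<lambda>x. ln (cmod (n21 x * z x + n22 x)) - Re (u0 x - (of_real (e x) * A x)\<^sup>2 / 2))"
  proof
    fix x
    have "1 + u x = n21 x * z x + n22 x" by (simp add: u_def)
    moreover have "(u x - u0 x) - (1/2) * ((u x + of_real (e x) * A x) * (u x - of_real (e x) * A x))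
      = (u x - (u x)\<^sup>2 / 2) - (u0 x - (of_real (e x) * A x)\<^sup>2 / 2)"
      by (simp add: power2_eq_square field_simps)
    ultimately show "(ln (cmod (1 + u x)) - Re (u x - (u x)\<^sup>2 / 2)) + Re ((u x - u0 x)
      - (1/2) * ((u x + of_real (e x) * A x) * (u x - of_real (e x) * A x)))
      = ln (cmod (n21 x * z x + n22 x)) - Re (u0 x - (of_real (e x) * A x)\<^sup>2 / 2)"
      by (simp only: minus_complex.sel)
  qed
  also have "(\<lambda>x. Re (u0 x - (of_real (e x) * A x)\<^sup>2 / 2)) = (\<lambda>x. (d x * q x + (e x)\<^sup>2 * (cmod (b x))\<^sup>2 / 2
      + Re (z x * (of_real (e x) * b x + of_real ((e x)\<^sup>2) * (b' x + \<i> * (of_real (p x) * b x))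
            + of_real (d x) * (\<i> * bq x)))
      - (e x)\<^sup>2 / 2 * Re ((z x)\<^sup>2 * (b x)\<^sup>2)))"
    unfolding cmod_power2 u0_def A_def B_def D_def
    by (rule ext) (simp add: power2_eq_square field_simps)
  finally show ?thesis .
qed

text \<open>The first-order term is the vector field of the infinitesimal Moebius action, called
  \<open>V\<close> in the proof. With \<open>A\<close> the first-order part of the denominator,
  \<open>A * z + V\<close> is that of the numerator; so multiplying by the denominator, which stays
  away from 0, leaves only second-order terms.\<close>

lemma moebius_expansion:
  fixes b z n11 n12 n21 n22 :: "'x \<Rightarrow> complex" and p :: "'x \<Rightarrow> real"
  assumes bd: "bO b (\<lambda>_. 1)" "bO z (\<lambda>_. 1)" "bO p (\<lambda>_. 1)"
    and n11: "bO (\<lambda>x. n11 x - (1 + of_real (e x) * (\<i> * of_real (p x)))) \<rho>2"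
    and n12: "bO (\<lambda>x. n12 x - of_real (e x) * cnj (b x)) \<rho>2"
    and n21: "bO (\<lambda>x. n21 x - of_real (e x) * b x) \<rho>2"
    and n22: "bO (\<lambda>x. n22 x - (1 - of_real (e x) * (\<i> * of_real (p x)))) \<rho>2"
  shows "bO (\<lambda>x. (n11 x * z x + n12 x) / (n21 x * z x + n22 x)
      - (z x + of_real (e x) * (cnj (b x) + 2 * \<i> * of_real (p x) * z x - b x * (z x)\<^sup>2))) \<rho>2"
proof -
  define V where "V x = cnj (b x) + 2 * \<i> * of_real (p x) * z x - b x * (z x * z x)" for x
  define A where "A x = b x * z x - \<i> * of_real (p x)" for x
  define w where "w x = n21 x * z x + n22 x" for x
  note rules = bO_add bO_diff bO_mult1 bO_const bO_of_real bO_cnj bd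
  have AV: "bO A (\<lambda>_. 1)" "bO V (\<lambda>_. 1)"
    unfolding A_def V_def by (intro rules)+
  have "bO (\<lambda>x. (n21 x - of_real (e x) * b x) * z x + (n22 x - (1 - of_real (e x) * (\<i> * of_real (p x))))) \<rho>2"
    by (intro bO_add bO_mult2 n21 n22 bd)
  then have w2: "bO (\<lambda>x. w x - (1 + of_real (e x) * A x)) \<rho>2"
    by (simp add: w_def A_def algebra_simps)
  have "bO (\<lambda>x. (w x - (1 + of_real (e x) * A x)) + of_real (e x) * A x) \<rho>1"
    by (intro bO_add bO_21[OF w2] bO_mult2 scale_e AV)
  then have "bO (\<lambda>x. w x - 1) \<rho>1" by simp
  from bO_1_tendsto[OF this] have "eventually (\<lambda>x. cmod (w x - 1) < 1/2) F"
    by (intro order_tendstoD(2)[of _ 0] tendsto_norm_zero) auto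
  then have w: "eventually (\<lambda>x. cmod (inverse (w x)) \<le> 2 \<and> w x \<noteq> 0) F"
  proof eventually_elim
    case (elim x)
    have "1 \<le> cmod (w x) + cmod (w x - 1)"
      using norm_triangle_ineq4[of "w x" "w x - 1"] by simp
    then have "cmod (w x) \<ge> 1/2" using elim by simp
    then show ?case using le_imp_inverse_le[of "1/2" "cmod (w x)"] by (auto simp: norm_inverse)
  qed
  then have w_inv: "bO (\<lambda>x. inverse (w x)) (\<lambda>_. 1)"
    by (intro bigoI[of _ 2]) (auto elim: eventually_mono)
  have div_sub: "a / y - v = (a - y * v) * inverse y" if "y \<noteq> 0" for a v y :: complex
    using that by (simp add: field_simps)
  have e2: "bO (\<lambda>x. of_real (e x) * of_real (e x) * (A x * V x)) \<rho>2"
    by (intro bO_mult2[OF bO_11[OF scale_e scale_e]] bO_mult1 AV)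
  have zV: "bO (\<lambda>x. z x + of_real (e x) * V x) (\<lambda>_. 1)"
    by (intro bO_add bd bO_mult2 bO_10[OF scale_e] AV)
  have "bO (\<lambda>x. ((n11 x - (1 + of_real (e x) * (\<i> * of_real (p x)))) * z x + (n12 x - of_real (e x) * cnj (b x))
      - (w x - (1 + of_real (e x) * A x)) * (z x + of_real (e x) * V x)
      - of_real (e x) * of_real (e x) * (A x * V x)) * inverse (w x)) \<rho>2"
    by (intro bO_mult2[OF _ w_inv] bO_diff bO_add bO_mult2[OF _ zV] bO_mult2[OF _ bd(2)] w2 e2 n11 n12)
  then show ?thesis
  proof (rule bO_mono[rotated])
    show "eventually (\<lambda>x. norm ((n11 x * z x + n12 x) / (n21 x * z x + n22 x)
      - (z x + of_real (e x) * (cnj (b x) + 2 * \<i> * of_real (p x) * z x - b x * (z x)\<^sup>2))) \<le>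
      norm (((n11 x - (1 + of_real (e x) * (\<i> * of_real (p x)))) * z x + (n12 x - of_real (e x) * cnj (b x))
      - (w x - (1 + of_real (e x) * A x)) * (z x + of_real (e x) * V x)
      - of_real (e x) * of_real (e x) * (A x * V x)) * inverse (w x))) F"
      using w
    proof eventually_elim
      case (elim x)
      have "((n11 x - (1 + of_real (e x) * (\<i> * of_real (p x)))) * z x + (n12 x - of_real (e x) * cnj (b x))
      - (w x - (1 + of_real (e x) * A x)) * (z x + of_real (e x) * V x)
      - of_real (e x) * of_real (e x) * (A x * V x)) = (n11 x * z x + n12 x) - w x * (z x + of_real (e x) * V x)"
        by (simp add: A_def V_def algebra_simps)
      moreover have "(n11 x * z x + n12 x) / w x - (z x + of_real (e x) * V x)
        = ((n11 x * z x + n12 x) - w x * (z x + of_real (e x) * V x)) * inverse (w x)"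
        by (rule div_sub) (use elim in simp)
      moreover have "z x + of_real (e x) * (cnj (b x) + 2 * \<i> * of_real (p x) * z x - b x * (z x)\<^sup>2)
        = z x + of_real (e x) * V x"
        by (simp add: V_def power2_eq_square)
      ultimately show ?case
        unfolding w_def[symmetric] by (simp only: order_refl)
    qed
  qed
qed

text \<open>Beyond its linear part \<open>X\<close> is of second order, so in the quadratic term of
  the exponential \<open>X ** X\<close> may be replaced by \<open>e^2\<close> times
  \<open>P ** P\<close> up to \<open>\<rho>3\<close>.\<close>

lemma mexp_expansion:
  fixes P P' Q E :: "'x \<Rightarrow> cmat"
  assumes bd: "bO P (\<lambda>_. 1)" "bO P' (\<lambda>_. 1)" "bO Q (\<lambda>_. 1)"
    and E: "bO E \<rho>3"
  defines "X \<equiv> \<lambda>x. of_real (e x) *\<^sub>c P x + of_real ((e x)\<^sup>2) *\<^sub>c P' x + (\<i> * of_real (d x)) *\<^sub>c Q x + E x"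
  shows "bO (\<lambda>x. mexp (X x) $ i $ j - (mat 1 $ i $ j + of_real (e x) * P x $ i $ j
      + of_real ((e x)\<^sup>2) * (P' x $ i $ j + (P x ** P x) $ i $ j / 2)
      + of_real (d x) * (\<i> * Q x $ i $ j))) \<rho>3"
proof -
  have entry: "bO (\<lambda>x. A x $ i $ j) h" if "bO A h" for A :: "'x \<Rightarrow> cmat" and h i j
    by (rule bO_mono[OF _ that]) (auto intro!: always_eventually norm_entry_le)
  have csc: "bO (\<lambda>x. c x *\<^sub>c A x) h" if "bO c h" "bO A (\<lambda>_. 1)" for c and A :: "'x \<Rightarrow> cmat" and h
    using bO_mult2[of "\<lambda>x. cmod (c x)" h "\<lambda>x. norm (A x)"] that by (simp add: norm_csc)
  have "bO (\<lambda>x. \<i> * complex_of_real (d x)) \<rho>2" by (rule bO_mult1[OF bO_const scale_d])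
  then have X2: "bO (\<lambda>x. of_real ((e x)\<^sup>2) *\<^sub>c P' x + (\<i> * of_real (d x)) *\<^sub>c Q x + E x) \<rho>2"
    by (intro bO_add csc scale_e2 bO_32[OF E] bd)
  then have "bO (\<lambda>x. of_real (e x) *\<^sub>c P x + (of_real ((e x)\<^sup>2) *\<^sub>c P' x + (\<i> * of_real (d x)) *\<^sub>c Q x + E x)) \<rho>1"
    by (intro bO_add csc scale_e bO_21[OF X2] bd)
  then have X1: "bO X \<rho>1" by (simp add: X_def add.assoc)
  have XP: "bO (\<lambda>x. X x $ i $ j - of_real (e x) * P x $ i $ j) \<rho>2" for i j
    using entry[OF X2, of i j] by (simp add: X_def add.assoc)
  have eP: "bO (\<lambda>x. of_real (e x) * P x $ i $ j) \<rho>1" for i j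
    by (intro bO_mult2 scale_e entry bd)
  have prod: "bO (\<lambda>x. X x $ i $ k * X x $ k $ j - of_real (e x) * P x $ i $ k * (of_real (e x) * P x $ k $ j)) \<rho>3" for i j k
  proof -
    have "bO (\<lambda>x. X x $ i $ k * (X x $ k $ j - of_real (e x) * P x $ k $ j)
       + (of_real (e x) * P x $ k $ j) * (X x $ i $ k - of_real (e x) * P x $ i $ k)) \<rho>3"
      by (intro bO_add bO_12 XP eP entry X1)
    then show ?thesis by (simp add: algebra_simps)
  qed
  have "eventually (\<lambda>x. norm (X x) < 1) F"
    using bO_1_tendsto[OF X1] by (intro order_tendstoD(2)[of _ 0] tendsto_norm_zero) auto
  then have "bO (\<lambda>x. exp (norm (X x))) (\<lambda>_. 1)"
    by (intro bigoI[of _ "exp 1"]) (auto elim: eventually_mono)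
  moreover have "bO (\<lambda>x. norm (X x)) \<rho>1" using X1 by simp
  ultimately have rem: "bO (\<lambda>x. norm (X x) * (norm (X x) * norm (X x)) * exp (norm (X x))) \<rho>3"
    by (intro bO_mult2 bO_cube)
  have "bO (\<lambda>x. mexp (X x) - (mat 1 + X x + (1/2) *\<^sub>R (X x ** X x))) \<rho>3"
  proof (rule bO_mono[OF _ rem], rule always_eventually, rule allI)
    fix x
    show "norm (mexp (X x) - (mat 1 + X x + (1/2) *\<^sub>R (X x ** X x)))
      \<le> norm (norm (X x) * (norm (X x) * norm (X x)) * exp (norm (X x)))"
      using norm_mexp_remainder_le[of "X x"] by (simp add: power3_eq_cube mult.assoc)
  qed
  moreover have "((1/2) *\<^sub>R Y) $ i $ j = (1/2) * Y $ i $ j" for Y :: cmat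
    by (simp add: scaleR_conv_of_real[of _ "Y $ i $ j"])
  ultimately have 1: "bO (\<lambda>x. mexp (X x) $ i $ j - (mat 1 $ i $ j + X x $ i $ j
      + (1/2) * (X x $ i $ 1 * X x $ 1 $ j + X x $ i $ 2 * X x $ 2 $ j))) \<rho>3"
    using entry[of "\<lambda>x. mexp (X x) - (mat 1 + X x + (1/2) *\<^sub>R (X x ** X x))" \<rho>3 i j]
    by (simp only: vector_add_component vector_minus_component matrix_mult_2_nth)
  have "bO (\<lambda>x. (mexp (X x) $ i $ j - (mat 1 $ i $ j + X x $ i $ j
      + (1/2) * (X x $ i $ 1 * X x $ 1 $ j + X x $ i $ 2 * X x $ 2 $ j)))
      + E x $ i $ j
      + (1/2) * ((X x $ i $ 1 * X x $ 1 $ j - of_real (e x) * P x $ i $ 1 * (of_real (e x) * P x $ 1 $ j))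
          + (X x $ i $ 2 * X x $ 2 $ j - of_real (e x) * P x $ i $ 2 * (of_real (e x) * P x $ 2 $ j)))) \<rho>3"
    by (intro bO_add 1 bO_mult1[OF bO_const] prod entry E)
  moreover have "(mexp (X x) $ i $ j - (mat 1 $ i $ j + X x $ i $ j
      + (1/2) * (X x $ i $ 1 * X x $ 1 $ j + X x $ i $ 2 * X x $ 2 $ j)))
      + E x $ i $ j
      + (1/2) * ((X x $ i $ 1 * X x $ 1 $ j - of_real (e x) * P x $ i $ 1 * (of_real (e x) * P x $ 1 $ j))
          + (X x $ i $ 2 * X x $ 2 $ j - of_real (e x) * P x $ i $ 2 * (of_real (e x) * P x $ 2 $ j)))
      = mexp (X x) $ i $ j - (mat 1 $ i $ j + of_real (e x) * P x $ i $ j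
      + of_real ((e x)\<^sup>2) * (P' x $ i $ j + (P x ** P x) $ i $ j / 2)
      + of_real (d x) * (\<i> * Q x $ i $ j))" for x
  proof -
    have "X x $ i $ j = of_real (e x) * P x $ i $ j + of_real ((e x)\<^sup>2) * P' x $ i $ j
       + \<i> * of_real (d x) * Q x $ i $ j + E x $ i $ j" by (simp add: X_def)
    then show ?thesis by (simp add: matrix_mult_2_nth power2_eq_square field_simps)
  qed
  ultimately show ?thesis by (simp only:)
qed

end

section \<open>Products of random contractions\<close>

lemma cnj_measurable [measurable (raw)]:
  "f \<in> borel_measurable N \<Longrightarrow> (\<lambda>x. cnj (f x)) \<in> borel_measurable N"
  by (erule measurable_compose) (intro borel_measurable_continuous_onI continuous_intros)

lemma borel_measurable_entry [measurable]:
  "(\<lambda>A :: cmat. A $ i $ j) \<in> borel_measurable borel"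
  by (intro borel_measurable_continuous_onI continuous_intros)

lemma borel_measurable_matrix_mult [measurable (raw)]:
  fixes f g :: "'a \<Rightarrow> cmat"
  assumes "f \<in> borel_measurable N" "g \<in> borel_measurable N"
  shows "(\<lambda>x. f x ** g x) \<in> borel_measurable N"
  using assms
proof (rule borel_measurable_continuous_Pair)
  show "continuous_on UNIV (\<lambda>x::cmat \<times> cmat. fst x ** snd x)"
    unfolding matrix_matrix_mult_def
    by (intro continuous_on_vec_lambda continuous_intros)
qed

text \<open>On the closed disc the denominator of a contracting matrix never vanishes, so the
  Moebius action is a plain quotient of complex numbers. The function \<open>disc_factor\<close>
  below is the modulus of its automorphy factor.\<close>

definition disc_map :: "cmat \<Rightarrow> complex \<Rightarrow> complex" where
  "disc_map A z = (A$1$1 * z + A$1$2) / (A$2$1 * z + A$2$2)"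

definition disc_factor :: "cmat \<Rightarrow> complex \<Rightarrow> real" where
  "disc_factor A z = cmod (A$2$1 * z + A$2$2)"

lemma disc_map_measurable [measurable]: "case_prod disc_map \<in> borel_measurable (borel \<Otimes>\<^sub>M borel)"
  unfolding disc_map_def by measurable

lemma disc_factor_measurable [measurable]: "case_prod disc_factor \<in> borel_measurable (borel \<Otimes>\<^sub>M borel)"
  unfolding disc_factor_def by measurable

locale contracting_products = sequence_space M for M :: "'s measure" +
  fixes X :: "'s \<Rightarrow> cmat" and K :: real
  assumes X_measurable [measurable]: "X \<in> borel_measurable M"
    and X_contracting: "s \<in> space M \<Longrightarrow> contracting (X s)"
    and X_bound: "s \<in> space M \<Longrightarrow> norm (X s) \<le> K"
begin

lemma comp_space: "\<omega> \<in> space S \<Longrightarrow> \<omega> n \<in> space M"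
  by (auto simp: space_PiM)

lemma K_ge_1: "1 \<le> K"
proof -
  obtain s where "s \<in> space M" using M.not_empty by blast
  then show ?thesis
    using norm_ge_1_of_det[of "X s"] X_bound[of s] X_contracting[of s] unfolding contracting_def by simp
qed

abbreviation Pr :: "nat \<Rightarrow> (nat \<Rightarrow> 's) \<Rightarrow> cmat" where
  "Pr n \<omega> \<equiv> mprod (\<lambda>i. X (\<omega> i)) n"

lemma Pr_measurable [measurable]: "Pr n \<in> borel_measurable S"
  by (induction n) simp_all

lemma Pr_contracting: "\<omega> \<in> space S \<Longrightarrow> contracting (Pr n \<omega>)"
  by (intro contracting_mprod X_contracting comp_space)

lemma norm_Pr_le: "\<omega> \<in> space S \<Longrightarrow> norm (Pr n \<omega>) \<le> 2 * K ^ n"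
proof (induction n)
  case 0
  show ?case using norm_le_sum_entries[of "mat 1"] by (simp add: mat_def)
next
  case (Suc n)
  have "norm (Pr (Suc n) \<omega>) \<le> norm (X (\<omega> n)) * norm (Pr n \<omega>)" by (simp add: norm_matrix_mult_le)
  also have "\<dots> \<le> K * (2 * K ^ n)"
    using Suc K_ge_1 by (intro mult_mono X_bound comp_space) auto
  finally show ?case by simp
qed

lemma norm_Pr_ge: "\<omega> \<in> space S \<Longrightarrow> 1 \<le> norm (Pr n \<omega>)"
  using Pr_contracting[of \<omega> n] by (intro norm_ge_1_of_det) (simp add: contracting_def)

definition log_norm :: "nat \<Rightarrow> (nat \<Rightarrow> 's) \<Rightarrow> real" where
  "log_norm n \<omega> = ln (norm (Pr n \<omega>))"

text \<open>The factor 2 in \<open>ln (2 * K)\<close> absorbs the norm of the empty product. The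
  shift estimate holds because the first factor can be cancelled on the right by an inverse of the
  same norm.\<close>

sublocale iid_subadditive M log_norm "ln (2 * K)"
proof unfold_locales
  show "log_norm n \<in> borel_measurable S" for n
    unfolding log_norm_def by measurable
next
  fix \<omega> \<omega>' :: "nat \<Rightarrow> 's" and n
  assume "\<And>i. i < n \<Longrightarrow> \<omega> i = \<omega>' i"
  then have "Pr n \<omega> = Pr n \<omega>'" by (intro mprod_cong) simp
  then show "log_norm n \<omega> = log_norm n \<omega>'" by (simp add: log_norm_def)
next
  fix \<omega> n assume \<omega>: "\<omega> \<in> space S"
  show "0 \<le> log_norm n \<omega>" unfolding log_norm_def using norm_Pr_ge[OF \<omega>] by simp
  have "log_norm n \<omega> \<le> ln (2 * K ^ n)"
    unfolding log_norm_def using norm_Pr_ge[OF \<omega>, of n] norm_Pr_le[OF \<omega>, of n] by (intro ln_mono) auto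
  also have "\<dots> \<le> ln ((2 * K) ^ (n + 1))"
  proof (rule ln_mono)
    have "1 \<le> 2 ^ n * K" using mult_mono[of 1 "2 ^ n" 1 K] K_ge_1 by simp
    then have "2 * K ^ n * 1 \<le> 2 * K ^ n * (2 ^ n * K)" using K_ge_1 by (intro mult_left_mono) auto
    then show "2 * K ^ n \<le> (2 * K) ^ (n + 1)" by (simp add: power_mult_distrib mult_ac)
  qed (use K_ge_1 in auto)
  also have "\<dots> = ln (2 * K) * (real n + 1)"
    using K_ge_1 by (subst ln_realpow) auto
  finally show "log_norm n \<omega> \<le> ln (2 * K) * (real n + 1)" .
  have pos: "0 < norm (Pr m \<omega>')" if "\<omega>' \<in> space S" for m \<omega>' using norm_Pr_ge[OF that, of m] by linarith
  show "log_norm (m + n) \<omega> \<le> log_norm m \<omega> + log_norm n (shift_seq m \<omega>)" for m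
  proof -
    have "norm (Pr (m + n) \<omega>) \<le> norm (Pr n (shift_seq m \<omega>)) * norm (Pr m \<omega>)"
      by (simp add: mprod_add shift_seq_def norm_matrix_mult_le)
    then show ?thesis
      unfolding log_norm_def using pos[OF \<omega>] pos[OF shift_seq_space[OF \<omega>]]
      by (subst ln_mult_pos[symmetric]) (auto simp: mult.commute)
  qed
  show "log_norm n (shift_seq 1 \<omega>) \<le> log_norm (Suc n) \<omega> + ln (2 * K)"
  proof -
    have X0: "\<omega> 0 \<in> space M" using \<omega> by (rule comp_space)
    then have "det (X (\<omega> 0)) = 1" using X_contracting by (simp add: contracting_def)
    then obtain B where B: "X (\<omega> 0) ** B = mat 1" "norm B = norm (X (\<omega> 0))"
      by (rule det_1_inverse)
    have "Pr (Suc n) \<omega> = Pr n (shift_seq 1 \<omega>) ** X (\<omega> 0)"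
      using mprod_add[of "\<lambda>i. X (\<omega> i)" 1 n] by (simp add: shift_seq_def)
    then have "Pr (Suc n) \<omega> ** B = Pr n (shift_seq 1 \<omega>)"
      by (simp only: matrix_mul_assoc[symmetric] B matrix_mul_rid)
    then have "norm (Pr n (shift_seq 1 \<omega>)) \<le> norm (Pr (Suc n) \<omega>) * norm B"
      by (metis norm_matrix_mult_le)
    also have "\<dots> \<le> norm (Pr (Suc n) \<omega>) * (2 * K)"
      using B X_bound[OF X0] K_ge_1 by (intro mult_left_mono) auto
    finally show ?thesis
      unfolding log_norm_def using pos[OF \<omega>, of "Suc n"] pos[OF shift_seq_space[OF \<omega>], of 1 n] K_ge_1
      by (subst ln_mult_pos[symmetric]) (auto simp del: mprod.simps)
  qed
qed

text \<open>Two almost sure limits with respect to a probability measure agree, so the description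
  in \<open>lyap\<close> denotes the constant of the subadditive theorem.\<close>

lemma lyap_eq_growth: "lyap M X = growth"
  unfolding lyap_def
proof (rule the_equality)
  show "AE w in S. (\<lambda>N. ln (norm (Pr N w)) / real N) \<longlonglongrightarrow> growth"
    using AE_tendsto_growth by (simp add: log_norm_def)
  fix g assume "AE w in S. (\<lambda>N. ln (norm (Pr N w)) / real N) \<longlonglongrightarrow> g"
  then have "AE w in S. g = growth"
    using AE_tendsto_growth
    by eventually_elim (auto simp: log_norm_def intro: LIMSEQ_unique)
  then show "g = growth" by simp
qed

section \<open>Orbit of the origin in the closed disc\<close>

definition zn :: "nat \<Rightarrow> (nat \<Rightarrow> 's) \<Rightarrow> complex" where
  "zn n \<omega> = Pr n \<omega> $ 1 $ 2 / Pr n \<omega> $ 2 $ 2"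

lemma zn_measurable [measurable]: "zn n \<in> borel_measurable S"
  unfolding zn_def by measurable

lemma zn_cong: "(\<And>i. i < n \<Longrightarrow> \<omega> i = \<omega>' i) \<Longrightarrow> zn n \<omega> = zn n \<omega>'"
  using mprod_cong[of n "\<lambda>i. X (\<omega> i)" "\<lambda>i. X (\<omega>' i)"] by (simp add: zn_def)

lemma Pr22_nonzero: "\<omega> \<in> space S \<Longrightarrow> Pr n \<omega> $ 2 $ 2 \<noteq> 0"
  using contracting_norm_le(1)[OF Pr_contracting, of \<omega> n] by auto

lemma zn_disc: "\<omega> \<in> space S \<Longrightarrow> cmod (zn n \<omega>) \<le> 1"
  using contracting_disc[OF Pr_contracting, of \<omega> 0 1 n] Pr22_nonzero[of \<omega> n]
  by (simp add: zn_def norm_divide)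

lemma zn_0: "zn 0 \<omega> = 0"
  by (simp add: zn_def mat_def)

text \<open>The second column of the product is \<open>(zn n, 1)\<close> scaled by its lower entry.
  One more factor moves the point by the disc action and multiplies the modulus of the scale by the
  cocycle \<open>disc_factor\<close>.\<close>

lemma zn_Suc:
  assumes "\<omega> \<in> space S"
  shows "zn (Suc n) \<omega> = disc_map (X (\<omega> n)) (zn n \<omega>)"
    and "cmod (Pr (Suc n) \<omega> $ 2 $ 2) = disc_factor (X (\<omega> n)) (zn n \<omega>) * cmod (Pr n \<omega> $ 2 $ 2)"
proof -
  let ?y = "Pr n \<omega> $ 2 $ 2" and ?A = "X (\<omega> n)"
  have y: "?y \<noteq> 0" by (rule Pr22_nonzero[OF assms])
  have x: "Pr n \<omega> $ 1 $ 2 = zn n \<omega> * ?y" using y by (simp add: zn_def)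
  have e: "Pr (Suc n) \<omega> $ i $ 2 = (?A $ i $ 1 * zn n \<omega> + ?A $ i $ 2) * ?y" for i
    by (simp add: matrix_mult_2_nth x algebra_simps)
  show "zn (Suc n) \<omega> = disc_map ?A (zn n \<omega>)"
    unfolding zn_def[of "Suc n"] e using y by (simp add: disc_map_def)
  show "cmod (Pr (Suc n) \<omega> $ 2 $ 2) = disc_factor ?A (zn n \<omega>) * cmod ?y"
    unfolding e by (simp add: disc_factor_def norm_mult)
qed

lemma disc_bounds:
  assumes "s \<in> space M" "cmod z \<le> 1"
  shows "1 / (2 * K) \<le> disc_factor (X s) z" "disc_factor (X s) z \<le> 2 * K"
    "cmod (disc_map (X s) z) \<le> 1" "\<bar>ln (disc_factor (X s) z)\<bar> \<le> ln (2 * K)"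
proof -
  define A where "A = X s"
  define x where "x = A$1$1 * z + A$1$2"
  define y where "y = A$2$1 * z + A$2$2"
  have A: "contracting A" "norm A \<le> K" using X_contracting X_bound assms by (auto simp: A_def)
  have ent: "cmod (A $ i $ j) \<le> K" for i j using norm_entry_le[of A i j] A by simp
  have xy: "cmod x \<le> cmod y"
    using contracting_disc[OF A(1), of z 1] assms by (simp add: x_def y_def)
  \<comment> \<open>The determinant keeps the denominator away from 0: as
    \<open>cmod x \<le> cmod y\<close>, a small \<open>y\<close> would make the left-hand side
    small.\<close>
  have "A$1$1 * y - A$2$1 * x = det A" by (simp add: det_2 x_def y_def algebra_simps)
  also have "\<dots> = 1" using A by (simp add: contracting_def)
  finally have "1 = cmod (A$1$1 * y - A$2$1 * x)" by simp
  also have "\<dots> \<le> cmod (A$1$1) * cmod y + cmod (A$2$1) * cmod x"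
    unfolding norm_mult[symmetric] by (rule norm_triangle_ineq4)
  also have "\<dots> \<le> K * cmod y + K * cmod y"
    using ent xy K_ge_1 by (intro add_mono mult_mono) auto
  finally have lo: "1 / (2 * K) \<le> cmod y" using K_ge_1 by (simp add: field_simps)
  then show 1: "1 / (2 * K) \<le> disc_factor (X s) z" by (simp add: disc_factor_def y_def A_def)
  have "cmod y \<le> cmod (A$2$1) * cmod z + cmod (A$2$2)"
    unfolding y_def norm_mult[symmetric] by (rule norm_triangle_ineq)
  also have "\<dots> \<le> K * 1 + K" using ent assms K_ge_1 by (intro add_mono mult_mono) auto
  finally show 2: "disc_factor (X s) z \<le> 2 * K" by (simp add: disc_factor_def y_def A_def)
  have y0: "0 < cmod y" using lo K_ge_1 by (meson less_le_trans divide_pos_pos mult_pos_pos zero_less_numeral zero_less_one)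
  show "cmod (disc_map (X s) z) \<le> 1"
    using xy y0 by (simp add: disc_map_def x_def y_def A_def norm_divide)
  have p: "0 < disc_factor (X s) z" using y0 by (simp add: disc_factor_def y_def A_def)
  have "ln (disc_factor (X s) z) \<le> ln (2 * K)" using p 2 K_ge_1 by simp
  moreover have "ln (1 / (2 * K)) \<le> ln (disc_factor (X s) z)" using 1 p K_ge_1 by simp
  ultimately show "\<bar>ln (disc_factor (X s) z)\<bar> \<le> ln (2 * K)" using K_ge_1 by (simp add: ln_div)
qed

lemma log_norm_approx:
  assumes "\<omega> \<in> space S"
  shows "\<bar>log_norm n \<omega> - ln (cmod (Pr n \<omega> $ 2 $ 2))\<bar> \<le> ln 5"
proof -
  let ?y = "cmod (Pr n \<omega> $ 2 $ 2)"
  have y: "1 \<le> ?y" "norm (Pr n \<omega>) \<le> 5 * ?y"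
    using contracting_norm_le[OF Pr_contracting[OF assms]] by auto
  have "ln ?y \<le> log_norm n \<omega>"
    unfolding log_norm_def using y norm_entry_le[of "Pr n \<omega>" 2 2] by (intro ln_mono) auto
  moreover have "log_norm n \<omega> \<le> ln (5 * ?y)"
    unfolding log_norm_def using y norm_Pr_ge[OF assms, of n] by (intro ln_mono) auto
  moreover have "ln (5 * ?y) = ln 5 + ln ?y" using y by (intro ln_mult_pos) auto
  ultimately show ?thesis by simp
qed

lemma log_entry_eq_sum:
  "\<omega> \<in> space S \<Longrightarrow> ln (cmod (Pr n \<omega> $ 2 $ 2)) = (\<Sum>k<n. ln (disc_factor (X (\<omega> k)) (zn k \<omega>)))"
proof (induction n)
  case 0
  then show ?case by (simp add: mat_def)
next
  case (Suc n)
  have "0 < disc_factor (X (\<omega> n)) (zn n \<omega>)"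
    using disc_bounds(1)[OF comp_space[OF Suc.prems] zn_disc[OF Suc.prems], of n n] K_ge_1
    by (meson less_le_trans divide_pos_pos mult_pos_pos zero_less_numeral zero_less_one)
  moreover have "0 < cmod (Pr n \<omega> $ 2 $ 2)" using Pr22_nonzero[OF Suc.prems, of n] by simp
  ultimately show ?case
    unfolding zn_Suc(2)[OF Suc.prems] using Suc by (simp add: ln_mult_pos)
qed

text \<open>The \<open>n\<close>-th factor is independent of \<open>zn n\<close>, which only involves the factors before it.\<close>

lemma expectation_step_approx:
  fixes g :: "cmat \<Rightarrow> complex \<Rightarrow> 'b::{banach, second_countable_topology}" and h :: "complex \<Rightarrow> 'b"
  assumes g [measurable]: "case_prod g \<in> borel_measurable (borel \<Otimes>\<^sub>M borel)"
    and bd: "\<And>s z. s \<in> space M \<Longrightarrow> cmod z \<le> 1 \<Longrightarrow> norm (g (X s) z) \<le> B"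
    and h [measurable]: "h \<in> borel_measurable borel"
    and approx: "\<And>z. cmod z \<le> 1 \<Longrightarrow> norm ((\<integral>s. g (X s) z \<partial>M) - h z) \<le> R"
  shows "norm ((\<integral>\<omega>. g (X (\<omega> n)) (zn n \<omega>) \<partial>S) - (\<integral>\<omega>. h (zn n \<omega>) \<partial>S)) \<le> R"
proof -
  define q where "q z = (\<integral>s. g (X s) z \<partial>M)" for z
  have q_meas: "(\<lambda>\<omega>. q (zn n \<omega>)) \<in> borel_measurable S"
    unfolding q_def by measurable
  have q_bd: "norm (q z) \<le> B" if "cmod z \<le> 1" for z
  proof -
    have "norm (q z) \<le> (\<integral>s. norm (g (X s) z) \<partial>M)" unfolding q_def by (rule integral_norm_bound)
    also have "\<dots> \<le> (\<integral>s. B \<partial>M)"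
    proof (rule integral_mono)
      show "integrable M (\<lambda>s. norm (g (X s) z))"
        by (rule M.integrable_const_bound[of _ B]) (auto intro!: AE_I2 bd that)
    qed (use bd[OF _ that] in auto)
    finally show ?thesis by (simp add: M.prob_space)
  qed
  have q_int: "integrable S (\<lambda>\<omega>. q (zn n \<omega>))"
    by (rule integrable_bounded[of _ B]) (auto intro: q_bd zn_disc q_meas)
  have h_bd: "norm (h (zn n \<omega>)) \<le> B + R" if "\<omega> \<in> space S" for \<omega>
    using approx[OF zn_disc[OF that], of n] q_bd[OF zn_disc[OF that], of n]
      norm_triangle_ineq2[of "h (zn n \<omega>)" "q (zn n \<omega>)"] norm_minus_commute[of "h (zn n \<omega>)" "q (zn n \<omega>)"]
    unfolding q_def by linarith
  have h_int: "integrable S (\<lambda>\<omega>. h (zn n \<omega>))"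
    by (rule integrable_bounded[of _ "B + R"]) (auto intro: h_bd)
  have "(\<integral>\<omega>. g (X (\<omega> n)) (zn n \<omega>) \<partial>S)
      = (\<integral>\<omega>. (\<integral>\<omega>'. g (X (comb_seq n \<omega> \<omega>' n)) (zn n (comb_seq n \<omega> \<omega>')) \<partial>S) \<partial>S)"
    by (rule integral_split[of _ B]) (auto intro: bd comp_space zn_disc)
  \<comment> \<open>Position \<open>n\<close> is the first entry of the second half, whereas
    \<open>zn n\<close> reads only positions below \<open>n\<close>.\<close>
  also have "\<dots> = (\<integral>\<omega>. (\<integral>\<omega>'. g (X (\<omega>' 0)) (zn n \<omega>) \<partial>S) \<partial>S)"
  proof (intro Bochner_Integration.integral_cong refl)
    fix \<omega> \<omega>'
    have "zn n (comb_seq n \<omega> \<omega>') = zn n \<omega>" by (rule zn_cong) (simp add: comb_seq_less)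
    then show "g (X (comb_seq n \<omega> \<omega>' n)) (zn n (comb_seq n \<omega> \<omega>')) = g (X (\<omega>' 0)) (zn n \<omega>)"
      by (simp add: comb_seq_def)
  qed
  also have "\<dots> = (\<integral>\<omega>. q (zn n \<omega>) \<partial>S)"
    unfolding q_def
  proof (intro Bochner_Integration.integral_cong refl)
    fix \<omega>
    show "(\<integral>\<omega>'. g (X (\<omega>' 0)) (zn n \<omega>) \<partial>S) = (\<integral>s. g (X s) (zn n \<omega>) \<partial>M)"
      by (rule integral_component[of "\<lambda>s. g (X s) (zn n \<omega>)" 0]) measurable
  qed
  finally have "(\<integral>\<omega>. g (X (\<omega> n)) (zn n \<omega>) \<partial>S) - (\<integral>\<omega>. h (zn n \<omega>) \<partial>S) = (\<integral>\<omega>. q (zn n \<omega>) - h (zn n \<omega>) \<partial>S)"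
    using q_int h_int by simp
  also have "norm \<dots> \<le> (\<integral>\<omega>. norm (q (zn n \<omega>) - h (zn n \<omega>)) \<partial>S)" by (rule integral_norm_bound)
  also have "\<dots> \<le> (\<integral>\<omega>. R \<partial>S)"
    using q_int h_int by (intro integral_mono) (auto simp: q_def intro: approx zn_disc)
  finally show ?thesis by (simp add: P.prob_space)
qed

section \<open>Moments of the orbit and their Cesaro means\<close>

lemma zn_integrable: "integrable S (zn n)" "integrable S (\<lambda>\<omega>. (zn n \<omega>)\<^sup>2)"
  by (rule integrable_bounded[of _ 1]; auto intro: zn_disc power_le_one simp: norm_power)+

lemma norm_expectation_zn_le:
  "cmod (\<integral>\<omega>. zn n \<omega> \<partial>S) \<le> 1" "cmod (\<integral>\<omega>. (zn n \<omega>)\<^sup>2 \<partial>S) \<le> 1"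
proof -
  have *: "cmod (\<integral>\<omega>. f \<omega> \<partial>S) \<le> 1" if "integrable S f" "\<And>\<omega>. \<omega> \<in> space S \<Longrightarrow> cmod (f \<omega>) \<le> 1" for f
  proof -
    have "cmod (\<integral>\<omega>. f \<omega> \<partial>S) \<le> (\<integral>\<omega>. cmod (f \<omega>) \<partial>S)" by (rule integral_norm_bound)
    also have "\<dots> \<le> (\<integral>\<omega>. 1 \<partial>S)" using that by (intro integral_mono) auto
    finally show ?thesis by (simp add: P.prob_space)
  qed
  show "cmod (\<integral>\<omega>. zn n \<omega> \<partial>S) \<le> 1" "cmod (\<integral>\<omega>. (zn n \<omega>)\<^sup>2 \<partial>S) \<le> 1"
    by (rule *; use zn_integrable zn_disc in \<open>auto simp: norm_power power_le_one\<close>)+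
qed

text \<open>\<open>m1\<close> and \<open>m2\<close> are limits of Cesaro means of the first two moments of \<open>zn\<close>, that is moments of a
  stationary measure on the closed disc; stationarity shows up as the vanishing of the telescoping boundary terms.\<close>

theorem growth_via_stationary_moments:
  fixes A0 R1 R2 R3 :: real and A1 A2 \<kappa>1 \<kappa>2 C0 C1 C2 :: complex
  assumes log: "\<And>z. cmod z \<le> 1 \<Longrightarrow>
      \<bar>(\<integral>s. ln (disc_factor (X s) z) \<partial>M) - (A0 + Re (A1 * z + A2 * z\<^sup>2))\<bar> \<le> R3"
    and first: "\<And>z. cmod z \<le> 1 \<Longrightarrow>
      cmod ((\<integral>s. disc_map (X s) z \<partial>M) - (\<kappa>1 * z + (C0 + (C1 * z + C2 * z\<^sup>2)))) \<le> R2"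
    and second: "\<And>z. cmod z \<le> 1 \<Longrightarrow> cmod ((\<integral>s. (disc_map (X s) z)\<^sup>2 \<partial>M) - \<kappa>2 * z\<^sup>2) \<le> R1"
  shows "\<exists>m1 m2. cmod m1 \<le> 1 \<and> cmod m2 \<le> 1 \<and>
    \<bar>growth - (A0 + Re (A1 * m1 + A2 * m2))\<bar> \<le> R3 \<and>
    cmod (m1 - (\<kappa>1 * m1 + (C0 + (C1 * m1 + C2 * m2)))) \<le> R2 \<and>
    cmod (m2 - \<kappa>2 * m2) \<le> R1"
proof -
  define u where "u n = (\<integral>\<omega>. zn n \<omega> \<partial>S)" for n
  define v where "v n = (\<integral>\<omega>. (zn n \<omega>)\<^sup>2 \<partial>S)" for n
  define U where "U N = (\<Sum>n<N. u n) / of_nat N" for N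
  define V where "V N = (\<Sum>n<N. v n) / of_nat N" for N
  define L where "L N = (\<integral>\<omega>. log_norm N \<omega> \<partial>S) / real N" for N
  have uv_bd: "cmod (u n) \<le> 1" "cmod (v n) \<le> 1" for n
    using norm_expectation_zn_le by (auto simp: u_def v_def)
  note [simp] = zn_integrable P.prob_space
  have u_step: "cmod (u (Suc n) - (\<kappa>1 * u n + (C0 + (C1 * u n + C2 * v n)))) \<le> R2" for n
  proof -
    have "cmod ((\<integral>\<omega>. disc_map (X (\<omega> n)) (zn n \<omega>) \<partial>S)
        - (\<integral>\<omega>. \<kappa>1 * zn n \<omega> + (C0 + (C1 * zn n \<omega> + C2 * (zn n \<omega>)\<^sup>2)) \<partial>S)) \<le> R2"
      by (rule expectation_step_approx[where B = 1 and h = "\<lambda>z. \<kappa>1 * z + (C0 + (C1 * z + C2 * z\<^sup>2))"])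
        (auto intro: disc_bounds first)
    also have "(\<integral>\<omega>. disc_map (X (\<omega> n)) (zn n \<omega>) \<partial>S) = u (Suc n)"
      unfolding u_def by (intro Bochner_Integration.integral_cong) (auto simp: zn_Suc)
    also have "(\<integral>\<omega>. \<kappa>1 * zn n \<omega> + (C0 + (C1 * zn n \<omega> + C2 * (zn n \<omega>)\<^sup>2)) \<partial>S)
        = \<kappa>1 * u n + (C0 + (C1 * u n + C2 * v n))"
      by (simp add: u_def v_def)
    finally show ?thesis .
  qed
  have v_step: "cmod (v (Suc n) - \<kappa>2 * v n) \<le> R1" for n
  proof -
    have "cmod ((\<integral>\<omega>. (disc_map (X (\<omega> n)) (zn n \<omega>))\<^sup>2 \<partial>S) - (\<integral>\<omega>. \<kappa>2 * (zn n \<omega>)\<^sup>2 \<partial>S)) \<le> R1"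
      by (rule expectation_step_approx[where B = 1 and g = "\<lambda>A z. (disc_map A z)\<^sup>2" and h = "\<lambda>z. \<kappa>2 * z\<^sup>2"])
        (auto intro: disc_bounds second power_le_one simp: norm_power)
    also have "(\<integral>\<omega>. (disc_map (X (\<omega> n)) (zn n \<omega>))\<^sup>2 \<partial>S) = v (Suc n)"
      unfolding v_def by (intro Bochner_Integration.integral_cong) (auto simp: zn_Suc)
    finally show ?thesis by (simp add: v_def)
  qed
  have l_step: "\<bar>(\<integral>\<omega>. ln (disc_factor (X (\<omega> n)) (zn n \<omega>)) \<partial>S) - (A0 + Re (A1 * u n + A2 * v n))\<bar> \<le> R3" for n
  proof -
    have "norm ((\<integral>\<omega>. ln (disc_factor (X (\<omega> n)) (zn n \<omega>)) \<partial>S)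
        - (\<integral>\<omega>. A0 + Re (A1 * zn n \<omega> + A2 * (zn n \<omega>)\<^sup>2) \<partial>S)) \<le> R3"
      by (rule expectation_step_approx[where B = "ln (2 * K)" and g = "\<lambda>A z. ln (disc_factor A z)"
            and h = "\<lambda>z. A0 + Re (A1 * z + A2 * z\<^sup>2)"])
        (auto intro: disc_bounds log[simplified])
    also have "(\<integral>\<omega>. A0 + Re (A1 * zn n \<omega> + A2 * (zn n \<omega>)\<^sup>2) \<partial>S) = A0 + Re (A1 * u n + A2 * v n)"
      by (simp add: u_def v_def del: plus_complex.sel times_complex.sel)
    finally show ?thesis by simp
  qed
  have UV_bd: "cmod (U N) \<le> 1" "cmod (V N) \<le> 1" for N
    using sum_norm_le[of "{..<N}" u "\<lambda>_. 1"] sum_norm_le[of "{..<N}" v "\<lambda>_. 1"] uv_bd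
    by (auto simp: U_def V_def norm_divide divide_le_eq_1)
  have U_eq: "cmod (u N / of_nat N + U N - (\<kappa>1 * U N + (C0 + (C1 * U N + C2 * V N)))) \<le> R2" if "N > 0" for N
  proof -
    \<comment> \<open>Telescoping: \<open>u 0 = 0\<close> because the orbit starts at the origin, so
      the shifted sum exceeds the original one by \<open>u N\<close> exactly.\<close>
    have "(\<Sum>n<N. u (Suc n) - (\<kappa>1 * u n + (C0 + (C1 * u n + C2 * v n))))
      = (u N + (\<Sum>n<N. u n)) - (\<kappa>1 * (\<Sum>n<N. u n) + (of_nat N * C0 + (C1 * (\<Sum>n<N. u n) + C2 * (\<Sum>n<N. v n))))"
      using sum.lessThan_Suc_shift[of u N] zn_0
      by (simp add: sum_subtractf sum.distrib sum_distrib_left u_def add.commute)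
    moreover have "cmod (\<Sum>n<N. u (Suc n) - (\<kappa>1 * u n + (C0 + (C1 * u n + C2 * v n)))) \<le> of_nat N * R2"
      using sum_norm_le[of "{..<N}" _ "\<lambda>_. R2", OF u_step] by simp
    moreover have "u N / of_nat N + U N - (\<kappa>1 * U N + (C0 + (C1 * U N + C2 * V N))) =
      ((u N + (\<Sum>n<N. u n)) - (\<kappa>1 * (\<Sum>n<N. u n) + (of_nat N * C0 + (C1 * (\<Sum>n<N. u n) + C2 * (\<Sum>n<N. v n))))) / of_nat N"
      using that by (simp add: U_def V_def add_divide_distrib diff_divide_distrib)
    ultimately show ?thesis using that by (simp add: norm_divide divide_le_eq mult.commute)
  qed
  have V_eq: "cmod (v N / of_nat N + V N - \<kappa>2 * V N) \<le> R1" if "N > 0" for N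
  proof -
    have "(\<Sum>n<N. v (Suc n) - \<kappa>2 * v n) = (v N + (\<Sum>n<N. v n)) - \<kappa>2 * (\<Sum>n<N. v n)"
      using sum.lessThan_Suc_shift[of v N] zn_0
      by (simp add: sum_subtractf sum_distrib_left v_def add.commute)
    moreover have "cmod (\<Sum>n<N. v (Suc n) - \<kappa>2 * v n) \<le> of_nat N * R1"
      using sum_norm_le[of "{..<N}" _ "\<lambda>_. R1", OF v_step] by simp
    moreover have "v N / of_nat N + V N - \<kappa>2 * V N = ((v N + (\<Sum>n<N. v n)) - \<kappa>2 * (\<Sum>n<N. v n)) / of_nat N"
      using that by (simp add: V_def add_divide_distrib diff_divide_distrib)
    ultimately show ?thesis using that by (simp add: norm_divide divide_le_eq mult.commute)
  qed
  \<comment> \<open>Replacing the logarithm of the norm by the sum along the orbit costs at most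
    \<open>ln 5\<close> in total, independently of \<open>N\<close>.\<close>
  have L_eq: "\<bar>L N - (A0 + Re (A1 * U N + A2 * V N))\<bar> \<le> R3 + ln 5 / real N" if "N > 0" for N
  proof -
    define l where "l n = (\<integral>\<omega>. ln (disc_factor (X (\<omega> n)) (zn n \<omega>)) \<partial>S)" for n
    have l_int: "integrable S (\<lambda>\<omega>. ln (disc_factor (X (\<omega> n)) (zn n \<omega>)))" for n
      by (rule integrable_bounded[of _ "ln (2 * K)"]) (auto intro: disc_bounds comp_space zn_disc)
    have "\<bar>(\<integral>\<omega>. log_norm N \<omega> \<partial>S) - (\<Sum>n<N. l n)\<bar>
        = \<bar>\<integral>\<omega>. log_norm N \<omega> - (\<Sum>n<N. ln (disc_factor (X (\<omega> n)) (zn n \<omega>))) \<partial>S\<bar>"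
      using l_int by (simp add: l_def)
    also have "\<dots> \<le> (\<integral>\<omega>. \<bar>log_norm N \<omega> - (\<Sum>n<N. ln (disc_factor (X (\<omega> n)) (zn n \<omega>)))\<bar> \<partial>S)"
      by (rule integral_abs_bound)
    also have "\<dots> \<le> (\<integral>\<omega>. ln 5 \<partial>S)"
    proof (rule integral_mono)
      fix \<omega> assume "\<omega> \<in> space S"
      then show "\<bar>log_norm N \<omega> - (\<Sum>n<N. ln (disc_factor (X (\<omega> n)) (zn n \<omega>)))\<bar> \<le> ln 5"
        using log_norm_approx[of \<omega> N] log_entry_eq_sum[of \<omega> N] by simp
    qed (use l_int in auto)
    finally have 1: "\<bar>(\<integral>\<omega>. log_norm N \<omega> \<partial>S) - (\<Sum>n<N. l n)\<bar> \<le> ln 5" by simp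
    have "(\<Sum>n<N. l n - (A0 + Re (A1 * u n + A2 * v n)))
      = (\<Sum>n<N. l n) - (real N * A0 + Re (A1 * (\<Sum>n<N. u n) + A2 * (\<Sum>n<N. v n)))"
      unfolding sum_subtractf sum.distrib Re_sum[symmetric] sum_distrib_left by simp
    moreover have "\<bar>\<Sum>n<N. l n - (A0 + Re (A1 * u n + A2 * v n))\<bar> \<le> real N * R3"
      using sum_norm_le[of "{..<N}" "\<lambda>n. l n - (A0 + Re (A1 * u n + A2 * v n))" "\<lambda>_. R3"] l_step
      by (simp add: l_def del: plus_complex.sel times_complex.sel)
    ultimately have 2: "\<bar>(\<Sum>n<N. l n) - (real N * A0 + Re (A1 * (\<Sum>n<N. u n) + A2 * (\<Sum>n<N. v n)))\<bar> \<le> real N * R3"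
      by (simp only:)
    have "Re (A1 * U N + A2 * V N) = Re (A1 * (\<Sum>n<N. u n) + A2 * (\<Sum>n<N. v n)) / real N"
      by (simp add: U_def V_def add_divide_distrib diff_divide_distrib Re_divide_of_nat)
    then have E1: "L N - (A0 + Re (A1 * U N + A2 * V N)) = ((\<integral>\<omega>. log_norm N \<omega> \<partial>S)
        - (real N * A0 + Re (A1 * (\<Sum>n<N. u n) + A2 * (\<Sum>n<N. v n)))) / real N"
      using that by (simp add: L_def field_simps del: plus_complex.sel times_complex.sel)
    have E2: "\<bar>(\<integral>\<omega>. log_norm N \<omega> \<partial>S)
        - (real N * A0 + Re (A1 * (\<Sum>n<N. u n) + A2 * (\<Sum>n<N. v n)))\<bar> \<le> real N * R3 + ln 5"
      using 1 2 by linarith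
    have E3: "(real N * R3 + ln 5) / real N = R3 + ln 5 / real N"
      using that by (simp add: field_simps)
    have "\<bar>x / real N\<bar> \<le> y / real N" if "\<bar>x\<bar> \<le> y" for x y
      using that by (simp add: abs_divide divide_right_mono)
    then show ?thesis
      unfolding E1 E3[symmetric] using E2 by blast
  qed
  \<comment> \<open>The Cesaro means need not converge. A common subsequence suffices: the
    normalised expectations of \<open>log_norm\<close> converge along every subsequence, and the
    three relations are closed conditions.\<close>
  have "compact (cball 0 1 \<times> cball 0 1 :: (complex \<times> complex) set)" by (intro compact_Times compact_cball)
  then obtain p \<sigma> where p: "p \<in> cball 0 1 \<times> cball 0 1" and \<sigma>: "strict_mono \<sigma>"
    and lim: "((\<lambda>N. (U N, V N)) \<circ> \<sigma>) \<longlonglongrightarrow> p"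
    using UV_bd unfolding compact_def by (elim allE[of _ "\<lambda>N. (U N, V N)"]) auto
  obtain m1 m2 where m: "p = (m1, m2)" by (cases p)
  have limU: "(\<lambda>k. U (\<sigma> k)) \<longlonglongrightarrow> m1" and limV: "(\<lambda>k. V (\<sigma> k)) \<longlonglongrightarrow> m2"
    using tendsto_fst[OF lim] tendsto_snd[OF lim] by (simp_all add: m o_def)
  have \<sigma>_top: "filterlim \<sigma> at_top sequentially" by (rule filterlim_subseq[OF \<sigma>])
  have limL: "(\<lambda>k. L (\<sigma> k)) \<longlonglongrightarrow> growth"
    unfolding L_def by (rule filterlim_compose[OF expectation_tendsto_growth \<sigma>_top])
  have small_lim: "(\<lambda>k. f (\<sigma> k) / of_nat (\<sigma> k)) \<longlonglongrightarrow> 0" if "\<And>n. cmod (f n) \<le> 1" for f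
  proof -
    have "(\<lambda>n. f n / of_nat n) \<longlonglongrightarrow> 0"
      by (rule Lim_null_comparison[of _ "\<lambda>n. 1 / real n"])
        (auto simp: norm_divide that lim_1_over_n intro!: always_eventually divide_right_mono)
    then show ?thesis by (rule filterlim_compose[OF _ \<sigma>_top])
  qed
  have pos: "eventually (\<lambda>k. \<sigma> k > 0) sequentially"
    using \<sigma>_top eventually_gt_at_top[of 0] by (auto simp: filterlim_iff)
  have "(\<lambda>k. ln 5 / real (\<sigma> k)) \<longlonglongrightarrow> 0"
    by (rule filterlim_compose[OF _ \<sigma>_top]) real_asymp
  then have "(\<lambda>k. R3 + ln 5 / real (\<sigma> k)) \<longlonglongrightarrow> R3 + 0"
    by (intro tendsto_add tendsto_const)
  moreover have "(\<lambda>k. \<bar>L (\<sigma> k) - (A0 + Re (A1 * U (\<sigma> k) + A2 * V (\<sigma> k)))\<bar>) \<longlonglongrightarrow> \<bar>growth - (A0 + Re (A1 * m1 + A2 * m2))\<bar>"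
    by (intro tendsto_intros limL limU limV)
  moreover have "eventually (\<lambda>k. \<bar>L (\<sigma> k) - (A0 + Re (A1 * U (\<sigma> k) + A2 * V (\<sigma> k)))\<bar> \<le> R3 + ln 5 / real (\<sigma> k)) sequentially"
    using pos by eventually_elim (rule L_eq)
  ultimately have 1: "\<bar>growth - (A0 + Re (A1 * m1 + A2 * m2))\<bar> \<le> R3 + 0"
    by (rule tendsto_le[OF sequentially_bot])
  have "(\<lambda>k. cmod (u (\<sigma> k) / of_nat (\<sigma> k) + U (\<sigma> k) - (\<kappa>1 * U (\<sigma> k) + (C0 + (C1 * U (\<sigma> k) + C2 * V (\<sigma> k))))))
      \<longlonglongrightarrow> cmod (0 + m1 - (\<kappa>1 * m1 + (C0 + (C1 * m1 + C2 * m2))))"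
    by (intro tendsto_intros small_lim uv_bd limU limV)
  then have 2: "cmod (0 + m1 - (\<kappa>1 * m1 + (C0 + (C1 * m1 + C2 * m2)))) \<le> R2"
    by (rule tendsto_upperbound) (use pos in \<open>eventually_elim, simp add: U_eq\<close>, simp)
  have "(\<lambda>k. cmod (v (\<sigma> k) / of_nat (\<sigma> k) + V (\<sigma> k) - \<kappa>2 * V (\<sigma> k))) \<longlonglongrightarrow> cmod (0 + m2 - \<kappa>2 * m2)"
    by (intro tendsto_intros small_lim uv_bd limV)
  then have 3: "cmod (0 + m2 - \<kappa>2 * m2) \<le> R1"
    by (rule tendsto_upperbound) (use pos in \<open>eventually_elim, simp add: V_eq\<close>, simp)
  show ?thesis
    using 1 2 3 p by (intro exI[of _ m1] exI[of _ m2]) (simp add: m)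
qed

end

section \<open>Random perturbations of rotations\<close>

text \<open>The parameters tend to \<open>(0, 0)\<close> with \<open>d\<close> nonnegative, while
  the third component ranges freely over \<open>A\<close>; a Landau bound along this filter is
  therefore uniform in \<open>A\<close>.\<close>

definition param_filter :: "'a set \<Rightarrow> (real \<times> real \<times> 'a) filter" where
  "param_filter A = (INF \<epsilon>\<in>{0<..}. principal {(e, d, a). \<bar>e\<bar> < \<epsilon> \<and> 0 \<le> d \<and> d < \<epsilon> \<and> a \<in> A})"

lemma eventually_param_filter:
  "eventually R (param_filter A) \<longleftrightarrow>
    (\<exists>\<epsilon>>0. \<forall>e d a. \<bar>e\<bar> < \<epsilon> \<longrightarrow> 0 \<le> d \<longrightarrow> d < \<epsilon> \<longrightarrow> a \<in> A \<longrightarrow> R (e, d, a))"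
proof -
  have "eventually R (param_filter A) \<longleftrightarrow>
    (\<exists>\<epsilon>\<in>{0<..}. eventually R (principal {(e, d, a). \<bar>e\<bar> < \<epsilon> \<and> 0 \<le> d \<and> d < \<epsilon> \<and> a \<in> A}))"
    unfolding param_filter_def
  proof (rule eventually_INF_base)
    fix x y :: real assume "x \<in> {0<..}" "y \<in> {0<..}"
    then show "\<exists>z\<in>{0<..}. principal {(e, d, a). \<bar>e\<bar> < z \<and> 0 \<le> d \<and> d < z \<and> a \<in> A}
        \<le> principal {(e, d, a). \<bar>e\<bar> < x \<and> 0 \<le> d \<and> d < x \<and> a \<in> A} \<sqinter>
          principal {(e, d, a). \<bar>e\<bar> < y \<and> 0 \<le> d \<and> d < y \<and> a \<in> A}"
      by (intro bexI[of _ "min x y"]) auto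
  qed auto
  moreover have "eventually R (principal {(e, d, a). \<bar>e\<bar> < \<epsilon> \<and> 0 \<le> d \<and> d < \<epsilon> \<and> a \<in> A}) \<longleftrightarrow>
      (\<forall>e d a. \<bar>e\<bar> < \<epsilon> \<longrightarrow> 0 \<le> d \<longrightarrow> d < \<epsilon> \<longrightarrow> a \<in> A \<longrightarrow> R (e, d, a))" for \<epsilon>
    by (auto simp: eventually_principal)
  ultimately show ?thesis by (simp only: Bex_def greaterThan_iff)
qed

lemma small_parameters_param_filter: "small_parameters (param_filter A) fst (\<lambda>x. fst (snd x))"
proof
  show "(fst \<longlongrightarrow> 0) (param_filter A)"
    unfolding tendsto_iff eventually_param_filter
  proof (intro allI impI)
    fix \<epsilon> :: real assume "0 < \<epsilon>"
    show "\<exists>\<epsilon>'>0. \<forall>(e::real) (d::real) a. \<bar>e\<bar> < \<epsilon>' \<longrightarrow> 0 \<le> d \<longrightarrow> d < \<epsilon>' \<longrightarrow> a \<in> A \<longrightarrow> dist (fst (e, d, a)) 0 < \<epsilon>"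
      by (intro exI[of _ \<epsilon>]) (use \<open>0 < \<epsilon>\<close> in auto)
  qed
  show "((\<lambda>x. fst (snd x)) \<longlongrightarrow> 0) (param_filter A)"
    unfolding tendsto_iff eventually_param_filter
  proof (intro allI impI)
    fix \<epsilon> :: real assume "0 < \<epsilon>"
    show "\<exists>\<epsilon>'>0. \<forall>(e::real) (d::real) a. \<bar>e\<bar> < \<epsilon>' \<longrightarrow> 0 \<le> d \<longrightarrow> d < \<epsilon>' \<longrightarrow> a \<in> A \<longrightarrow> dist (fst (snd (e, d, a))) 0 < \<epsilon>"
      by (intro exI[of _ \<epsilon>]) (use \<open>0 < \<epsilon>\<close> in auto)
  qed
  show "eventually (\<lambda>x. 0 \<le> fst (snd x)) (param_filter A)"
    unfolding eventually_param_filter by (intro exI[of _ 1]) simp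
qed

lemma bigo_param_filterE:
  fixes f g :: "real \<times> real \<times> 'a \<Rightarrow> real"
  assumes "f \<in> O[param_filter A](g)"
  obtains K \<epsilon> where "\<epsilon> > 0" "K > 0"
    "\<And>e d a. \<bar>e\<bar> < \<epsilon> \<Longrightarrow> 0 \<le> d \<Longrightarrow> d < \<epsilon> \<Longrightarrow> a \<in> A \<Longrightarrow> \<bar>f (e, d, a)\<bar> \<le> K * \<bar>g (e, d, a)\<bar>"
proof -
  from assms obtain K where "K > 0" "eventually (\<lambda>x. norm (f x) \<le> K * norm (g x)) (param_filter A)"
    by (rule landau_o.bigE)
  moreover from this(2) obtain \<epsilon> where "\<epsilon> > 0"
    "\<forall>e d a. \<bar>e\<bar> < \<epsilon> \<longrightarrow> 0 \<le> d \<longrightarrow> d < \<epsilon> \<longrightarrow> a \<in> A \<longrightarrow> norm (f (e, d, a)) \<le> K * norm (g (e, d, a))"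
    unfolding eventually_param_filter by blast
  ultimately show ?thesis using that[of \<epsilon> K] by simp
qed

lemma (in prob_space) norm_integral_diff_le:
  fixes f g :: "'a \<Rightarrow> 'b::{banach, second_countable_topology}"
  assumes [measurable]: "f \<in> borel_measurable M" and g: "integrable M g"
    and le: "\<And>s. s \<in> space M \<Longrightarrow> norm (f s - g s) \<le> R"
  shows "norm ((\<integral>s. f s \<partial>M) - (\<integral>s. g s \<partial>M)) \<le> R"
proof -
  have [measurable]: "g \<in> borel_measurable M" using g by auto
  have d: "integrable M (\<lambda>s. f s - g s)"
    by (rule integrable_const_bound[of _ R]) (auto intro!: AE_I2 le)
  from Bochner_Integration.integrable_add[OF d g] have f: "integrable M f" by simp
  have "(\<integral>s. f s \<partial>M) - (\<integral>s. g s \<partial>M) = (\<integral>s. f s - g s \<partial>M)"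
    using f g by simp
  also have "norm \<dots> \<le> (\<integral>s. norm (f s - g s) \<partial>M)" by (rule integral_norm_bound)
  also have "\<dots> \<le> (\<integral>s. R \<partial>M)" using d le by (intro integral_mono) auto
  finally show ?thesis by (simp add: prob_space)
qed

section \<open>The random family and its coefficients\<close>

locale perturbed_rotations = prob_space M for M :: "'s measure" +
  fixes T :: "real \<Rightarrow> complex \<Rightarrow> 's \<Rightarrow> cmat"
    and \<eta> :: "'s \<Rightarrow> real"
    and P P' Q :: "'s \<Rightarrow> cmat"
    and p1 p2 p3 q1 q2 q3 :: "'s \<Rightarrow> real"
    and r :: real
  assumes r_pos: "r > 0"
    and T_measurable [measurable]: "T e d \<in> borel_measurable M"
    and \<eta>_measurable [measurable]: "\<eta> \<in> borel_measurable M"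
    and coord_measurable [measurable]:
      "p1 \<in> borel_measurable M" "p2 \<in> borel_measurable M" "p3 \<in> borel_measurable M"
      "q1 \<in> borel_measurable M" "q2 \<in> borel_measurable M" "q3 \<in> borel_measurable M"
    and P'_measurable [measurable]: "P' \<in> borel_measurable M"
    and T_SU11_le: "s \<in> space M \<Longrightarrow> \<bar>e\<bar> < r \<Longrightarrow> 0 \<le> d \<Longrightarrow> d < r \<Longrightarrow> T e (of_real d) s \<in> SU11_le"
    and P'_su11: "s \<in> space M \<Longrightarrow> P' s \<in> su11"
    and P_coord: "s \<in> space M \<Longrightarrow>
                  P s = of_real (p1 s) *\<^sub>c B1 + of_real (p2 s) *\<^sub>c B2 + of_real (p3 s) *\<^sub>c B3"
    and Q_coord: "s \<in> space M \<Longrightarrow>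
                  Q s = of_real (q1 s) *\<^sub>c B1 + of_real (q2 s) *\<^sub>c B2 + of_real (q3 s) *\<^sub>c B3"
    and PQ_bounded: "\<exists>K. \<forall>s\<in>space M. norm (P s) \<le> K \<and> norm (P' s) \<le> K \<and> norm (Q s) \<le> K"
    and T_expansion: "\<exists>C. \<forall>e d s. s \<in> space M \<longrightarrow> \<bar>e\<bar> < r \<longrightarrow> 0 \<le> d \<longrightarrow> d < r \<longrightarrow>
                  (\<exists>E. T e (of_real d) s
                        = Rrot (\<eta> s) ** mexp (of_real e *\<^sub>c P s + of_real (e^2) *\<^sub>c P' s
                                               + (\<i> * of_real d) *\<^sub>c Q s + E)
                      \<and> norm E \<le> C * (\<bar>e\<bar>^3 + \<bar>e\<bar> * d + d^2))"
    and nonresonant: "(\<integral>s. exp (2 * \<i> * of_real (\<eta> s)) \<partial>M) \<noteq> 1"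
      "(\<integral>s. exp (4 * \<i> * of_real (\<eta> s)) \<partial>M) \<noteq> 1"
begin

text \<open>\<open>\<beta>\<close>, \<open>\<beta>'\<close> and \<open>\<beta>q\<close> are the
  lower left entries of \<open>P\<close>, \<open>P'\<close> and \<open>Q\<close>; \<open>ph\<close>
  is the multiplier by which \<open>Rrot\<close> acts on the disc.\<close>

definition \<beta> :: "'s \<Rightarrow> complex" where "\<beta> s = of_real (p1 s) - \<i> * of_real (p2 s)"
definition \<beta>' :: "'s \<Rightarrow> complex" where "\<beta>' s = P' s $ 2 $ 1"
definition \<beta>q :: "'s \<Rightarrow> complex" where "\<beta>q s = of_real (q1 s) - \<i> * of_real (q2 s)"
definition ph :: "'s \<Rightarrow> complex" where "ph s = exp (2 * \<i> * of_real (\<eta> s))"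

lemma \<beta>_measurable [measurable]:
  "\<beta> \<in> borel_measurable M" "\<beta>' \<in> borel_measurable M" "\<beta>q \<in> borel_measurable M" "ph \<in> borel_measurable M"
  unfolding \<beta>_def \<beta>'_def \<beta>q_def ph_def by measurable

lemma P_entries:
  assumes "s \<in> space M"
  shows "P s $ 1 $ 1 = \<i> * of_real (p3 s)" "P s $ 1 $ 2 = cnj (\<beta> s)"
    "P s $ 2 $ 1 = \<beta> s" "P s $ 2 $ 2 = - (\<i> * of_real (p3 s))"
  using P_coord[OF assms] by (auto simp: \<beta>_def B1_def B2_def B3_def)

lemma Q_entries:
  assumes "s \<in> space M"
  shows "Q s $ 1 $ 1 = \<i> * of_real (q3 s)" "Q s $ 2 $ 1 = \<beta>q s" "Q s $ 2 $ 2 = - (\<i> * of_real (q3 s))"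
  using Q_coord[OF assms] by (auto simp: \<beta>q_def B1_def B2_def B3_def)

text \<open>Diagonal entries of elements of \<open>su11\<close> are imaginary. The double sign puts
  the entry into the shape of the parameter \<open>y\<close> in \<open>log_expansion\<close>, whose
  contribution has zero real part.\<close>

lemma P'_22:
  assumes "s \<in> space M"
  shows "P' s $ 2 $ 2 = - (\<i> * of_real (- Im (P' s $ 2 $ 2)))"
proof -
  have "(adj (P' s) ** Jmat) $ 2 $ 2 = (- (Jmat ** P' s)) $ 2 $ 2"
    using P'_su11[OF assms] by (simp add: su11_def)
  then have "cnj (P' s $ 2 $ 2) = - P' s $ 2 $ 2"
    by (simp add: matrix_mult_2_nth adj_def Jmat_def) (metis minus_minus)
  then have "Re (P' s $ 2 $ 2) = 0" by (simp add: complex_eq_iff)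
  then show ?thesis by (simp add: complex_eq_iff)
qed

lemma coord_bounds:
  obtains K where "K \<ge> 0" "\<And>s. s \<in> space M \<Longrightarrow> norm (P s) \<le> K" "\<And>s. s \<in> space M \<Longrightarrow> norm (P' s) \<le> K"
    "\<And>s. s \<in> space M \<Longrightarrow> norm (Q s) \<le> K" "\<And>s. s \<in> space M \<Longrightarrow> cmod (\<beta> s) \<le> K"
    "\<And>s. s \<in> space M \<Longrightarrow> cmod (\<beta>' s) \<le> K" "\<And>s. s \<in> space M \<Longrightarrow> cmod (\<beta>q s) \<le> K"
    "\<And>s. s \<in> space M \<Longrightarrow> \<bar>p3 s\<bar> \<le> K" "\<And>s. s \<in> space M \<Longrightarrow> \<bar>q3 s\<bar> \<le> K"
    "\<And>s. s \<in> space M \<Longrightarrow> \<bar>Im (P' s $ 2 $ 2)\<bar> \<le> K"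
proof -
  obtain K where K: "\<And>s. s \<in> space M \<Longrightarrow> norm (P s) \<le> K \<and> norm (P' s) \<le> K \<and> norm (Q s) \<le> K"
    using PQ_bounded by blast
  have e: "cmod (A $ i $ j) \<le> K" if "norm A \<le> K" for A :: cmat and i j
    using norm_entry_le[of A i j] that by simp
  show ?thesis
  proof (rule that[of K])
    show "0 \<le> K" using K not_empty by (meson all_not_in_conv norm_ge_zero order_trans)
    fix s assume s: "s \<in> space M"
    show "norm (P s) \<le> K" "norm (P' s) \<le> K" "norm (Q s) \<le> K" using K[OF s] by auto
    show "cmod (\<beta> s) \<le> K" using e[of "P s" 2 1] K[OF s] P_entries[OF s] by simp
    show "cmod (\<beta>' s) \<le> K" using e[of "P' s" 2 1] K[OF s] by (simp add: \<beta>'_def)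
    show "cmod (\<beta>q s) \<le> K" using e[of "Q s" 2 1] K[OF s] Q_entries[OF s] by simp
    show "\<bar>p3 s\<bar> \<le> K" using e[of "P s" 1 1] K[OF s] P_entries[OF s] by (simp add: norm_mult)
    show "\<bar>q3 s\<bar> \<le> K" using e[of "Q s" 1 1] K[OF s] Q_entries[OF s] by (simp add: norm_mult)
    show "\<bar>Im (P' s $ 2 $ 2)\<bar> \<le> K"
      using e[of "P' s" 2 2] K[OF s] abs_Im_le_cmod[of "P' s $ 2 $ 2"] by simp
  qed
qed

lemma norm_ph [simp]: "cmod (ph s) = 1"
  by (simp add: ph_def norm_exp_eq_Re)

section \<open>Expansions uniform in the sample and the disc point\<close>

definition log_main :: "real \<Rightarrow> real \<Rightarrow> 's \<Rightarrow> complex \<Rightarrow> real" where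
  "log_main e d s z = d * q3 s + e\<^sup>2 * (cmod (\<beta> s))\<^sup>2 / 2
      + Re (z * (of_real e * \<beta> s + of_real (e\<^sup>2) * (\<beta>' s + \<i> * (of_real (p3 s) * \<beta> s))
            + of_real d * (\<i> * \<beta>q s)))
      - e\<^sup>2 / 2 * Re (z\<^sup>2 * (\<beta> s)\<^sup>2)"

definition map_main :: "real \<Rightarrow> 's \<Rightarrow> complex \<Rightarrow> complex" where
  "map_main e s z = ph s * (z + of_real e * (cnj (\<beta> s) + 2 * \<i> * of_real (p3 s) * z - \<beta> s * z\<^sup>2))"

text \<open>The points of the filter carry the sample and the disc point, so Landau estimates are
  automatically uniform in both, as integration over the samples requires. The nonzero entries of
  the rotation have modulus one: it drops out of the logarithm and acts on the disc as the factor
  \<open>ph\<close>.\<close>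

lemma uniform_expansions:
  obtains K \<epsilon> where "0 < \<epsilon>" "\<epsilon> \<le> r" "0 < K"
    "\<And>e d s z. \<bar>e\<bar> < \<epsilon> \<Longrightarrow> 0 \<le> d \<Longrightarrow> d < \<epsilon> \<Longrightarrow> s \<in> space M \<Longrightarrow> cmod z \<le> 1 \<Longrightarrow>
      \<bar>ln (disc_factor (T e (of_real d) s) z) - log_main e d s z\<bar> \<le> K * (\<bar>e\<bar>^3 + \<bar>e\<bar> * d + d\<^sup>2)"
    "\<And>e d s z. \<bar>e\<bar> < \<epsilon> \<Longrightarrow> 0 \<le> d \<Longrightarrow> d < \<epsilon> \<Longrightarrow> s \<in> space M \<Longrightarrow> cmod z \<le> 1 \<Longrightarrow>
      cmod (disc_map (T e (of_real d) s) z - map_main e s z) \<le> K * (e\<^sup>2 + d)"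
    "\<And>e d s z. \<bar>e\<bar> < \<epsilon> \<Longrightarrow> 0 \<le> d \<Longrightarrow> d < \<epsilon> \<Longrightarrow> s \<in> space M \<Longrightarrow> cmod z \<le> 1 \<Longrightarrow>
      cmod ((disc_map (T e (of_real d) s) z)\<^sup>2 - (ph s)\<^sup>2 * z\<^sup>2) \<le> K * (\<bar>e\<bar> + d)"
    "\<And>e d s. \<bar>e\<bar> < \<epsilon> \<Longrightarrow> 0 \<le> d \<Longrightarrow> d < \<epsilon> \<Longrightarrow> s \<in> space M \<Longrightarrow> norm (T e (of_real d) s) \<le> K"
proof -
  obtain C where C: "\<And>e d s. s \<in> space M \<Longrightarrow> \<bar>e\<bar> < r \<Longrightarrow> 0 \<le> d \<Longrightarrow> d < r \<Longrightarrow>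
     \<exists>E. T e (of_real d) s = Rrot (\<eta> s) ** mexp (of_real e *\<^sub>c P s + of_real (e^2) *\<^sub>c P' s
                                               + (\<i> * of_real d) *\<^sub>c Q s + E)
                      \<and> norm E \<le> C * (\<bar>e\<bar>^3 + \<bar>e\<bar> * d + d^2)"
    using T_expansion by meson
  define A where "A = space M \<times> (cball 0 1 :: complex set)"
  define ep :: "real \<times> real \<times> 's \<times> complex \<Rightarrow> real" where "ep = fst"
  define dp :: "real \<times> real \<times> 's \<times> complex \<Rightarrow> real" where "dp = (\<lambda>x. fst (snd x))"
  define sp :: "real \<times> real \<times> 's \<times> complex \<Rightarrow> 's" where "sp = (\<lambda>x. fst (snd (snd x)))"
  define z :: "real \<times> real \<times> 's \<times> complex \<Rightarrow> complex" where "z = (\<lambda>x. snd (snd (snd x)))"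
  define F where "F = param_filter A"
  interpret small_parameters F ep dp
    unfolding F_def ep_def dp_def by (rule small_parameters_param_filter)
  have dom: "eventually (\<lambda>x. sp x \<in> space M \<and> cmod (z x) \<le> 1 \<and> \<bar>ep x\<bar> < r \<and> 0 \<le> dp x \<and> dp x < r) F"
    unfolding F_def eventually_param_filter ep_def dp_def sp_def z_def A_def
    by (intro exI[of _ r]) (use r_pos in auto)
  \<comment> \<open>An error matrix is given for each argument separately; choice turns it into a
    function, of which only the size matters.\<close>
  define E where "E x = (SOME E. T (ep x) (of_real (dp x)) (sp x) = Rrot (\<eta> (sp x)) **
      mexp (of_real (ep x) *\<^sub>c P (sp x) + of_real ((ep x)^2) *\<^sub>c P' (sp x) + (\<i> * of_real (dp x)) *\<^sub>c Q (sp x) + E)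
      \<and> norm E \<le> C * (\<bar>ep x\<bar>^3 + \<bar>ep x\<bar> * dp x + (dp x)^2))" for x
  define N where "N x = mexp (of_real (ep x) *\<^sub>c P (sp x) + of_real ((ep x)^2) *\<^sub>c P' (sp x)
      + (\<i> * of_real (dp x)) *\<^sub>c Q (sp x) + E x)" for x
  define Tx where "Tx x = T (ep x) (of_real (dp x)) (sp x)" for x
  have TE: "eventually (\<lambda>x. Tx x = Rrot (\<eta> (sp x)) ** N x \<and> norm (E x) \<le> C * \<rho>3 x) F"
    using dom
  proof eventually_elim
    case (elim x)
    show ?case unfolding Tx_def N_def \<rho>3_def
      using elim someI_ex[OF C[of "sp x" "ep x" "dp x"]] unfolding E_def[of x] by blast
  qed
  have E3: "bO E \<rho>3"
  proof (rule bigoI[of _ "\<bar>C\<bar>"], use TE in eventually_elim)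
    case (elim x)
    have "C * \<rho>3 x \<le> \<bar>C\<bar> * \<bar>\<rho>3 x\<bar>" by (simp add: abs_mult[symmetric])
    then show ?case using elim by simp
  qed
  obtain K where K: "K \<ge> 0" "\<And>s. s \<in> space M \<Longrightarrow> norm (P s) \<le> K" "\<And>s. s \<in> space M \<Longrightarrow> norm (P' s) \<le> K"
    "\<And>s. s \<in> space M \<Longrightarrow> norm (Q s) \<le> K" "\<And>s. s \<in> space M \<Longrightarrow> cmod (\<beta> s) \<le> K"
    "\<And>s. s \<in> space M \<Longrightarrow> cmod (\<beta>' s) \<le> K" "\<And>s. s \<in> space M \<Longrightarrow> cmod (\<beta>q s) \<le> K"
    "\<And>s. s \<in> space M \<Longrightarrow> \<bar>p3 s\<bar> \<le> K" "\<And>s. s \<in> space M \<Longrightarrow> \<bar>q3 s\<bar> \<le> K"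
    "\<And>s. s \<in> space M \<Longrightarrow> \<bar>Im (P' s $ 2 $ 2)\<bar> \<le> K"
    by (rule coord_bounds) blast
  have bounded: "bO (\<lambda>x. f (sp x)) (\<lambda>_. 1)" if "\<And>s. s \<in> space M \<Longrightarrow> norm (f s) \<le> B"
    for f :: "'s \<Rightarrow> 'c::real_normed_vector" and B
    by (rule bigoI[of _ B], use dom in eventually_elim) (use that in auto)
  have z1: "bO z (\<lambda>_. 1)"
    by (rule bigoI[of _ 1], use dom in eventually_elim) auto
  note bds = bounded[OF K(2)] bounded[OF K(3)] bounded[OF K(4)]
  have b: "bO (\<lambda>x. \<beta> (sp x)) (\<lambda>_. 1)" "bO (\<lambda>x. \<beta>' (sp x)) (\<lambda>_. 1)" "bO (\<lambda>x. \<beta>q (sp x)) (\<lambda>_. 1)"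
      "bO (\<lambda>x. p3 (sp x)) (\<lambda>_. 1)" "bO (\<lambda>x. q3 (sp x)) (\<lambda>_. 1)" "bO (\<lambda>x. - Im (P' (sp x) $ 2 $ 2)) (\<lambda>_. 1)"
    using bounded[of \<beta>, OF K(5)] bounded[of \<beta>', OF K(6)] bounded[of \<beta>q, OF K(7)] bounded[of p3 K] K(8)
      bounded[of q3 K] K(9) bounded[of "\<lambda>s. Im (P' s $ 2 $ 2)" K] K(10) by auto
  have N_exp: "bO (\<lambda>x. N x $ i $ j - (mat 1 $ i $ j + of_real (ep x) * P (sp x) $ i $ j
      + of_real ((ep x)\<^sup>2) * (P' (sp x) $ i $ j + (P (sp x) ** P (sp x)) $ i $ j / 2)
      + of_real (dp x) * (\<i> * Q (sp x) $ i $ j))) \<rho>3" for i j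
    unfolding N_def by (rule mexp_expansion[OF bds E3])
  have transfer: "bO g h" if "bO f h" "\<And>x. sp x \<in> space M \<Longrightarrow> g x = f x"
    for f g :: "real \<times> real \<times> 's \<times> complex \<Rightarrow> complex" and h
    by (rule bO_mono[OF _ that(1)], use dom in eventually_elim) (simp add: that(2))
  have n21: "bO (\<lambda>x. N x $ 2 $ 1 - (of_real (ep x) * \<beta> (sp x) + of_real ((ep x)\<^sup>2) * \<beta>' (sp x)
      + of_real (dp x) * (\<i> * \<beta>q (sp x)))) \<rho>3"
    by (rule transfer[OF N_exp[of 2 1]])
      (simp add: mat_def P_entries Q_entries \<beta>'_def matrix_mult_2_nth)
  have n22: "bO (\<lambda>x. N x $ 2 $ 2 - (1 - of_real (ep x) * (\<i> * of_real (p3 (sp x)))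
        + of_real ((ep x)\<^sup>2) * ((\<beta> (sp x) * cnj (\<beta> (sp x)) - of_real (p3 (sp x)) * of_real (p3 (sp x))) / 2
            - \<i> * of_real (- Im (P' (sp x) $ 2 $ 2)))
        + of_real (dp x) * of_real (q3 (sp x)))) \<rho>3"
  proof (rule transfer[OF N_exp[of 2 2]])
    fix x assume s: "sp x \<in> space M"
    have "(P (sp x) ** P (sp x)) $ 2 $ 2 = \<beta> (sp x) * cnj (\<beta> (sp x)) - of_real (p3 (sp x)) * of_real (p3 (sp x))"
      using s by (simp add: matrix_mult_2_nth P_entries algebra_simps)
    moreover have "\<i> * Q (sp x) $ 2 $ 2 = of_real (q3 (sp x))"
      using s by (simp add: Q_entries algebra_simps)
    ultimately show "N x $ 2 $ 2 - (1 - of_real (ep x) * (\<i> * of_real (p3 (sp x)))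
        + of_real ((ep x)\<^sup>2) * ((\<beta> (sp x) * cnj (\<beta> (sp x)) - of_real (p3 (sp x)) * of_real (p3 (sp x))) / 2
            - \<i> * of_real (- Im (P' (sp x) $ 2 $ 2)))
        + of_real (dp x) * of_real (q3 (sp x))) =
      N x $ 2 $ 2 - (mat 1 $ 2 $ 2 + of_real (ep x) * P (sp x) $ 2 $ 2
      + of_real ((ep x)\<^sup>2) * (P' (sp x) $ 2 $ 2 + (P (sp x) ** P (sp x)) $ 2 $ 2 / 2)
      + of_real (dp x) * (\<i> * Q (sp x) $ 2 $ 2))"
      by (subst (2) P'_22[OF s]) (simp add: mat_def P_entries[OF s])
  qed
  have N2: "bO (\<lambda>x. N x $ i $ j - (mat 1 $ i $ j + of_real (ep x) * P (sp x) $ i $ j)) \<rho>2" for i j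
  proof -
    have ent: "bO (\<lambda>x. B (sp x) $ i $ j) (\<lambda>_. 1)" if "\<And>s. s \<in> space M \<Longrightarrow> norm (B s) \<le> K'" for B :: "'s \<Rightarrow> cmat" and K' i j
      by (rule bounded[of _ K']) (rule order_trans[OF norm_entry_le that])
    have "bO (\<lambda>x. (N x $ i $ j - (mat 1 $ i $ j + of_real (ep x) * P (sp x) $ i $ j
      + of_real ((ep x)\<^sup>2) * (P' (sp x) $ i $ j + (P (sp x) ** P (sp x)) $ i $ j / 2)
      + of_real (dp x) * (\<i> * Q (sp x) $ i $ j)))
      + (of_real ((ep x)\<^sup>2) * (P' (sp x) $ i $ j + (1/2) * (P (sp x) $ i $ 1 * P (sp x) $ 1 $ j + P (sp x) $ i $ 2 * P (sp x) $ 2 $ j))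
      + of_real (dp x) * (\<i> * Q (sp x) $ i $ j))) \<rho>2"
      by (intro bO_add bO_32[OF N_exp] bO_mult2[OF scale_e2] bO_mult2[OF scale_d] bO_mult1
          bO_const ent[OF K(2)] ent[OF K(3)] ent[OF K(4)])
    also have "(\<lambda>x. (N x $ i $ j - (mat 1 $ i $ j + of_real (ep x) * P (sp x) $ i $ j
      + of_real ((ep x)\<^sup>2) * (P' (sp x) $ i $ j + (P (sp x) ** P (sp x)) $ i $ j / 2)
      + of_real (dp x) * (\<i> * Q (sp x) $ i $ j)))
      + (of_real ((ep x)\<^sup>2) * (P' (sp x) $ i $ j + (1/2) * (P (sp x) $ i $ 1 * P (sp x) $ 1 $ j + P (sp x) $ i $ 2 * P (sp x) $ 2 $ j))
      + of_real (dp x) * (\<i> * Q (sp x) $ i $ j))) = (\<lambda>x. N x $ i $ j - (mat 1 $ i $ j + of_real (ep x) * P (sp x) $ i $ j))"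
      by (rule ext) (simp add: matrix_mult_2_nth)
    finally show ?thesis .
  qed
  note log = log_expansion[OF b(1,2,3) z1 b(4,6,5) n21 n22]
  have moeb: "bO (\<lambda>x. (N x $ 1 $ 1 * z x + N x $ 1 $ 2) / (N x $ 2 $ 1 * z x + N x $ 2 $ 2)
      - (z x + of_real (ep x) * (cnj (\<beta> (sp x)) + 2 * \<i> * of_real (p3 (sp x)) * z x - \<beta> (sp x) * (z x)\<^sup>2))) \<rho>2"
    by (rule moebius_expansion[OF b(1) z1 b(4) transfer[OF N2[of 1 1]] transfer[OF N2[of 1 2]]
          transfer[OF N2[of 2 1]] transfer[OF N2[of 2 2]]])
      (simp_all add: mat_def P_entries)
  have R_entries: "Tx x $ 1 $ j = exp (\<i> * of_real (\<eta> (sp x))) * N x $ 1 $ j"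
      "Tx x $ 2 $ j = exp (- \<i> * of_real (\<eta> (sp x))) * N x $ 2 $ j"
    if "Tx x = Rrot (\<eta> (sp x)) ** N x" for x j
    using that by (simp_all add: Rrot_def matrix_mult_2_nth)
  have map_eq: "disc_map (Tx x) (z x)
      = ph (sp x) * ((N x $ 1 $ 1 * z x + N x $ 1 $ 2) / (N x $ 2 $ 1 * z x + N x $ 2 $ 2))"
    if "Tx x = Rrot (\<eta> (sp x)) ** N x" for x
  proof -
    have "disc_map (Tx x) (z x) = (exp (\<i> * of_real (\<eta> (sp x))) * (N x $ 1 $ 1 * z x + N x $ 1 $ 2))
      / (exp (- \<i> * of_real (\<eta> (sp x))) * (N x $ 2 $ 1 * z x + N x $ 2 $ 2))"
      by (simp add: disc_map_def R_entries[OF that] algebra_simps)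
    also have "\<dots> = exp (\<i> * of_real (\<eta> (sp x))) / exp (- \<i> * of_real (\<eta> (sp x)))
        * ((N x $ 1 $ 1 * z x + N x $ 1 $ 2) / (N x $ 2 $ 1 * z x + N x $ 2 $ 2))"
      by simp
    also have "exp (\<i> * of_real (\<eta> (sp x))) / exp (- \<i> * of_real (\<eta> (sp x))) = ph (sp x)"
      by (simp add: ph_def exp_diff[symmetric] mult.assoc)
    finally show ?thesis .
  qed
  have L1: "bO (\<lambda>x. ln (disc_factor (Tx x) (z x)) - log_main (ep x) (dp x) (sp x) (z x)) \<rho>3"
  proof (rule bO_mono[OF _ log], use TE in eventually_elim)
    case (elim x)
    have "Tx x $ 2 $ 1 * z x + Tx x $ 2 $ 2 = exp (- \<i> * of_real (\<eta> (sp x))) * (N x $ 2 $ 1 * z x + N x $ 2 $ 2)"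
      using R_entries(2)[of x] elim by (simp add: algebra_simps)
    then have "disc_factor (Tx x) (z x) = cmod (N x $ 2 $ 1 * z x + N x $ 2 $ 2)"
      by (simp add: disc_factor_def norm_mult norm_exp_eq_Re)
    then show ?case by (simp only: log_main_def order_refl)
  qed
  have ph1: "bO (\<lambda>x. ph (sp x)) (\<lambda>_. 1)" by (rule bounded[of _ 1]) simp
  have L2: "bO (\<lambda>x. disc_map (Tx x) (z x) - map_main (ep x) (sp x) (z x)) \<rho>2"
  proof (rule bO_mono[OF _ bO_mult1[OF ph1 moeb]], use TE in eventually_elim)
    case (elim x)
    then show ?case using map_eq[of x] by (simp add: map_main_def right_diff_distrib)
  qed
  have main1: "bO (\<lambda>x. map_main (ep x) (sp x) (z x) - ph (sp x) * z x) \<rho>1"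
  proof -
    have "bO (\<lambda>x. ph (sp x) * (of_real (ep x) * (cnj (\<beta> (sp x)) + 2 * \<i> * of_real (p3 (sp x)) * z x - \<beta> (sp x) * (z x * z x)))) \<rho>1"
      by (intro bO_mult1[OF ph1] bO_mult2[OF scale_e] bO_add bO_diff bO_mult1 bO_const bO_cnj bO_of_real b z1)
    then show ?thesis by (simp add: map_main_def power2_eq_square algebra_simps)
  qed
  have phz: "bO (\<lambda>x. ph (sp x) * z x) (\<lambda>_. 1)" by (intro bO_mult1 ph1 z1)
  have D1: "bO (\<lambda>x. (disc_map (Tx x) (z x) - map_main (ep x) (sp x) (z x)) + (map_main (ep x) (sp x) (z x) - ph (sp x) * z x)) \<rho>1"
    by (intro bO_add bO_21[OF L2] main1)
  then have D1': "bO (\<lambda>x. disc_map (Tx x) (z x) - ph (sp x) * z x) \<rho>1" by simp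
  \<comment> \<open>This is \<open>a^2 - b^2 = (a - b) * ((a - b) + 2 * b)\<close> with
    \<open>a - b\<close> of first order and \<open>b\<close> bounded.\<close>
  have "bO (\<lambda>x. (disc_map (Tx x) (z x) - ph (sp x) * z x) * ((disc_map (Tx x) (z x) - ph (sp x) * z x) + 2 * (ph (sp x) * z x))) \<rho>1"
    by (intro bO_mult2[OF D1'] bO_add bO_10[OF D1'] bO_mult1[OF bO_const] phz)
  then have L3: "bO (\<lambda>x. (disc_map (Tx x) (z x))\<^sup>2 - (ph (sp x))\<^sup>2 * (z x)\<^sup>2) \<rho>1"
    by (simp add: power2_eq_square algebra_simps)
  have N0: "bO (\<lambda>x. N x $ i $ j) (\<lambda>_. 1)" for i j
  proof -
    have "bO (\<lambda>x. (N x $ i $ j - (mat 1 $ i $ j + of_real (ep x) * P (sp x) $ i $ j)) + (mat 1 $ i $ j + of_real (ep x) * P (sp x) $ i $ j)) (\<lambda>_. 1)"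
      by (intro bO_add bO_10[OF bO_21[OF N2]] bO_const bO_mult2[OF bO_10[OF scale_e]] bounded[of _ K] order_trans[OF norm_entry_le K(2)])
    then show ?thesis by simp
  qed
  have sumN: "bO (\<lambda>x. cmod (N x $ 1 $ 1) + cmod (N x $ 1 $ 2) + cmod (N x $ 2 $ 1) + cmod (N x $ 2 $ 2)) (\<lambda>_. 1)"
    using N0 by (intro bO_add) auto
  have L4: "bO Tx (\<lambda>_. 1)"
  proof (rule bO_mono[OF _ sumN], use TE in eventually_elim)
    case (elim x)
    have "norm (Tx x) \<le> cmod (N x $ 1 $ 1) + cmod (N x $ 1 $ 2) + cmod (N x $ 2 $ 1) + cmod (N x $ 2 $ 2)"
      using norm_le_sum_entries[of "Tx x"] R_entries[OF conjunct1[OF elim]]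
      by (simp add: norm_mult norm_exp_eq_Re)
    then show ?case by simp
  qed
  obtain K1 \<epsilon>1 where 1: "\<epsilon>1 > 0" "K1 > 0" "\<And>e d a. \<bar>e\<bar> < \<epsilon>1 \<Longrightarrow> 0 \<le> d \<Longrightarrow> d < \<epsilon>1 \<Longrightarrow> a \<in> A \<Longrightarrow>
      \<bar>norm (ln (disc_factor (Tx (e, d, a)) (z (e, d, a))) - log_main (ep (e, d, a)) (dp (e, d, a)) (sp (e, d, a)) (z (e, d, a)))\<bar> \<le> K1 * \<bar>\<rho>3 (e, d, a)\<bar>"
    using L1 unfolding F_def by (rule bigo_param_filterE) blast
  obtain K2 \<epsilon>2 where 2: "\<epsilon>2 > 0" "K2 > 0" "\<And>e d a. \<bar>e\<bar> < \<epsilon>2 \<Longrightarrow> 0 \<le> d \<Longrightarrow> d < \<epsilon>2 \<Longrightarrow> a \<in> A \<Longrightarrow>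
      \<bar>norm (disc_map (Tx (e, d, a)) (z (e, d, a)) - map_main (ep (e, d, a)) (sp (e, d, a)) (z (e, d, a)))\<bar> \<le> K2 * \<bar>\<rho>2 (e, d, a)\<bar>"
    using L2 unfolding F_def by (rule bigo_param_filterE) blast
  obtain K3 \<epsilon>3 where 3: "\<epsilon>3 > 0" "K3 > 0" "\<And>e d a. \<bar>e\<bar> < \<epsilon>3 \<Longrightarrow> 0 \<le> d \<Longrightarrow> d < \<epsilon>3 \<Longrightarrow> a \<in> A \<Longrightarrow>
      \<bar>norm ((disc_map (Tx (e, d, a)) (z (e, d, a)))\<^sup>2 - (ph (sp (e, d, a)))\<^sup>2 * (z (e, d, a))\<^sup>2)\<bar> \<le> K3 * \<bar>\<rho>1 (e, d, a)\<bar>"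
    using L3 unfolding F_def by (rule bigo_param_filterE) blast
  obtain K4 \<epsilon>4 where 4: "\<epsilon>4 > 0" "K4 > 0" "\<And>e d a. \<bar>e\<bar> < \<epsilon>4 \<Longrightarrow> 0 \<le> d \<Longrightarrow> d < \<epsilon>4 \<Longrightarrow> a \<in> A \<Longrightarrow>
      \<bar>norm (Tx (e, d, a))\<bar> \<le> K4 * \<bar>1\<bar>"
    using L4 unfolding F_def by (rule bigo_param_filterE) blast
  have rho_eq: "\<rho>1 (e, d, a) = \<bar>e\<bar> + d" "\<rho>2 (e, d, a) = e\<^sup>2 + d" "\<rho>3 (e, d, a) = \<bar>e\<bar>^3 + \<bar>e\<bar> * d + d\<^sup>2" for e d a
    by (simp_all only: \<rho>1_def \<rho>2_def \<rho>3_def) (simp_all add: ep_def dp_def)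
  define \<epsilon> where "\<epsilon> = Min {\<epsilon>1, \<epsilon>2, \<epsilon>3, \<epsilon>4, r}"
  define K0 where "K0 = Max {K1, K2, K3, K4}"
  have K0: "K1 \<le> K0" "K2 \<le> K0" "K3 \<le> K0" "K4 \<le> K0" by (auto simp: K0_def)
  have le: "\<epsilon> \<le> \<epsilon>1" "\<epsilon> \<le> \<epsilon>2" "\<epsilon> \<le> \<epsilon>3" "\<epsilon> \<le> \<epsilon>4" "\<epsilon> \<le> r" by (auto simp: \<epsilon>_def)
  have scale: "x \<le> K0 * y" if "x \<le> k * y" "k \<le> K0" "0 \<le> y" for x y k
    using that mult_right_mono[of k K0 y] by linarith
  show ?thesis
  proof (rule that[of \<epsilon> K0])
    show "0 < \<epsilon>" "\<epsilon> \<le> r" using 1(1) 2(1) 3(1) 4(1) r_pos le(5) by (auto simp: \<epsilon>_def)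
    show "0 < K0" using K0(1) 1(2) by linarith
    fix e d :: real and s z' assume h: "\<bar>e\<bar> < \<epsilon>" "0 \<le> d" "d < \<epsilon>" "s \<in> space M"
    {
      assume "cmod z' \<le> 1"
      then have A: "(s, z') \<in> A" using h by (simp add: A_def)
      show "\<bar>ln (disc_factor (T e (of_real d) s) z') - log_main e d s z'\<bar> \<le> K0 * (\<bar>e\<bar>^3 + \<bar>e\<bar> * d + d\<^sup>2)"
        using 1(3)[OF _ h(2) _ A, of e, unfolded rho_eq] h le
        by (intro scale[OF _ K0(1)]) (auto simp: Tx_def ep_def dp_def sp_def z_def)
      show "cmod (disc_map (T e (of_real d) s) z' - map_main e s z') \<le> K0 * (e\<^sup>2 + d)"
        using 2(3)[OF _ h(2) _ A, of e, unfolded rho_eq] h le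
        by (intro scale[OF _ K0(2)]) (auto simp: Tx_def ep_def dp_def sp_def z_def)
      show "cmod ((disc_map (T e (of_real d) s) z')\<^sup>2 - (ph s)\<^sup>2 * z'\<^sup>2) \<le> K0 * (\<bar>e\<bar> + d)"
        using 3(3)[OF _ h(2) _ A, of e, unfolded rho_eq] h le
        by (intro scale[OF _ K0(3)]) (auto simp: Tx_def ep_def dp_def sp_def z_def)
    }
    \<comment> \<open>The norm bound does not involve the disc point; 0 is an arbitrary
      choice.\<close>
    have A: "(s, 0) \<in> A" using h by (simp add: A_def)
    show "norm (T e (of_real d) s) \<le> K0"
      using 4(3)[OF _ h(2) _ A, of e] h le K0(4) by (auto simp: Tx_def ep_def dp_def sp_def)
  qed
qed

section \<open>Expectations of the expansions\<close>

lemma integrable_coord: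
  fixes f :: "'s \<Rightarrow> 'b::{banach, second_countable_topology}"
  assumes "f \<in> borel_measurable M" "\<And>s. s \<in> space M \<Longrightarrow> norm (f s) \<le> B"
  shows "integrable M f"
  by (rule integrable_const_bound[of _ B]) (use assms in auto)

lemma integrable_coords:
  "integrable M q3" "integrable M (\<lambda>s. (cmod (\<beta> s))\<^sup>2)" "integrable M \<beta>" "integrable M \<beta>'" "integrable M \<beta>q"
  "integrable M (\<lambda>s. of_real (p3 s) * \<beta> s)" "integrable M (\<lambda>s. (\<beta> s)\<^sup>2)"
  "integrable M ph" "integrable M (\<lambda>s. ph s * cnj (\<beta> s))" "integrable M (\<lambda>s. ph s * of_real (p3 s))"
  "integrable M (\<lambda>s. ph s * \<beta> s)" "integrable M (\<lambda>s. (ph s)\<^sup>2)"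
proof -
  obtain K where K: "K \<ge> 0" "\<And>s. s \<in> space M \<Longrightarrow> norm (P s) \<le> K" "\<And>s. s \<in> space M \<Longrightarrow> norm (P' s) \<le> K"
    "\<And>s. s \<in> space M \<Longrightarrow> norm (Q s) \<le> K" "\<And>s. s \<in> space M \<Longrightarrow> cmod (\<beta> s) \<le> K"
    "\<And>s. s \<in> space M \<Longrightarrow> cmod (\<beta>' s) \<le> K" "\<And>s. s \<in> space M \<Longrightarrow> cmod (\<beta>q s) \<le> K"
    "\<And>s. s \<in> space M \<Longrightarrow> \<bar>p3 s\<bar> \<le> K" "\<And>s. s \<in> space M \<Longrightarrow> \<bar>q3 s\<bar> \<le> K"
    "\<And>s. s \<in> space M \<Longrightarrow> \<bar>Im (P' s $ 2 $ 2)\<bar> \<le> K"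
    by (rule coord_bounds) blast
  show "integrable M q3" by (rule integrable_coord[of _ K]) (use K in auto)
  show "integrable M (\<lambda>s. (cmod (\<beta> s))\<^sup>2)" by (rule integrable_coord[of _ "K\<^sup>2"]) (auto intro!: power_mono K)
  show "integrable M \<beta>" by (rule integrable_coord[of _ K]) (use K in auto)
  show "integrable M \<beta>'" by (rule integrable_coord[of _ K]) (use K in auto)
  show "integrable M \<beta>q" by (rule integrable_coord[of _ K]) (use K in auto)
  show "integrable M (\<lambda>s. of_real (p3 s) * \<beta> s)"
    by (rule integrable_coord[of _ "K * K"]) (auto simp: norm_mult intro!: mult_mono K)
  show "integrable M (\<lambda>s. (\<beta> s)\<^sup>2)"
    by (rule integrable_coord[of _ "K\<^sup>2"]) (auto simp: norm_power intro!: power_mono K)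
  show "integrable M ph" by (rule integrable_coord[of _ 1]) auto
  show "integrable M (\<lambda>s. ph s * cnj (\<beta> s))"
    by (rule integrable_coord[of _ K]) (auto simp: norm_mult intro!: K)
  show "integrable M (\<lambda>s. ph s * of_real (p3 s))"
    by (rule integrable_coord[of _ K]) (auto simp: norm_mult intro!: K)
  show "integrable M (\<lambda>s. ph s * \<beta> s)"
    by (rule integrable_coord[of _ K]) (auto simp: norm_mult intro!: K)
  show "integrable M (\<lambda>s. (ph s)\<^sup>2)"
    by (rule integrable_coord[of _ 1]) (auto simp: norm_power)
qed

text \<open>After taking expectations, \<open>b1\<close>, \<open>b2\<close>, \<open>b3\<close> and
  \<open>b4\<close> are the complex coefficients of \<open>e * z\<close>, \<open>e^2 * z\<close>,
  \<open>d * z\<close> and \<open>e^2 * z^2\<close> under the real part in \<open>log_main\<close>,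
  and \<open>c0\<close>, \<open>c1\<close>, \<open>c2\<close> those of \<open>e\<close>,
  \<open>e * z\<close>, \<open>e * z^2\<close> in \<open>map_main\<close>. Only \<open>b1\<close>,
  \<open>c0\<close> and \<open>\<kappa>1\<close> reach the final formula.\<close>

definition \<kappa>1 :: complex where "\<kappa>1 = (\<integral>s. ph s \<partial>M)"
definition \<kappa>2 :: complex where "\<kappa>2 = (\<integral>s. (ph s)\<^sup>2 \<partial>M)"
definition b1 :: complex where "b1 = (\<integral>s. \<beta> s \<partial>M)"
definition b2 :: complex where "b2 = (\<integral>s. \<beta>' s \<partial>M) + \<i> * (\<integral>s. of_real (p3 s) * \<beta> s \<partial>M)"
definition b3 :: complex where "b3 = \<i> * (\<integral>s. \<beta>q s \<partial>M)"
definition b4 :: complex where "b4 = - (1/2) * (\<integral>s. (\<beta> s)\<^sup>2 \<partial>M)"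
definition c0 :: complex where "c0 = (\<integral>s. ph s * cnj (\<beta> s) \<partial>M)"
definition c1 :: complex where "c1 = 2 * \<i> * (\<integral>s. ph s * of_real (p3 s) \<partial>M)"
definition c2 :: complex where "c2 = - (\<integral>s. ph s * \<beta> s \<partial>M)"

lemma nonresonant': "\<kappa>1 \<noteq> 1" "\<kappa>2 \<noteq> 1"
proof -
  show "\<kappa>1 \<noteq> 1" using nonresonant(1) by (simp add: \<kappa>1_def ph_def)
  have "(ph s)\<^sup>2 = exp (4 * \<i> * of_real (\<eta> s))" for s
    by (simp add: ph_def power2_eq_square exp_add[symmetric] mult.assoc)
  then show "\<kappa>2 \<noteq> 1" using nonresonant(2) by (simp add: \<kappa>2_def)
qed

lemma expectation_log_main:
  "integrable M (\<lambda>s. log_main e d s z)"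
  "(\<integral>s. log_main e d s z \<partial>M) = (d * (\<integral>s. q3 s \<partial>M) + e\<^sup>2 * ((\<integral>s. (cmod (\<beta> s))\<^sup>2 \<partial>M) / 2))
     + Re ((of_real e * b1 + of_real (e\<^sup>2) * b2 + of_real d * b3) * z + (of_real (e\<^sup>2) * b4) * z\<^sup>2)"
proof -
  \<comment> \<open>A complex combination, linear in integrable functions of the sample: expectation
    commutes with \<open>Re\<close>, and only the integrals behind \<open>b1\<close> to
    \<open>b4\<close> remain.\<close>
  define G where "G s = of_real e * \<beta> s * z + of_real (e\<^sup>2) * \<beta>' s * z + of_real (e\<^sup>2) * \<i> * z * (of_real (p3 s) * \<beta> s)
     + of_real d * \<i> * z * \<beta>q s - of_real (e\<^sup>2) / 2 * z\<^sup>2 * (\<beta> s)\<^sup>2" for s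
  have eq: "log_main e d s z = (d * q3 s + e\<^sup>2 / 2 * (cmod (\<beta> s))\<^sup>2) + Re (G s)" for s
  proof -
    have "G s = z * (of_real e * \<beta> s + of_real (e\<^sup>2) * (\<beta>' s + \<i> * (of_real (p3 s) * \<beta> s)) + of_real d * (\<i> * \<beta>q s))
       - of_real (e\<^sup>2 / 2) * (z\<^sup>2 * (\<beta> s)\<^sup>2)"
      by (simp add: G_def algebra_simps)
    moreover have "Re (of_real c * w) = c * Re w" for c w by simp
    ultimately show ?thesis by (simp only: log_main_def minus_complex.sel)
  qed
  have G_int: "integrable M G"
    unfolding G_def
    by (intro Bochner_Integration.integrable_add Bochner_Integration.integrable_diff integrable_mult_right
        integrable_mult_left integrable_coords)
  have G_val: "(\<integral>s. G s \<partial>M) = (of_real e * b1 + of_real (e\<^sup>2) * b2 + of_real d * b3) * z + (of_real (e\<^sup>2) * b4) * z\<^sup>2"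
  proof -
    have "(\<integral>s. G s \<partial>M) = of_real e * (\<integral>s. \<beta> s \<partial>M) * z + of_real (e\<^sup>2) * (\<integral>s. \<beta>' s \<partial>M) * z
      + of_real (e\<^sup>2) * \<i> * z * (\<integral>s. of_real (p3 s) * \<beta> s \<partial>M) + of_real d * \<i> * z * (\<integral>s. \<beta>q s \<partial>M)
      - of_real (e\<^sup>2) / 2 * z\<^sup>2 * (\<integral>s. (\<beta> s)\<^sup>2 \<partial>M)"
      unfolding G_def using integrable_coords by simp
    then show ?thesis by (simp add: b1_def b2_def b3_def b4_def algebra_simps)
  qed
  show "integrable M (\<lambda>s. log_main e d s z)"
    unfolding eq using G_int integrable_coords by simp
  show "(\<integral>s. log_main e d s z \<partial>M) = (d * (\<integral>s. q3 s \<partial>M) + e\<^sup>2 * ((\<integral>s. (cmod (\<beta> s))\<^sup>2 \<partial>M) / 2))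
     + Re ((of_real e * b1 + of_real (e\<^sup>2) * b2 + of_real d * b3) * z + (of_real (e\<^sup>2) * b4) * z\<^sup>2)"
    unfolding eq G_val[symmetric] using G_int integrable_coords by simp
qed

lemma expectation_map_main:
  "integrable M (\<lambda>s. map_main e s z)"
  "(\<integral>s. map_main e s z \<partial>M) = \<kappa>1 * z + (of_real e * c0 + (of_real e * c1 * z + of_real e * c2 * z\<^sup>2))"
proof -
  have eq: "map_main e s z = ph s * z + of_real e * (ph s * cnj (\<beta> s)) + of_real e * 2 * \<i> * z * (ph s * of_real (p3 s))
      - of_real e * z\<^sup>2 * (ph s * \<beta> s)" for s
    by (simp add: map_main_def algebra_simps)
  show "integrable M (\<lambda>s. map_main e s z)"
    unfolding eq using integrable_coords by simp
  show "(\<integral>s. map_main e s z \<partial>M) = \<kappa>1 * z + (of_real e * c0 + (of_real e * c1 * z + of_real e * c2 * z\<^sup>2))"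
  proof -
    have "(\<integral>s. map_main e s z \<partial>M) = (\<integral>s. ph s \<partial>M) * z + of_real e * (\<integral>s. ph s * cnj (\<beta> s) \<partial>M)
      + of_real e * 2 * \<i> * z * (\<integral>s. ph s * of_real (p3 s) \<partial>M) - of_real e * z\<^sup>2 * (\<integral>s. ph s * \<beta> s \<partial>M)"
      unfolding eq using integrable_coords by simp
    then show ?thesis by (simp add: \<kappa>1_def c0_def c1_def c2_def algebra_simps)
  qed
qed

section \<open>From stationarity to the expansion of the exponent\<close>

lemma stationary_moments:
  obtains K \<epsilon> where "0 < \<epsilon>" "0 < K"
    "\<And>e d. \<bar>e\<bar> < \<epsilon> \<Longrightarrow> 0 \<le> d \<Longrightarrow> d < \<epsilon> \<Longrightarrow> \<exists>m1 m2. cmod m1 \<le> 1 \<and> cmod m2 \<le> 1 \<and>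
      \<bar>lyap M (T e (of_real d)) - ((d * (\<integral>s. q3 s \<partial>M) + e\<^sup>2 * ((\<integral>s. (cmod (\<beta> s))\<^sup>2 \<partial>M) / 2))
        + Re ((of_real e * b1 + of_real (e\<^sup>2) * b2 + of_real d * b3) * m1 + (of_real (e\<^sup>2) * b4) * m2))\<bar>
        \<le> K * (\<bar>e\<bar>^3 + \<bar>e\<bar> * d + d\<^sup>2) \<and>
      cmod (m1 - (\<kappa>1 * m1 + (of_real e * c0 + (of_real e * c1 * m1 + of_real e * c2 * m2)))) \<le> K * (e\<^sup>2 + d) \<and>
      cmod (m2 - \<kappa>2 * m2) \<le> K * (\<bar>e\<bar> + d)"
proof -
  obtain K \<epsilon> where "0 < \<epsilon>" "\<epsilon> \<le> r" "0 < K" and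
    log: "\<And>e d s z. \<bar>e\<bar> < \<epsilon> \<Longrightarrow> 0 \<le> d \<Longrightarrow> d < \<epsilon> \<Longrightarrow> s \<in> space M \<Longrightarrow> cmod z \<le> 1 \<Longrightarrow>
      \<bar>ln (disc_factor (T e (of_real d) s) z) - log_main e d s z\<bar> \<le> K * (\<bar>e\<bar>^3 + \<bar>e\<bar> * d + d\<^sup>2)" and
    map: "\<And>e d s z. \<bar>e\<bar> < \<epsilon> \<Longrightarrow> 0 \<le> d \<Longrightarrow> d < \<epsilon> \<Longrightarrow> s \<in> space M \<Longrightarrow> cmod z \<le> 1 \<Longrightarrow>
      cmod (disc_map (T e (of_real d) s) z - map_main e s z) \<le> K * (e\<^sup>2 + d)" and
    sq: "\<And>e d s z. \<bar>e\<bar> < \<epsilon> \<Longrightarrow> 0 \<le> d \<Longrightarrow> d < \<epsilon> \<Longrightarrow> s \<in> space M \<Longrightarrow> cmod z \<le> 1 \<Longrightarrow>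
      cmod ((disc_map (T e (of_real d) s) z)\<^sup>2 - (ph s)\<^sup>2 * z\<^sup>2) \<le> K * (\<bar>e\<bar> + d)" and
    bd: "\<And>e d s. \<bar>e\<bar> < \<epsilon> \<Longrightarrow> 0 \<le> d \<Longrightarrow> d < \<epsilon> \<Longrightarrow> s \<in> space M \<Longrightarrow> norm (T e (of_real d) s) \<le> K"
    by (rule uniform_expansions) blast
  show ?thesis
  proof (rule that[of \<epsilon> K])
    fix e d :: real assume h: "\<bar>e\<bar> < \<epsilon>" "0 \<le> d" "d < \<epsilon>"
    note diff_le = norm_integral_diff_le
    interpret contracting_products M "T e (of_real d)" K
    proof unfold_locales
      fix s assume "s \<in> space M"
      then show "contracting (T e (of_real d) s)" "norm (T e (of_real d) s) \<le> K"
        using h \<open>\<epsilon> \<le> r\<close> bd by (auto intro!: SU11_le_contracting T_SU11_le)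
    qed simp
    have [measurable]: "(\<lambda>s. disc_map (T e (of_real d) s) z) \<in> borel_measurable M"
      "(\<lambda>s. disc_factor (T e (of_real d) s) z) \<in> borel_measurable M" for z
      unfolding disc_map_def disc_factor_def by measurable
    show "\<exists>m1 m2. cmod m1 \<le> 1 \<and> cmod m2 \<le> 1 \<and>
      \<bar>lyap M (T e (of_real d)) - ((d * (\<integral>s. q3 s \<partial>M) + e\<^sup>2 * ((\<integral>s. (cmod (\<beta> s))\<^sup>2 \<partial>M) / 2))
        + Re ((of_real e * b1 + of_real (e\<^sup>2) * b2 + of_real d * b3) * m1 + (of_real (e\<^sup>2) * b4) * m2))\<bar>
        \<le> K * (\<bar>e\<bar>^3 + \<bar>e\<bar> * d + d\<^sup>2) \<and>
      cmod (m1 - (\<kappa>1 * m1 + (of_real e * c0 + (of_real e * c1 * m1 + of_real e * c2 * m2)))) \<le> K * (e\<^sup>2 + d) \<and>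
      cmod (m2 - \<kappa>2 * m2) \<le> K * (\<bar>e\<bar> + d)"
      unfolding lyap_eq_growth
    proof (rule growth_via_stationary_moments)
      fix z :: complex assume z: "cmod z \<le> 1"
      show "\<bar>(\<integral>s. ln (disc_factor (T e (of_real d) s) z) \<partial>M)
          - ((d * (\<integral>s. q3 s \<partial>M) + e\<^sup>2 * ((\<integral>s. (cmod (\<beta> s))\<^sup>2 \<partial>M) / 2))
        + Re ((of_real e * b1 + of_real (e\<^sup>2) * b2 + of_real d * b3) * z + (of_real (e\<^sup>2) * b4) * z\<^sup>2))\<bar>
        \<le> K * (\<bar>e\<bar>^3 + \<bar>e\<bar> * d + d\<^sup>2)"
        unfolding expectation_log_main(2)[symmetric] real_norm_def[symmetric]
        by (rule diff_le) (use expectation_log_main log[OF h _ z] in auto)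
      show "cmod ((\<integral>s. disc_map (T e (of_real d) s) z \<partial>M)
          - (\<kappa>1 * z + (of_real e * c0 + (of_real e * c1 * z + of_real e * c2 * z\<^sup>2)))) \<le> K * (e\<^sup>2 + d)"
        unfolding expectation_map_main(2)[symmetric]
        by (rule diff_le) (use expectation_map_main map[OF h _ z] in auto)
      have "(\<integral>s. (ph s)\<^sup>2 * z\<^sup>2 \<partial>M) = \<kappa>2 * z\<^sup>2"
        using integrable_coords by (simp add: \<kappa>2_def)
      moreover have "cmod ((\<integral>s. (disc_map (T e (of_real d) s) z)\<^sup>2 \<partial>M) - (\<integral>s. (ph s)\<^sup>2 * z\<^sup>2 \<partial>M)) \<le> K * (\<bar>e\<bar> + d)"
        by (rule diff_le) (use sq[OF h _ z] integrable_coords in auto)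
      ultimately show "cmod ((\<integral>s. (disc_map (T e (of_real d) s) z)\<^sup>2 \<partial>M) - \<kappa>2 * z\<^sup>2) \<le> K * (\<bar>e\<bar> + d)"
        by (simp only:)
    qed
  qed fact+
qed

text \<open>By nonresonance the stationarity relations determine \<open>m2 = O(\<bar>e\<bar> + d)\<close> and
  \<open>m1 = e c0 / (1 - \<kappa>1) + O(e\<^sup>2 + d)\<close>.\<close>

theorem lyapunov_expansion:
  obtains K \<epsilon> where "0 < \<epsilon>"
    "\<And>e d. \<bar>e\<bar> < \<epsilon> \<Longrightarrow> 0 \<le> d \<Longrightarrow> d < \<epsilon> \<Longrightarrow>
      \<bar>lyap M (T e (of_real d)) - (\<integral>s. q3 s \<partial>M) * d
        - (1/2 * (\<integral>s. (cmod (\<beta> s))\<^sup>2 \<partial>M) + Re (b1 * c0 / (1 - \<kappa>1))) * e\<^sup>2\<bar>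
      \<le> K * (\<bar>e\<bar>^3 + \<bar>e\<bar> * d + d\<^sup>2)"
proof -
  obtain K0 \<epsilon>0 where \<epsilon>0: "0 < \<epsilon>0" "0 < K0" and
    ex: "\<And>e d. \<bar>e\<bar> < \<epsilon>0 \<Longrightarrow> 0 \<le> d \<Longrightarrow> d < \<epsilon>0 \<Longrightarrow> \<exists>m1 m2. cmod m1 \<le> 1 \<and> cmod m2 \<le> 1 \<and>
      \<bar>lyap M (T e (of_real d)) - ((d * (\<integral>s. q3 s \<partial>M) + e\<^sup>2 * ((\<integral>s. (cmod (\<beta> s))\<^sup>2 \<partial>M) / 2))
        + Re ((of_real e * b1 + of_real (e\<^sup>2) * b2 + of_real d * b3) * m1 + (of_real (e\<^sup>2) * b4) * m2))\<bar>
        \<le> K0 * (\<bar>e\<bar>^3 + \<bar>e\<bar> * d + d\<^sup>2) \<and>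
      cmod (m1 - (\<kappa>1 * m1 + (of_real e * c0 + (of_real e * c1 * m1 + of_real e * c2 * m2)))) \<le> K0 * (e\<^sup>2 + d) \<and>
      cmod (m2 - \<kappa>2 * m2) \<le> K0 * (\<bar>e\<bar> + d)"
    by (rule stationary_moments) blast
  define ep :: "real \<times> real \<times> unit \<Rightarrow> real" where "ep = fst"
  define dp :: "real \<times> real \<times> unit \<Rightarrow> real" where "dp = (\<lambda>x. fst (snd x))"
  \<comment> \<open>The samples are integrated out, so there is nothing left to be uniform in; the
    third component is \<open>unit\<close>.\<close>
  define F where "F = param_filter (UNIV :: unit set)"
  interpret small_parameters F ep dp
    unfolding F_def ep_def dp_def by (rule small_parameters_param_filter)
  define ly where "ly x = lyap M (T (ep x) (of_real (dp x)))" for x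
  define A0 where "A0 x = dp x * (\<integral>s. q3 s \<partial>M) + (ep x)\<^sup>2 * ((\<integral>s. (cmod (\<beta> s))\<^sup>2 \<partial>M) / 2)" for x
  define A1 where "A1 x = of_real (ep x) * b1 + of_real ((ep x)\<^sup>2) * b2 + of_real (dp x) * b3" for x
  define A2 where "A2 x = of_real ((ep x)\<^sup>2) * b4" for x
  define good where "good x m1 m2 \<longleftrightarrow> cmod m1 \<le> 1 \<and> cmod m2 \<le> 1 \<and>
      \<bar>ly x - (A0 x + Re (A1 x * m1 + A2 x * m2))\<bar> \<le> K0 * \<rho>3 x \<and>
      cmod (m1 - (\<kappa>1 * m1 + (of_real (ep x) * c0 + (of_real (ep x) * c1 * m1 + of_real (ep x) * c2 * m2)))) \<le> K0 * \<rho>2 x \<and>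
      cmod (m2 - \<kappa>2 * m2) \<le> K0 * \<rho>1 x" for x m1 m2
  have "eventually (\<lambda>x. \<exists>m. good x (fst m) (snd m)) F"
    unfolding F_def eventually_param_filter
  proof (intro exI[of _ \<epsilon>0] conjI allI impI \<epsilon>0)
    fix e d :: real and a :: unit assume "\<bar>e\<bar> < \<epsilon>0" "0 \<le> d" "d < \<epsilon>0"
    from ex[OF this] show "\<exists>m. good (e, d, a) (fst m) (snd m)"
      unfolding good_def ly_def A0_def A1_def A2_def \<rho>1_def \<rho>2_def \<rho>3_def by (simp add: ep_def dp_def)
  qed
  \<comment> \<open>The moments exist for each parameter separately; choosing them as functions of
    the parameter makes the Landau calculus applicable.\<close>
  moreover define m where "m x = (SOME m. good x (fst m) (snd m))" for x
  ultimately have good: "eventually (\<lambda>x. good x (fst (m x)) (snd (m x))) F"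
    by (elim eventually_mono) (unfold m_def, erule someI_ex)
  define m1 where "m1 x = fst (m x)" for x
  define m2 where "m2 x = snd (m x)" for x
  have Re_of_real_mult: "Re (of_real c * w) = c * Re w" for c w by simp
  have m1_1: "bO m1 (\<lambda>_. 1)" and m2_1: "bO m2 (\<lambda>_. 1)"
    by (rule bigoI[of _ 1], use good in eventually_elim, simp add: good_def m1_def m2_def)+
  have good_bigo: "f \<in> O[F](g)" if "\<And>x. good x (m1 x) (m2 x) \<Longrightarrow> \<bar>f x\<bar> \<le> K0 * g x" for f g :: "real \<times> real \<times> unit \<Rightarrow> real"
  proof (rule bigoI[of _ K0], use good in eventually_elim)
    case (elim x)
    then have "\<bar>f x\<bar> \<le> K0 * g x" by (intro that) (simp add: m1_def m2_def)
    also have "\<dots> \<le> K0 * \<bar>g x\<bar>" using \<epsilon>0(2) by (intro mult_left_mono) auto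
    finally show ?case by simp
  qed
  have r1: "bO (\<lambda>x. m2 x - \<kappa>2 * m2 x) \<rho>1"
    and r2: "bO (\<lambda>x. m1 x - (\<kappa>1 * m1 x + (of_real (ep x) * c0 + (of_real (ep x) * c1 * m1 x + of_real (ep x) * c2 * m2 x)))) \<rho>2"
    and r3: "bO (\<lambda>x. ly x - (A0 x + Re (A1 x * m1 x + A2 x * m2 x))) \<rho>3"
    by (rule good_bigo, simp only: good_def abs_norm_cancel real_norm_def abs_idempotent)+
  have "bO (\<lambda>x. (1 / (1 - \<kappa>2)) * (m2 x - \<kappa>2 * m2 x)) \<rho>1"
    by (intro bO_mult1[OF bO_const] r1)
  then have m2_\<rho>1: "bO m2 \<rho>1"
  proof (rule bO_mono[rotated], intro always_eventually allI)
    fix x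
    have "(1 / (1 - \<kappa>2)) * (m2 x - \<kappa>2 * m2 x) = m2 x"
      using nonresonant' by (simp add: field_simps)
    then show "norm (m2 x) \<le> norm ((1 / (1 - \<kappa>2)) * (m2 x - \<kappa>2 * m2 x))" by simp
  qed
  define m0 where "m0 x = of_real (ep x) * (c0 / (1 - \<kappa>1))" for x
  have m0_\<rho>1: "bO m0 \<rho>1"
    unfolding m0_def by (intro bO_mult2 scale_e bO_const)
  define w where "w x = m1 x - (\<kappa>1 * m1 x + (of_real (ep x) * c0 + (of_real (ep x) * c1 * m1 x + of_real (ep x) * c2 * m2 x)))" for x
  have w: "bO w \<rho>2" using r2 by (simp add: w_def)
  have m1_eq: "m1 x = m0 x + (1 / (1 - \<kappa>1)) * (w x + (of_real (ep x) * (c1 * m1 x) + of_real (ep x) * (c2 * m2 x)))" for x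
  proof -
    have "w x + (of_real (ep x) * (c1 * m1 x) + of_real (ep x) * (c2 * m2 x)) = (1 - \<kappa>1) * m1 x - of_real (ep x) * c0"
      by (simp add: w_def algebra_simps)
    then show ?thesis using nonresonant' by (simp add: m0_def diff_divide_distrib)
  qed
  have diff_eqI: "a = b + c \<Longrightarrow> a - b = c" for a b c :: complex by simp
  \<comment> \<open>A bootstrap: mere boundedness of the moments gives \<open>m1\<close> of first
    order; reinserting this together with the bound for \<open>m2\<close> turns the corrections
    carrying the factor \<open>e\<close> into second-order terms.\<close>
  have "bO (\<lambda>x. m0 x + (1 / (1 - \<kappa>1)) * (w x + (of_real (ep x) * (c1 * m1 x) + of_real (ep x) * (c2 * m2 x)))) \<rho>1"
    by (intro bO_add m0_\<rho>1 bO_mult1[OF bO_const] bO_21[OF w] bO_mult2[OF scale_e] m1_1 m2_1)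
  then have m1_\<rho>1: "bO m1 \<rho>1" unfolding m1_eq[symmetric] .
  have "bO (\<lambda>x. (1 / (1 - \<kappa>1)) * (w x + (of_real (ep x) * (c1 * m1 x) + of_real (ep x) * (c2 * m2 x)))) \<rho>2"
    by (intro bO_add bO_mult1[OF bO_const] w bO_11[OF scale_e] m1_\<rho>1 m2_\<rho>1)
  moreover have "m1 x - m0 x = (1 / (1 - \<kappa>1)) * (w x + (of_real (ep x) * (c1 * m1 x) + of_real (ep x) * (c2 * m2 x)))" for x
    by (rule diff_eqI[OF m1_eq])
  ultimately have m1_m0: "bO (\<lambda>x. m1 x - m0 x) \<rho>2" by (simp only:)
  \<comment> \<open>This is the difference between \<open>A1 * m1 + A2 * m2\<close> and its leading
    term \<open>e^2 * b1 * c0 / (1 - \<kappa>1)\<close>. Each summand pairs a first-order with a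
    second-order quantity.\<close>
  have "bO (\<lambda>x. of_real (ep x) * (b1 * (m1 x - m0 x))
      + (of_real ((ep x)\<^sup>2) * b2 + of_real (dp x) * b3) * m1 x + (of_real ((ep x)\<^sup>2) * b4) * m2 x) \<rho>3"
  proof (intro bO_add)
    show "bO (\<lambda>x. of_real (ep x) * (b1 * (m1 x - m0 x))) \<rho>3"
      by (intro bO_12[OF scale_e] bO_mult1[OF bO_const] m1_m0)
    have "bO (\<lambda>x. m1 x * (of_real ((ep x)\<^sup>2) * b2 + of_real (dp x) * b3)) \<rho>3"
      by (intro bO_12[OF m1_\<rho>1] bO_add bO_mult2[OF _ bO_const] scale_e2 scale_d)
    then show "bO (\<lambda>x. (of_real ((ep x)\<^sup>2) * b2 + of_real (dp x) * b3) * m1 x) \<rho>3"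
      by (simp add: mult.commute)
    have "bO (\<lambda>x. m2 x * (of_real ((ep x)\<^sup>2) * b4)) \<rho>3"
      by (intro bO_12[OF m2_\<rho>1] bO_mult2[OF _ bO_const] scale_e2)
    then show "bO (\<lambda>x. (of_real ((ep x)\<^sup>2) * b4) * m2 x) \<rho>3"
      by (simp add: mult.commute)
  qed
  from bO_add[OF r3 bO_Re[OF this]]
  have fin: "bO (\<lambda>x. ly x - (\<integral>s. q3 s \<partial>M) * dp x
        - (1/2 * (\<integral>s. (cmod (\<beta> s))\<^sup>2 \<partial>M) + Re (b1 * c0 / (1 - \<kappa>1))) * (ep x)\<^sup>2) \<rho>3"
  proof (rule bO_mono[rotated], intro always_eventually allI)
    fix x
    define Y where "Y = of_real (ep x) * (b1 * (m1 x - m0 x))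
      + (of_real ((ep x)\<^sup>2) * b2 + of_real (dp x) * b3) * m1 x + (of_real ((ep x)\<^sup>2) * b4) * m2 x"
    have "A1 x * m1 x + A2 x * m2 x = Y + of_real ((ep x)\<^sup>2) * (b1 * c0 / (1 - \<kappa>1))"
      by (simp add: A1_def A2_def Y_def m0_def power2_eq_square algebra_simps)
    then have "Re (A1 x * m1 x + A2 x * m2 x) = Re Y + (ep x)\<^sup>2 * Re (b1 * c0 / (1 - \<kappa>1))"
      by (simp only: plus_complex.sel Re_of_real_mult)
    then have "ly x - (\<integral>s. q3 s \<partial>M) * dp x
        - (1/2 * (\<integral>s. (cmod (\<beta> s))\<^sup>2 \<partial>M) + Re (b1 * c0 / (1 - \<kappa>1))) * (ep x)\<^sup>2
      = ly x - (A0 x + Re (A1 x * m1 x + A2 x * m2 x)) + Re Y"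
      by (simp only: A0_def) (simp add: algebra_simps del: Re_divide times_complex.sel)
    then show "norm (ly x - (\<integral>s. q3 s \<partial>M) * dp x
        - (1/2 * (\<integral>s. (cmod (\<beta> s))\<^sup>2 \<partial>M) + Re (b1 * c0 / (1 - \<kappa>1))) * (ep x)\<^sup>2)
      \<le> norm (ly x - (A0 x + Re (A1 x * m1 x + A2 x * m2 x)) + Re (of_real (ep x) * (b1 * (m1 x - m0 x))
      + (of_real ((ep x)\<^sup>2) * b2 + of_real (dp x) * b3) * m1 x + (of_real ((ep x)\<^sup>2) * b4) * m2 x))"
      unfolding Y_def by (simp only: order_refl)
  qed
  then obtain K \<epsilon> where \<epsilon>: "\<epsilon> > 0" and K: "\<And>e d a. \<bar>e\<bar> < \<epsilon> \<Longrightarrow> 0 \<le> d \<Longrightarrow> d < \<epsilon> \<Longrightarrow> a \<in> UNIV \<Longrightarrow>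
      \<bar>norm (ly (e, d, a) - (\<integral>s. q3 s \<partial>M) * dp (e, d, a)
        - (1/2 * (\<integral>s. (cmod (\<beta> s))\<^sup>2 \<partial>M) + Re (b1 * c0 / (1 - \<kappa>1))) * (ep (e, d, a))\<^sup>2)\<bar> \<le> K * \<bar>\<rho>3 (e, d, a)\<bar>"
    unfolding F_def by (rule bigo_param_filterE) blast
  have rho3: "\<rho>3 (e, d, a) = \<bar>e\<bar>^3 + \<bar>e\<bar> * d + d\<^sup>2" for e d a
    by (simp only: \<rho>3_def) (simp add: ep_def dp_def)
  show ?thesis
  proof (rule that[of \<epsilon> K])
    fix e d :: real assume h: "\<bar>e\<bar> < \<epsilon>" "0 \<le> d" "d < \<epsilon>"
    have "0 \<le> \<bar>e\<bar>^3 + \<bar>e\<bar> * d + d\<^sup>2" using h by simp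
    then show "\<bar>lyap M (T e (of_real d)) - (\<integral>s. q3 s \<partial>M) * d
        - (1/2 * (\<integral>s. (cmod (\<beta> s))\<^sup>2 \<partial>M) + Re (b1 * c0 / (1 - \<kappa>1))) * e\<^sup>2\<bar>
      \<le> K * (\<bar>e\<bar>^3 + \<bar>e\<bar> * d + d\<^sup>2)"
      using K[OF h UNIV_I, of "()"] unfolding rho3 by (simp add: ly_def ep_def dp_def del: Re_divide)
  qed fact
qed

end

theorem theorem2:
  fixes M :: "'s measure"
    and T :: "real \<Rightarrow> complex \<Rightarrow> 's \<Rightarrow> cmat"
    and \<eta> :: "'s \<Rightarrow> real"
    and P P' Q :: "'s \<Rightarrow> cmat"
    and p1 p2 p3 q1 q2 q3 :: "'s \<Rightarrow> real"
    and r :: real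
  assumes prob: "prob_space M"
    and r_pos: "r > 0"
    and T_meas: "\<And>e d. T e d \<in> borel_measurable M"
    and eta_meas: "\<eta> \<in> borel_measurable M"
    and p_meas: "p1 \<in> borel_measurable M" "p2 \<in> borel_measurable M" "p3 \<in> borel_measurable M"
    and q_meas: "q1 \<in> borel_measurable M" "q2 \<in> borel_measurable M" "q3 \<in> borel_measurable M"
    and P'_meas: "P' \<in> borel_measurable M"
    and SL: "\<And>e d s. s \<in> space M \<Longrightarrow> \<bar>e\<bar> < r \<Longrightarrow> \<bar>d\<bar> < r \<Longrightarrow> det (T e (of_real d) s) = 1"
    and C2: "\<And>s. s \<in> space M \<Longrightarrow> C2_near (\<lambda>(e, d). T e (of_real d) s) (0, 0)"
    and at0: "\<And>s. s \<in> space M \<Longrightarrow> T 0 0 s = Rrot (\<eta> s) \<and> 0 \<le> \<eta> s \<and> \<eta> s < 2 * pi"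
    and SU_eps: "\<And>e s. s \<in> space M \<Longrightarrow> \<bar>e\<bar> < r \<Longrightarrow> T e 0 s \<in> SU11"
    and SU_del: "\<And>d s. s \<in> space M \<Longrightarrow> \<bar>d\<bar> < r \<Longrightarrow> T 0 (\<i> * of_real d) s \<in> SU11"
    and SU_le: "\<And>e d s. s \<in> space M \<Longrightarrow> \<bar>e\<bar> < r \<Longrightarrow> 0 \<le> d \<Longrightarrow> d < r \<Longrightarrow>
                  T e (of_real d) s \<in> SU11_le"
    and in_su: "\<And>s. s \<in> space M \<Longrightarrow> P s \<in> su11 \<and> P' s \<in> su11 \<and> Q s \<in> su11"
    and P_coord: "\<And>s. s \<in> space M \<Longrightarrow>
                  P s = of_real (p1 s) *\<^sub>c B1 + of_real (p2 s) *\<^sub>c B2 + of_real (p3 s) *\<^sub>c B3"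
    and Q_coord: "\<And>s. s \<in> space M \<Longrightarrow>
                  Q s = of_real (q1 s) *\<^sub>c B1 + of_real (q2 s) *\<^sub>c B2 + of_real (q3 s) *\<^sub>c B3"
    and bounded: "\<exists>K. \<forall>s\<in>space M. norm (P s) \<le> K \<and> norm (P' s) \<le> K \<and> norm (Q s) \<le> K"
    and expansion: "\<exists>C. \<forall>e d s. s \<in> space M \<longrightarrow> \<bar>e\<bar> < r \<longrightarrow> 0 \<le> d \<longrightarrow> d < r \<longrightarrow>
                  (\<exists>E. T e (of_real d) s
                        = Rrot (\<eta> s) ** mexp (of_real e *\<^sub>c P s + of_real (e^2) *\<^sub>c P' s
                                               + (\<i> * of_real d) *\<^sub>c Q s + E)
                      \<and> norm E \<le> C * (\<bar>e\<bar>^3 + \<bar>e\<bar> * d + d^2))"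
    and nonfinite: "\<And>e d F. \<bar>e\<bar> < r \<Longrightarrow> 0 \<le> d \<Longrightarrow> d < r \<Longrightarrow> (e, d) \<noteq> (0, 0) \<Longrightarrow>
                  finite F \<Longrightarrow> F \<noteq> {} \<Longrightarrow>
                  \<not> ((\<lambda>(A, z). moebius A z) ` (rsupp M (T e (of_real d)) \<times> F) \<subseteq> F)"
    and noncompact: "\<And>e d. \<bar>e\<bar> < r \<Longrightarrow> 0 \<le> d \<Longrightarrow> d < r \<Longrightarrow> (e, d) \<noteq> (0, 0) \<Longrightarrow>
                  \<not> compact (closure (semigroup_gen (rsupp M (T e (of_real d)))))"
    and nonres: "\<And>j::nat. j \<in> {1, 2} \<Longrightarrow>
                  (\<integral>s. exp (2 * \<i> * of_nat j * of_real (\<eta> s)) \<partial>M) \<noteq> 1"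
  shows "\<exists>K \<epsilon>0. \<epsilon>0 > 0 \<and> (\<forall>e d. \<bar>e\<bar> < \<epsilon>0 \<longrightarrow> 0 \<le> d \<longrightarrow> d < \<epsilon>0 \<longrightarrow>
           (let \<beta> = (\<lambda>s. complex_of_real (p1 s) - \<i> * complex_of_real (p2 s));
                Cc = (\<integral>s. q3 s \<partial>M);
                Dc = (1/2) * (\<integral>s. (cmod (\<beta> s))^2 \<partial>M)
                     + Re ((\<integral>s. \<beta> s \<partial>M) * (\<integral>s. exp (2 * \<i> * of_real (\<eta> s)) * cnj (\<beta> s) \<partial>M)
                           / (1 - (\<integral>s. exp (2 * \<i> * of_real (\<eta> s)) \<partial>M)))
            in \<bar>lyap M (T e (of_real d)) - Cc * d - Dc * e^2\<bar>
                 \<le> K * (\<bar>e\<bar>^3 + \<bar>e\<bar> * d + d^2)))"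
proof -
  interpret prob_space M by (rule prob)
  interpret perturbed_rotations M T \<eta> P P' Q p1 p2 p3 q1 q2 q3 r
  proof
    show "(\<integral>s. exp (2 * \<i> * of_real (\<eta> s)) \<partial>M) \<noteq> 1" using nonres[of 1] by simp
    show "(\<integral>s. exp (4 * \<i> * of_real (\<eta> s)) \<partial>M) \<noteq> 1" using nonres[of 2] by (simp add: mult.assoc mult.left_commute)
  qed (use assms in_su in \<open>simp_all\<close>)
  obtain K \<epsilon>0 where "0 < \<epsilon>0" "\<And>e d. \<bar>e\<bar> < \<epsilon>0 \<Longrightarrow> 0 \<le> d \<Longrightarrow> d < \<epsilon>0 \<Longrightarrow>
      \<bar>lyap M (T e (of_real d)) - (\<integral>s. q3 s \<partial>M) * d
        - (1/2 * (\<integral>s. (cmod (\<beta> s))\<^sup>2 \<partial>M) + Re (b1 * c0 / (1 - \<kappa>1))) * e\<^sup>2\<bar>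
      \<le> K * (\<bar>e\<bar>^3 + \<bar>e\<bar> * d + d\<^sup>2)"
    by (rule lyapunov_expansion) blast
  then show ?thesis
    unfolding Let_def b1_def c0_def \<kappa>1_def ph_def \<beta>_def by blast
qed

end
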